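(* For integers $a\ge b\ge0$ let $c_{ab}=\binom ab\binom{-2r}{a}$. Then $$\overline R_{(a\,b)}=\frac1{c_{ab}}\sum_\mu\binom{-2r}{\mu_1}\binom{\mu_1}{\mu_1-\mu_2,\dots,\mu_{n-1}-\mu_n,\mu_n}\,\mathbf e_\mu,$$ where the sum runs through all $\mu\in\Lambda$ with $\sum_{i\text{ odd}}\mu_i=a$ and $\sum_{i\text{ even}}\mu_i=b$.
   Context: Let $k$ be a field of characteristic zero, $n\ge 1$, $\mathcal P=k[z_1,\dots,z_n]$, and let $W\subseteq S_n$ be the group of permutations $\pi$ with $\pi(i)\equiv i \bmod 2$ for all $i$, acting by permuting variables. $\Lambda$ is the set of integer tuples $\lambda=(\lambda_1\ge\dots\ge\lambda_n\ge 0)$ and $|\lambda|_{\rm odd}=\sum_{i\text{ odd}}\lambda_i$. The symbol $(a\,b)$ denotes the element $(a,b,0,\dots,0)$ of $\Lambda$, and $(1^m)$ denotes the element of $\Lambda$ with $m$ entries $1$ followed by zeros. Fix $r\in k$ which is not a negative rational number and put $\rho=((n-1)r,(n-2)r,\dots,r,0)$. For $\lambda\in\Lambda$ let $[\lambda]_m=\lambda_m-\lambda_{m+1}+\dots+(-1)^{n-m}\lambda_n$ and $[\lambda]=([\lambda]_1,\dots,[\lambda]_n)$. $R_\lambda(z;r)\in\mathcal P^W$ is the unique $W$-invariant polynomial of degree $|\lambda|_{\rm odd}$ which satisfies $R_\lambda(\rho+\mu;r)=0$ for all $\mu\in\Lambda$ with $|\mu|_{\rm odd}\le|\lambda|_{\rm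 odd}$, $\mu\ne\lambda$, and in which the monomial $z^{[\lambda]}$ has coefficient $1$ (it is known that this exists and is unique). $\overline R_\lambda$ is its homogeneous component of highest degree $|\lambda|_{\rm odd}$. $\mathbf e_m(z)=\overline R_{(1^m)}(z)$ for $1\le m\le n$; explicitly, with $z_{\rm odd}=(z_1,z_3,\dots)$, $z_{\rm even}=(z_2,z_4,\dots)$ and $e_p$ the usual elementary symmetric polynomials, $\mathbf e_{2p-1}(z)=e_p(z_{\rm odd})-e_p(z_{\rm even})$ and $\mathbf e_{2p}(z)=e_p(z_{\rm even})$. For $\mu\in\Lambda$, $\mathbf e_\mu=\mathbf e_1^{\mu_1-\mu_2}\mathbf e_2^{\mu_2-\mu_3}\cdots\mathbf e_{n-1}^{\mu_{n-1}-\mu_n}\mathbf e_n^{\mu_n}$. For $x\in k$ and an integer $d\ge0$, $\binom xd=x(x-1)\cdots(x-d+1)/d!$, and $\binom{d}{k_1,\dots,k_n}=\frac{d!}{k_1!\cdots k_n!}$ for $d=k_1+\dots+k_n$.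
   Formalization: The case r = 0 with a > 0 is excluded, because there c_ab = 0 and the factor 1/c_ab is undefined; for n = 1 only b = 0 is considered, since otherwise (a b) is not an element of Λ. *)

theory Defs
  imports Complex_Main "HOL-Library.Poly_Mapping" "HOL-Combinatorics.Permutations"
begin

text \<open>
  Polynomials over a field are finitely supported functions on monomials, and a monomial is a
  finitely supported exponent function on the variable indices.  The polynomial ring in
  the variables with indices \<open>1, \<dots>, n\<close> is the set \<open>polys n\<close>.
\<close>

type_synonym monom = "nat \<Rightarrow>\<^sub>0 nat"
type_synonym 'a mpoly = "monom \<Rightarrow>\<^sub>0 'a"

definition polys :: "nat \<Rightarrow> 'a::zero mpoly set" where
  "polys n = {p. \<forall>m\<in>Poly_Mapping.keys p. Poly_Mapping.keys m \<subseteq> {1..n}}"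

definition const :: "'a::zero \<Rightarrow> 'a mpoly" where
  "const c = Poly_Mapping.single 0 c"

definition mdeg :: "monom \<Rightarrow> nat" where
  "mdeg m = (\<Sum>i\<in>Poly_Mapping.keys m. Poly_Mapping.lookup m i)"

definition total_degree :: "'a::zero mpoly \<Rightarrow> nat" where
  "total_degree p = Max (insert 0 (mdeg ` Poly_Mapping.keys p))"

definition eval_poly :: "(nat \<Rightarrow> 'a) \<Rightarrow> 'a::comm_semiring_1 mpoly \<Rightarrow> 'a" where
  "eval_poly z p = (\<Sum>m\<in>Poly_Mapping.keys p.
     Poly_Mapping.lookup p m * (\<Prod>i\<in>Poly_Mapping.keys m. z i ^ Poly_Mapping.lookup m i))"

definition homogeneous_component :: "nat \<Rightarrow> 'a::comm_monoid_add mpoly \<Rightarrow> 'a mpoly" where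
  "homogeneous_component d p =
     (\<Sum>m\<in>{m \<in> Poly_Mapping.keys p. mdeg m = d}. Poly_Mapping.single m (Poly_Mapping.lookup p m))"

definition W :: "nat \<Rightarrow> (nat \<Rightarrow> nat) set" where
  "W n = {\<pi>. \<pi> permutes {1..n} \<and> (\<forall>i\<in>{1..n}. \<pi> i mod 2 = i mod 2)}"

text \<open>
  The coefficient of \<open>m\<close> in \<open>permute_vars \<pi> p\<close> is the coefficient of \<open>m \<circ> \<pi>\<close> in \<open>p\<close>; for a
  permutation \<open>\<pi>\<close> this substitutes the variable with index \<open>\<pi> i\<close> for the one with index \<open>i\<close>.
\<close>

definition permute_vars :: "(nat \<Rightarrow> nat) \<Rightarrow> 'a::zero mpoly \<Rightarrow> 'a mpoly" where
  "permute_vars \<pi> p = Poly_Mapping.map_key (Poly_Mapping.map_key \<pi>) p"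

definition invariant_polys :: "nat \<Rightarrow> 'a::zero mpoly set" where
  "invariant_polys n = {p \<in> polys n. \<forall>\<pi>\<in>W n. permute_vars \<pi> p = p}"

text \<open>
  Tuples are indexed from 1 and extended by 0 outside \<open>{1..n}\<close>, so that \<open>\<lambda> (n + 1) = 0\<close>.
\<close>

definition Lambda :: "nat \<Rightarrow> (nat \<Rightarrow> nat) set" where
  "Lambda n = {l. (\<forall>i. i \<notin> {1..n} \<longrightarrow> l i = 0) \<and> (\<forall>i\<in>{1..<n}. l (i + 1) \<le> l i)}"

definition odd_size :: "nat \<Rightarrow> (nat \<Rightarrow> nat) \<Rightarrow> nat" where
  "odd_size n l = (\<Sum>i\<in>{i \<in> {1..n}. odd i}. l i)"

definition even_size :: "nat \<Rightarrow> (nat \<Rightarrow> nat) \<Rightarrow> nat" where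
  "even_size n l = (\<Sum>i\<in>{i \<in> {1..n}. even i}. l i)"

definition bracket :: "nat \<Rightarrow> (nat \<Rightarrow> nat) \<Rightarrow> nat \<Rightarrow> int" where
  "bracket n l m = (\<Sum>j=m..n. (- 1) ^ (j - m) * int (l j))"

text \<open>
  For \<open>l \<in> Lambda n\<close> all the alternating sums \<open>bracket n l m\<close> are nonnegative, so \<open>nat\<close> below
  loses nothing.
\<close>

definition bracket_monom :: "nat \<Rightarrow> (nat \<Rightarrow> nat) \<Rightarrow> monom" where
  "bracket_monom n l = (\<Sum>m=1..n. Poly_Mapping.single m (nat (bracket n l m)))"

definition rho :: "nat \<Rightarrow> 'a::field_char_0 \<Rightarrow> nat \<Rightarrow> 'a" where
  "rho n r i = of_nat (n - i) * r"

definition is_R :: "nat \<Rightarrow> 'a::field_char_0 \<Rightarrow> (nat \<Rightarrow> nat) \<Rightarrow> 'a mpoly \<Rightarrow> bool" where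
  "is_R n r l p \<longleftrightarrow>
     p \<in> invariant_polys n \<and>
     total_degree p = odd_size n l \<and>
     (\<forall>\<mu>\<in>Lambda n. odd_size n \<mu> \<le> odd_size n l \<and> \<mu> \<noteq> l \<longrightarrow>
        eval_poly (\<lambda>i. rho n r i + of_nat (\<mu> i)) p = 0) \<and>
     Poly_Mapping.lookup p (bracket_monom n l) = 1"

definition R :: "nat \<Rightarrow> 'a::field_char_0 \<Rightarrow> (nat \<Rightarrow> nat) \<Rightarrow> 'a mpoly" where
  "R n r l = (THE p. is_R n r l p)"

definition R_bar :: "nat \<Rightarrow> 'a::field_char_0 \<Rightarrow> (nat \<Rightarrow> nat) \<Rightarrow> 'a mpoly" where
  "R_bar n r l = homogeneous_component (odd_size n l) (R n r l)"

definition column :: "nat \<Rightarrow> nat \<Rightarrow> nat" where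
  "column m = (\<lambda>i. if 1 \<le> i \<and> i \<le> m then 1 else 0)"

definition two_row :: "nat \<Rightarrow> nat \<Rightarrow> nat \<Rightarrow> nat" where
  "two_row a b = (\<lambda>i. if i = 1 then a else if i = 2 then b else 0)"

definition e_gen :: "nat \<Rightarrow> 'a::field_char_0 \<Rightarrow> nat \<Rightarrow> 'a mpoly" where
  "e_gen n r m = R_bar n r (column m)"

definition e_prod :: "nat \<Rightarrow> 'a::field_char_0 \<Rightarrow> (nat \<Rightarrow> nat) \<Rightarrow> 'a mpoly" where
  "e_prod n r \<mu> = (\<Prod>m=1..n. e_gen n r m ^ (\<mu> m - \<mu> (m + 1)))"

text \<open>
  The multinomial coefficient with lower entries the differences of consecutive parts of \<open>\<mu>\<close>;
  these differences add up to \<open>\<mu> 1\<close>.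
\<close>

definition diff_multinomial :: "nat \<Rightarrow> (nat \<Rightarrow> nat) \<Rightarrow> 'a::field_char_0" where
  "diff_multinomial n \<mu> = fact (\<mu> 1) / (\<Prod>m=1..n. fact (\<mu> m - \<mu> (m + 1)))"

text \<open>
  If \<open>r\<close> is not a negative rational number and \<open>b \<le> a\<close>, then \<open>c_coeff r a b\<close> vanishes exactly
  when \<open>r = 0\<close> and \<open>a > 0\<close>.
\<close>

definition c_coeff :: "'a::field_char_0 \<Rightarrow> nat \<Rightarrow> nat \<Rightarrow> 'a" where
  "c_coeff r a b = of_nat (a choose b) * ((- 2 * r) gchoose a)"

end

theory Submission
  imports Defs "HOL-Computational_Algebra.Formal_Power_Series"
begin

text \<open>
  A \<open>W\<close>-invariant polynomial of degree at most \<open>d\<close> that vanishes at all \<open>\<rho> + \<mu>\<close> with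
  \<open>|\<mu>|\<close> (the odd size) at most \<open>d\<close> is zero, so \<open>R_\<lambda>\<close> is determined by its defining
  properties and it suffices to exhibit a polynomial that has them.  With \<open>u = 1 / v\<close> and
  \<open>k = a - b\<close>, consider for \<open>0 \<le> j \<le> k\<close> the product \<open>\<Psi>_j(u; z)\<close> of the factors
  \<open>\<Gamma>(u + z_i + r + j) / \<Gamma>(u + z_i + r)\<close> for odd \<open>i\<close> and
  \<open>\<Gamma>(u + z_i) / \<Gamma>(u + z_i + 2 r + j)\<close> for even \<open>i\<close>.  At \<open>z = \<rho> + \<mu>\<close> the product
  telescopes, and \<open>\<Psi>_j(u; \<rho> + \<mu>) / \<Psi>_j(u; \<rho>)\<close> becomes a polynomial of degree at most
  \<open>\<mu>_1\<close> divided by the rising factorial of \<open>u + n r\<close> of length \<open>\<mu>_1\<close>.  Hence the \<open>a\<close>-th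
  coefficient of its expansion in inverse factorials of \<open>u + n r\<close> vanishes for \<open>\<mu>_1 < a\<close>, and
  for \<open>\<mu> = (a d)\<close> it is a constant independent of \<open>j\<close> times the binomial coefficient
  \<open>j\<close> over \<open>a - d\<close>.  The \<open>k\<close>-th finite difference in \<open>j\<close> therefore vanishes unless
  \<open>d = b\<close>, and is a multiple of \<open>R_(a b)\<close>.  Its top component is the coefficient of \<open>v^a\<close> in
  \<open>(E_odd - E_even)^k E_even^(- 2 r - k)\<close>, where \<open>E_odd\<close> and \<open>E_even\<close> are the products of
  \<open>1 + z_i v\<close> over odd and even \<open>i\<close>; since the coefficients of \<open>E_odd - E_even\<close> and
  \<open>E_even\<close> are the \<open>e_m\<close>, the multinomial theorem gives the formula.
\<close>

section \<open>Polynomial functions\<close>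

definition eval_monom :: "(nat \<Rightarrow> 'a) \<Rightarrow> monom \<Rightarrow> 'a::comm_semiring_1" where
  "eval_monom z m = (\<Prod>i\<in>Poly_Mapping.keys m. z i ^ Poly_Mapping.lookup m i)"

lemma eval_monom_superset:
  assumes "finite S" "Poly_Mapping.keys m \<subseteq> S"
  shows "eval_monom z m = (\<Prod>i\<in>S. z i ^ Poly_Mapping.lookup m i)"
  unfolding eval_monom_def
  by (rule prod.mono_neutral_left) (use assms in \<open>auto simp: in_keys_iff\<close>)

lemma eval_monom_add: "eval_monom z (m + m') = eval_monom z m * eval_monom z m'"
proof -
  let ?S = "Poly_Mapping.keys m \<union> Poly_Mapping.keys m'"
  have "Poly_Mapping.keys (m + m') \<subseteq> ?S" by (rule Poly_Mapping.keys_add)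
  then show ?thesis
    by (simp add: eval_monom_superset[of ?S] lookup_add power_add prod.distrib)
qed

lemma eval_monom_0 [simp]: "eval_monom z 0 = 1"
  by (simp add: eval_monom_def)

lemma eval_monom_single [simp]: "eval_monom z (Poly_Mapping.single i e) = z i ^ e"
  by (cases "e = 0") (simp_all add: eval_monom_def)

lemma mdeg_superset:
  assumes "finite S" "Poly_Mapping.keys m \<subseteq> S"
  shows "mdeg m = (\<Sum>i\<in>S. Poly_Mapping.lookup m i)"
  unfolding mdeg_def
  by (rule sum.mono_neutral_left) (use assms in \<open>auto simp: in_keys_iff\<close>)

lemma mdeg_add: "mdeg (m + m') = mdeg m + mdeg m'"
proof -
  let ?S = "Poly_Mapping.keys m \<union> Poly_Mapping.keys m'"
  have "Poly_Mapping.keys (m + m') \<subseteq> ?S" by (rule Poly_Mapping.keys_add)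
  then show ?thesis
    by (simp add: mdeg_superset[of ?S] lookup_add sum.distrib)
qed

lemma mdeg_0 [simp]: "mdeg 0 = 0"
  by (simp add: mdeg_def)

lemma mdeg_single [simp]: "mdeg (Poly_Mapping.single i e) = e"
  by (cases "e = 0") (simp_all add: mdeg_def)

lemma eval_poly_superset:
  assumes "finite M" "Poly_Mapping.keys p \<subseteq> M"
  shows "eval_poly z p = (\<Sum>m\<in>M. Poly_Mapping.lookup p m * eval_monom z m)"
  unfolding eval_poly_def eval_monom_def
  by (rule sum.mono_neutral_left) (use assms in \<open>auto simp: in_keys_iff\<close>)

lemma eval_poly_add: "eval_poly z (p + q) = eval_poly z p + eval_poly z q"
proof -
  let ?M = "Poly_Mapping.keys p \<union> Poly_Mapping.keys q"
  have "Poly_Mapping.keys (p + q) \<subseteq> ?M" by (rule Poly_Mapping.keys_add)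
  then show ?thesis
    by (simp add: eval_poly_superset[of ?M] lookup_add distrib_right sum.distrib)
qed

lemma eval_poly_0 [simp]: "eval_poly z 0 = 0"
  by (simp add: eval_poly_def)

lemma eval_poly_single [simp]: "eval_poly z (Poly_Mapping.single m c) = c * eval_monom z m"
  by (cases "c = 0") (simp_all add: eval_poly_def eval_monom_def)

lemma eval_poly_const [simp]: "eval_poly z (const c) = c"
  by (simp add: const_def)

lemma eval_poly_1 [simp]: "eval_poly z 1 = 1"
  using eval_poly_single[of z 0 1] by simp

lemma eval_poly_sum: "eval_poly z (sum f A) = (\<Sum>x\<in>A. eval_poly z (f x))"
  by (induction A rule: infinite_finite_induct) (simp_all add: eval_poly_add)

lemma mpoly_sum_single: "p = (\<Sum>m\<in>Poly_Mapping.keys p. Poly_Mapping.single m (Poly_Mapping.lookup p m))"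
  by (rule poly_mapping_eqI)
    (simp add: lookup_sum lookup_single when_def in_keys_iff)

lemma eval_poly_mult: "eval_poly z (p * q) = eval_poly z p * eval_poly z q"
proof -
  have "p * q = (\<Sum>m\<in>Poly_Mapping.keys p. \<Sum>m'\<in>Poly_Mapping.keys q.
      Poly_Mapping.single (m + m') (Poly_Mapping.lookup p m * Poly_Mapping.lookup q m'))"
    by (subst (1) mpoly_sum_single[of p], subst (1) mpoly_sum_single[of q])
      (simp add: sum_product mult_single)
  then have "eval_poly z (p * q) = (\<Sum>m\<in>Poly_Mapping.keys p. \<Sum>m'\<in>Poly_Mapping.keys q.
      (Poly_Mapping.lookup p m * eval_monom z m) * (Poly_Mapping.lookup q m' * eval_monom z m'))"
    by (simp add: eval_poly_sum eval_monom_add ac_simps)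
  then show ?thesis
    by (simp add: eval_poly_superset[OF _ order.refl] sum_product)
qed

lemma eval_poly_power: "eval_poly z (p ^ k) = eval_poly z p ^ k"
  by (induction k) (simp_all add: eval_poly_mult)

lemma eval_poly_prod: "eval_poly z (prod f A) = (\<Prod>x\<in>A. eval_poly z (f x))"
  by (induction A rule: infinite_finite_induct) (simp_all add: eval_poly_mult)

text \<open>
  Dedekind's argument: scaling one variable by 2 separates two distinct monomials, which shortens a
  linear relation.
\<close>

lemma eval_monom_linear_independent:
  fixes c :: "monom \<Rightarrow> 'a::field_char_0"
  assumes "finite M"
    and "\<And>z. (\<And>i. z i \<noteq> 0) \<Longrightarrow> (\<Sum>m\<in>M. c m * eval_monom z m) = 0"
    and "m \<in> M"
  shows "c m = 0"
  using assms
proof (induction M arbitrary: c m rule: finite_induct)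
  case empty
  then show ?case by simp
next
  case (insert m0 M)
  have zero: "c m = 0" if "m \<in> M" for m
  proof -
    from that insert.hyps have "m \<noteq> m0" by auto
    then obtain i where i: "Poly_Mapping.lookup m i \<noteq> Poly_Mapping.lookup m0 i"
      by (meson poly_mapping_eqI)
    define s where "s = (\<lambda>z::nat \<Rightarrow> 'a. \<lambda>j. if j = i then 2 * z j else z j)"
    have s: "eval_monom (s z) m' = 2 ^ Poly_Mapping.lookup m' i * eval_monom z m'" for z m'
    proof -
      let ?S = "insert i (Poly_Mapping.keys m')"
      have "eval_monom (s z) m' =
          (\<Prod>j\<in>?S. (if j = i then 2 ^ Poly_Mapping.lookup m' i else 1) * z j ^ Poly_Mapping.lookup m' j)"
        by (subst eval_monom_superset[of ?S])
          (auto simp: s_def power_mult_distrib intro!: prod.cong)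
      also have "\<dots> = 2 ^ Poly_Mapping.lookup m' i * (\<Prod>j\<in>?S. z j ^ Poly_Mapping.lookup m' j)"
        by (simp add: prod.distrib del: prod.insert)
      also have "(\<Prod>j\<in>?S. z j ^ Poly_Mapping.lookup m' j) = eval_monom z m'"
        by (rule eval_monom_superset[symmetric]) auto
      finally show ?thesis .
    qed
    have "c m * (2 ^ Poly_Mapping.lookup m i - 2 ^ Poly_Mapping.lookup m0 i) = 0"
    proof (rule insert.IH[OF _ that])
      fix z :: "nat \<Rightarrow> 'a" assume z: "\<And>i. z i \<noteq> 0"
      have "(\<Sum>m\<in>insert m0 M. c m * eval_monom (s z) m) = 0"
        by (rule insert.prems) (use z in \<open>auto simp: s_def\<close>)
      moreover have "(\<Sum>m\<in>insert m0 M. c m * eval_monom z m) = 0"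
        by (rule insert.prems) (use z in auto)
      ultimately have "(\<Sum>m\<in>insert m0 M. c m * eval_monom (s z) m)
          - 2 ^ Poly_Mapping.lookup m0 i * (\<Sum>m\<in>insert m0 M. c m * eval_monom z m) = 0"
        by simp
      moreover have "(\<Sum>m\<in>insert m0 M. c m * eval_monom (s z) m)
          - 2 ^ Poly_Mapping.lookup m0 i * (\<Sum>m\<in>insert m0 M. c m * eval_monom z m)
          = (\<Sum>m\<in>insert m0 M. c m * (2 ^ Poly_Mapping.lookup m i - 2 ^ Poly_Mapping.lookup m0 i) * eval_monom z m)"
        unfolding s sum_distrib_left sum_subtractf[symmetric]
        by (rule sum.cong) (auto simp: algebra_simps)
      ultimately show "(\<Sum>m\<in>M. c m * (2 ^ Poly_Mapping.lookup m i - 2 ^ Poly_Mapping.lookup m0 i) * eval_monom z m) = 0"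
        using insert.hyps by simp
    qed
    moreover have "(2::'a) ^ Poly_Mapping.lookup m i \<noteq> 2 ^ Poly_Mapping.lookup m0 i"
    proof
      assume "(2::'a) ^ Poly_Mapping.lookup m i = 2 ^ Poly_Mapping.lookup m0 i"
      then have "(of_nat (2 ^ Poly_Mapping.lookup m i) :: 'a) = of_nat (2 ^ Poly_Mapping.lookup m0 i)"
        by simp
      then have "(2::nat) ^ Poly_Mapping.lookup m i = 2 ^ Poly_Mapping.lookup m0 i"
        by (simp only: of_nat_eq_iff)
      with i show False by simp
    qed
    ultimately show ?thesis by simp
  qed
  have "(\<Sum>m\<in>insert m0 M. c m * eval_monom (\<lambda>_. 1) m) = 0"
    by (rule insert.prems) auto
  then have "c m0 = 0"
    using insert.hyps zero by (simp add: eval_monom_def)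
  with zero insert.prems show ?case by auto
qed

lemma lookup_eq_0_of_eval_eq_0:
  fixes p :: "'a::field_char_0 mpoly"
  assumes "\<And>z. (\<And>i. z i \<noteq> 0) \<Longrightarrow> eval_poly z p = 0"
  shows "Poly_Mapping.lookup p m = 0"
proof (cases "m \<in> Poly_Mapping.keys p")
  case True
  show ?thesis
    by (rule eval_monom_linear_independent[OF finite_keys _ True])
      (use assms in \<open>auto simp: eval_poly_superset[OF _ order.refl]\<close>)
qed (auto simp: in_keys_iff)

text \<open>Only points without zero coordinates are tested, so an identity may be checked after
  multiplying both sides by a product of variables.\<close>

lemma mpoly_eqI:
  fixes p q :: "'a::field_char_0 mpoly"
  assumes "\<And>z. (\<And>i. z i \<noteq> 0) \<Longrightarrow> eval_poly z p = eval_poly z q"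
  shows "p = q"
proof -
  have "Poly_Mapping.lookup (p - q) m = 0" for m
  proof (rule lookup_eq_0_of_eval_eq_0)
    fix z :: "nat \<Rightarrow> 'a" assume "\<And>i. z i \<noteq> 0"
    then have "eval_poly z (p - q) + eval_poly z q = eval_poly z q"
      using assms[of z] eval_poly_add[of z "p - q" q] by simp
    then show "eval_poly z (p - q) = 0" by simp
  qed
  then show ?thesis
    by (intro poly_mapping_eqI) (simp add: lookup_minus)
qed

text \<open>Setting the variables outside \<open>S\<close> to zero kills exactly the monomials that
  involve one of them, so the values at such points determine the remaining coefficients.\<close>

lemma lookup_eq_of_eval_eq_on:
  fixes p q :: "'a::field_char_0 mpoly"
  assumes eq: "\<And>z. (\<And>i. i \<notin> S \<Longrightarrow> z i = 0) \<Longrightarrow> eval_poly z p = eval_poly z q"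
    and m: "Poly_Mapping.keys m \<subseteq> S"
  shows "Poly_Mapping.lookup p m = Poly_Mapping.lookup q m"
proof -
  define res where "res = (\<lambda>p::'a mpoly. \<Sum>m\<in>{m \<in> Poly_Mapping.keys p. Poly_Mapping.keys m \<subseteq> S}.
    Poly_Mapping.single m (Poly_Mapping.lookup p m))"
  have lookup: "Poly_Mapping.lookup (res p) m = Poly_Mapping.lookup p m" for p
    using m by (simp add: res_def lookup_sum lookup_single when_def in_keys_iff)
  have eval: "eval_poly z (res p) = eval_poly (\<lambda>i. if i \<in> S then z i else 0) p" for z p
  proof -
    have "eval_monom (\<lambda>i. if i \<in> S then z i else 0) m = (if Poly_Mapping.keys m \<subseteq> S then eval_monom z m else 0)"
      for m
    proof (cases "Poly_Mapping.keys m \<subseteq> S")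
      case True
      then have "eval_monom (\<lambda>i. if i \<in> S then z i else 0) m = eval_monom z m"
        unfolding eval_monom_def by (intro prod.cong) auto
      with True show ?thesis by simp
    next
      case False
      then obtain i where "i \<in> Poly_Mapping.keys m" "i \<notin> S" by auto
      then have "eval_monom (\<lambda>i. if i \<in> S then z i else 0) m = 0"
        unfolding eval_monom_def by (intro prod_zero bexI[of _ i]) (auto simp: in_keys_iff)
      with False show ?thesis by simp
    qed
    then show ?thesis
      by (simp add: eval_poly_superset[OF _ order.refl, of p] res_def eval_poly_sum
          if_distrib[of "(*) _"] if_distrib[of "eval_poly _"] sum.inter_filter cong: if_cong)
  qed
  have "res p = res q"
    by (rule mpoly_eqI) (auto simp: eval intro!: eq)
  then show ?thesis
    using lookup[of p] lookup[of q] by simp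
qed

text \<open>\<open>D\<close> lists the degrees allowed for monomials: \<open>{..d}\<close> bounds
  the degree, \<open>{..<d}\<close> bounds it strictly and \<open>{d}\<close> means homogeneous, so
  that one set of closure rules serves all three.\<close>

definition poly_fun :: "nat \<Rightarrow> nat set \<Rightarrow> ((nat \<Rightarrow> 'a) \<Rightarrow> 'a::comm_semiring_1) \<Rightarrow> bool" where
  "poly_fun n D f \<longleftrightarrow>
     (\<exists>p\<in>polys n. (\<forall>m\<in>Poly_Mapping.keys p. mdeg m \<in> D) \<and> (\<forall>z. eval_poly z p = f z))"

lemma poly_funI:
  "p \<in> polys n \<Longrightarrow> (\<And>m. m \<in> Poly_Mapping.keys p \<Longrightarrow> mdeg m \<in> D) \<Longrightarrow> (\<And>z. eval_poly z p = f z)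
    \<Longrightarrow> poly_fun n D f"
  unfolding poly_fun_def by blast

lemma poly_funE:
  assumes "poly_fun n D f"
  obtains p where "p \<in> polys n" "\<And>m. m \<in> Poly_Mapping.keys p \<Longrightarrow> mdeg m \<in> D" "\<And>z. eval_poly z p = f z"
  using assms unfolding poly_fun_def by blast

lemma poly_fun_mono: "poly_fun n D f \<Longrightarrow> D \<subseteq> E \<Longrightarrow> poly_fun n E f"
  unfolding poly_fun_def by blast

lemma poly_fun_zero: "poly_fun n D (\<lambda>_. 0)"
  by (rule poly_funI[of 0]) (auto simp: polys_def)

lemma poly_fun_monom:
  assumes "Poly_Mapping.keys m \<subseteq> {1..n}" "mdeg m \<in> D"
  shows "poly_fun n D (\<lambda>z. c * eval_monom z m)"
  by (rule poly_funI[of "Poly_Mapping.single m c"])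
    (use assms in \<open>auto simp: polys_def split: if_splits\<close>)

lemma poly_fun_const: "0 \<in> D \<Longrightarrow> poly_fun n D (\<lambda>_. c)"
  using poly_fun_monom[of 0 n D c] by simp

lemma poly_fun_var: "i \<in> {1..n} \<Longrightarrow> 1 \<in> D \<Longrightarrow> poly_fun n D (\<lambda>z. z i)"
  using poly_fun_monom[of "Poly_Mapping.single i 1" n D 1] by simp

lemma poly_fun_add:
  assumes "poly_fun n D f" "poly_fun n D g"
  shows "poly_fun n D (\<lambda>z. f z + g z)"
proof -
  from assms(1) obtain p where p: "p \<in> polys n" "\<And>m. m \<in> Poly_Mapping.keys p \<Longrightarrow> mdeg m \<in> D"
    "\<And>z. eval_poly z p = f z" by (rule poly_funE) blast
  from assms(2) obtain q where q: "q \<in> polys n" "\<And>m. m \<in> Poly_Mapping.keys q \<Longrightarrow> mdeg m \<in> D"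
    "\<And>z. eval_poly z q = g z" by (rule poly_funE) blast
  have keys: "m \<in> Poly_Mapping.keys p \<or> m \<in> Poly_Mapping.keys q" if "m \<in> Poly_Mapping.keys (p + q)" for m
    using that Poly_Mapping.keys_add[of p q] by blast
  show ?thesis
  proof (rule poly_funI[of "p + q"])
    show "p + q \<in> polys n"
      using keys p(1) q(1) unfolding polys_def by blast
    show "mdeg m \<in> D" if "m \<in> Poly_Mapping.keys (p + q)" for m
      using keys[OF that] p(2) q(2) by blast
  qed (simp add: eval_poly_add p q)
qed

lemma poly_fun_mult:
  assumes "poly_fun n D f" "poly_fun n E g" "\<And>d e. d \<in> D \<Longrightarrow> e \<in> E \<Longrightarrow> d + e \<in> F"
  shows "poly_fun n F (\<lambda>z. f z * g z)"
proof -
  from assms(1) obtain p where p: "p \<in> polys n" "\<And>m. m \<in> Poly_Mapping.keys p \<Longrightarrow> mdeg m \<in> D"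
    "\<And>z. eval_poly z p = f z" by (rule poly_funE) blast
  from assms(2) obtain q where q: "q \<in> polys n" "\<And>m. m \<in> Poly_Mapping.keys q \<Longrightarrow> mdeg m \<in> E"
    "\<And>z. eval_poly z q = g z" by (rule poly_funE) blast
  have keys: "\<exists>a b. m = a + b \<and> a \<in> Poly_Mapping.keys p \<and> b \<in> Poly_Mapping.keys q"
    if "m \<in> Poly_Mapping.keys (p * q)" for m
    using that Poly_Mapping.keys_mult[of p q] by blast
  show ?thesis
  proof (rule poly_funI[of "p * q"])
    show "p * q \<in> polys n"
      unfolding polys_def
    proof (intro CollectI ballI)
      fix m assume "m \<in> Poly_Mapping.keys (p * q)"
      then obtain a b where "m = a + b" "a \<in> Poly_Mapping.keys p" "b \<in> Poly_Mapping.keys q"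
        using keys by blast
      then show "Poly_Mapping.keys m \<subseteq> {1..n}"
        using p(1) q(1) Poly_Mapping.keys_add[of a b] unfolding polys_def by blast
    qed
    show "mdeg m \<in> F" if "m \<in> Poly_Mapping.keys (p * q)" for m
      using keys[OF that] p(2) q(2) assms(3) by (auto simp: mdeg_add)
  qed (simp add: eval_poly_mult p q)
qed

lemma poly_fun_sum:
  "(\<And>x. x \<in> A \<Longrightarrow> poly_fun n D (f x)) \<Longrightarrow> poly_fun n D (\<lambda>z. \<Sum>x\<in>A. f x z)"
proof (induction A rule: infinite_finite_induct)
  case (insert x A)
  then have "poly_fun n D (\<lambda>z. f x z + (\<Sum>x\<in>A. f x z))"
    by (intro poly_fun_add) auto
  with insert.hyps show ?case by simp
qed (auto intro: poly_fun_zero)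

lemma poly_fun_diff:
  fixes f g :: "(nat \<Rightarrow> 'a) \<Rightarrow> 'a::comm_ring_1"
  assumes "poly_fun n D f" "poly_fun n D g"
  shows "poly_fun n D (\<lambda>z. f z - g z)"
  using poly_fun_add[OF assms(1) poly_fun_mult[OF poly_fun_const[of "{0}" n "-1"] assms(2)]] by simp

lemma poly_fun_power:
  "poly_fun n {..d} f \<Longrightarrow> poly_fun n {..k * d} (\<lambda>z. f z ^ k)"
proof (induction k)
  case (Suc k)
  then have "poly_fun n {..Suc k * d} (\<lambda>z. f z * f z ^ k)"
    by (intro poly_fun_mult[where D = "{..d}" and E = "{..k * d}"]) auto
  then show ?case by simp
qed (auto intro: poly_fun_const)

lemma poly_fun_prod:
  "(\<And>x. x \<in> A \<Longrightarrow> poly_fun n {..d x} (f x)) \<Longrightarrow> poly_fun n {..sum d A} (\<lambda>z. \<Prod>x\<in>A. f x z)"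
proof (induction A rule: infinite_finite_induct)
  case (insert x A)
  then have "poly_fun n {..d x + sum d A} (\<lambda>z. f x z * (\<Prod>x\<in>A. f x z))"
    by (intro poly_fun_mult[where D = "{..d x}" and E = "{..sum d A}"]) auto
  with insert.hyps show ?case by simp
qed (auto intro: poly_fun_const)

text \<open>Affine substitutions do not raise the degree. This covers the shifts, the permutations
  and the restriction to a hyperplane needed below.\<close>

lemma poly_fun_subst:
  assumes f: "poly_fun n {..d} f" and s: "\<And>i. i \<in> {1..n} \<Longrightarrow> poly_fun n' {..1} (\<lambda>z. s z i)"
  shows "poly_fun n' {..d} (\<lambda>z. f (s z))"
proof -
  from f obtain p where p: "p \<in> polys n" "\<And>m. m \<in> Poly_Mapping.keys p \<Longrightarrow> mdeg m \<in> {..d}"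
    "\<And>z. eval_poly z p = f z" by (rule poly_funE) blast
  have "poly_fun n' {..d} (\<lambda>z. \<Sum>m\<in>Poly_Mapping.keys p. Poly_Mapping.lookup p m * eval_monom (s z) m)"
  proof (rule poly_fun_sum)
    fix m assume m: "m \<in> Poly_Mapping.keys p"
    then have sub: "Poly_Mapping.keys m \<subseteq> {1..n}" using p(1) by (auto simp: polys_def)
    have "poly_fun n' {..\<Sum>i\<in>Poly_Mapping.keys m. Poly_Mapping.lookup m i * 1}
        (\<lambda>z. \<Prod>i\<in>Poly_Mapping.keys m. s z i ^ Poly_Mapping.lookup m i)"
      by (intro poly_fun_prod poly_fun_power s) (use sub in auto)
    then have "poly_fun n' {..mdeg m} (\<lambda>z. eval_monom (s z) m)"
      by (simp add: eval_monom_def mdeg_def)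
    then show "poly_fun n' {..d} (\<lambda>z. Poly_Mapping.lookup p m * eval_monom (s z) m)"
      by (rule poly_fun_mult[where D = "{0}" and E = "{..mdeg m}", rotated])
        (use p(2)[OF m] in \<open>auto intro: poly_fun_const\<close>)
  qed
  then show ?thesis
    by (simp add: eval_poly_superset[OF _ order.refl] flip: p(3))
qed

lemma poly_fun_cong_on:
  assumes "poly_fun n D f" "\<And>i. i \<in> {1..n} \<Longrightarrow> z i = w i"
  shows "f z = f w"
proof -
  from assms(1) obtain p where p: "p \<in> polys n" "\<And>z. eval_poly z p = f z"
    by (rule poly_funE) blast
  have "eval_monom z m = eval_monom w m" if "m \<in> Poly_Mapping.keys p" for m
  proof -
    have "Poly_Mapping.keys m \<subseteq> {1..n}" using that p(1) by (simp add: polys_def)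
    then show ?thesis
      unfolding eval_monom_def by (intro prod.cong refl arg_cong2[of _ _ _ _ "(^)"] assms(2)) auto
  qed
  then show ?thesis
    by (simp add: eval_poly_superset[OF _ order.refl] flip: p(2))
qed

lemma poly_fun_eq_0:
  fixes f :: "(nat \<Rightarrow> 'a::field_char_0) \<Rightarrow> 'a"
  assumes "poly_fun n D f" "\<And>z. (\<And>i. z i \<noteq> 0) \<Longrightarrow> f z = 0"
  shows "f z = 0"
proof -
  from assms(1) obtain p where p: "\<And>z. eval_poly z p = f z" by (rule poly_funE) blast
  then have "p = 0" using assms(2) by (intro mpoly_eqI) auto
  then show ?thesis using p[of z] by simp
qed

section \<open>Uniqueness of the interpolation polynomials\<close>

lemma lookup_map_key: "inj f \<Longrightarrow> Poly_Mapping.lookup (Poly_Mapping.map_key f p) x = Poly_Mapping.lookup p (f x)"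
  by (simp add: map_key.rep_eq)

lemma
  assumes "bij \<pi>"
  shows map_key_inv_left: "Poly_Mapping.map_key \<pi> (Poly_Mapping.map_key (inv \<pi>) m) = m"
    and map_key_inv_right: "Poly_Mapping.map_key (inv \<pi>) (Poly_Mapping.map_key \<pi> m) = m"
    and inj_map_key: "inj (Poly_Mapping.map_key \<pi> :: monom \<Rightarrow> monom)"
proof -
  have inj: "inj \<pi>" "inj (inv \<pi>)"
    using assms by (auto simp: bij_def surj_imp_inj_inv)
  show "Poly_Mapping.map_key \<pi> (Poly_Mapping.map_key (inv \<pi>) m) = m" for m
    by (rule poly_mapping_eqI) (use inj assms in \<open>simp add: lookup_map_key bij_is_inj\<close>)
  show *: "Poly_Mapping.map_key (inv \<pi>) (Poly_Mapping.map_key \<pi> m) = m" for m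
    by (rule poly_mapping_eqI) (use inj assms in \<open>simp add: lookup_map_key surj_f_inv_f bij_is_surj\<close>)
  show "inj (Poly_Mapping.map_key \<pi> :: monom \<Rightarrow> monom)"
    by (rule inj_on_inverseI[of _ "Poly_Mapping.map_key (inv \<pi>)"])
      (rule poly_mapping_eqI, use inj assms in \<open>simp add: lookup_map_key surj_f_inv_f bij_is_surj\<close>)
qed

lemma eval_permute_vars:
  assumes "bij \<pi>"
  shows "eval_poly z (permute_vars \<pi> p) = eval_poly (z \<circ> \<pi>) p"
proof -
  let ?K = "Poly_Mapping.map_key \<pi> :: monom \<Rightarrow> monom"
  have injK: "inj ?K" using assms by (rule inj_map_key)
  have inj: "inj \<pi>" using assms by (rule bij_is_inj)
  have mon: "eval_monom (z \<circ> \<pi>) (?K m) = eval_monom z m" for m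
  proof -
    have "Poly_Mapping.keys m = \<pi> ` (\<pi> -` Poly_Mapping.keys m)"
      using assms by (simp add: bij_def surj_image_vimage_eq)
    then show ?thesis
      unfolding eval_monom_def keys_map_key[OF inj]
      by (subst (2) \<open>Poly_Mapping.keys m = _\<close>, subst prod.reindex)
        (use inj in \<open>auto simp: lookup_map_key intro: inj_on_subset\<close>)
  qed
  have keys: "?K ` Poly_Mapping.keys (permute_vars \<pi> p) = Poly_Mapping.keys p"
  proof -
    have "surj ?K" by (rule surjI, rule map_key_inv_left[OF assms])
    then show ?thesis
      by (simp add: permute_vars_def keys_map_key[OF injK] surj_image_vimage_eq)
  qed
  have "eval_poly (z \<circ> \<pi>) p = (\<Sum>m\<in>?K ` Poly_Mapping.keys (permute_vars \<pi> p). Poly_Mapping.lookup p m * eval_monom (z \<circ> \<pi>) m)"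
    by (simp add: keys eval_poly_superset[OF _ order.refl])
  also have "\<dots> = (\<Sum>m\<in>Poly_Mapping.keys (permute_vars \<pi> p). Poly_Mapping.lookup p (?K m) * eval_monom z m)"
    by (subst sum.reindex) (use injK in \<open>auto simp: mon intro: inj_on_subset\<close>)
  also have "\<dots> = eval_poly z (permute_vars \<pi> p)"
    by (simp add: eval_poly_superset[OF _ order.refl] permute_vars_def lookup_map_key[OF injK])
  finally show ?thesis by simp
qed

lemma invariant_polys_iff:
  fixes p :: "'a::field_char_0 mpoly"
  shows "p \<in> invariant_polys n \<longleftrightarrow> p \<in> polys n \<and> (\<forall>\<pi>\<in>W n. \<forall>z. eval_poly (z \<circ> \<pi>) p = eval_poly z p)"
proof -
  have "permute_vars \<pi> p = p \<longleftrightarrow> (\<forall>z. eval_poly (z \<circ> \<pi>) p = eval_poly z p)" if "\<pi> \<in> W n" for \<pi>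
  proof -
    have "bij \<pi>" using that by (auto simp: W_def intro: permutes_bij)
    show ?thesis
      unfolding eval_permute_vars[OF \<open>bij \<pi>\<close>, symmetric] by (auto intro: mpoly_eqI)
  qed
  then show ?thesis by (auto simp: invariant_polys_def)
qed

lemma odd_size_Suc: "odd_size (Suc n) l = odd_size n l + (if odd (Suc n) then l (Suc n) else 0)"
proof -
  have "{i \<in> {1..Suc n}. odd i} = (if odd (Suc n) then insert (Suc n) {i \<in> {1..n}. odd i} else {i \<in> {1..n}. odd i})"
    by (auto simp: le_Suc_eq)
  then show ?thesis by (simp add: odd_size_def)
qed

lemma rho_plus_one: "i \<le> n \<Longrightarrow> rho n r i + r = rho (Suc n) r i"
  by (simp add: rho_def Suc_diff_le algebra_simps)

text \<open>For even \<open>n\<close> the map \<open>Suc\<close> carries the odd indices onto the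
  even ones. The degree of the product of all z_i with i congruent to n is therefore the amount by
  which adding 1 to every part raises the odd size.\<close>

lemma card_same_parity: "card {i::nat. i \<in> {1..n} \<and> i mod 2 = n mod 2} = card {i \<in> {1..n}. odd i}"
proof (cases "odd n")
  case True
  then show ?thesis by (auto simp: mod2_eq_if intro!: arg_cong[of _ _ card])
next
  case False
  have "{i \<in> {1..n}. i mod 2 = n mod 2} = Suc ` {i::nat. i \<in> {1..n} \<and> odd i}"
  proof (intro equalityI subsetI)
    fix i assume "i \<in> {i \<in> {1..n}. i mod 2 = n mod 2}"
    then have "1 \<le> i" "i \<le> n" "even i" using False by (simp_all add: even_iff_mod_2_eq_zero)
    then have "i = Suc (i - 1)" "i - 1 \<in> {i \<in> {1..n}. odd i}" by (cases i; auto elim: oddE)+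
    then show "i \<in> Suc ` {i \<in> {1..n}. odd i}" by (metis image_eqI)
  next
    fix i assume "i \<in> Suc ` {i \<in> {1..n}. odd i}"
    then obtain j where j: "i = Suc j" "1 \<le> j" "j \<le> n" "odd j" by auto
    with False have "j \<noteq> n" by auto
    with j False have "even i" "1 \<le> i" "i \<le> n" by auto
    with False show "i \<in> {i \<in> {1..n}. i mod 2 = n mod 2}" by (simp add: even_iff_mod_2_eq_zero)
  qed
  then show ?thesis by (simp add: card_image)
qed

lemma W_transpose:
  assumes "i \<in> {1..n}" "j \<in> {1..n}" "i mod 2 = j mod 2"
  shows "transpose i j \<in> W n"
  using assms by (auto simp: W_def permutes_swap_id transpose_def)

text \<open>Here the hypothesis on \<open>r\<close> enters the uniqueness proof: a zero would give r
  = - m / (n - i), a negative rational, or m = 0 if n - i = 0.\<close>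

lemma not_negative_rat_rho:
  assumes r: "\<forall>q::rat. q < 0 \<longrightarrow> (r::'a::field_char_0) \<noteq> of_rat q" and "0 < m"
  shows "rho n r i + of_nat m \<noteq> 0"
proof
  assume eq: "rho n r i + of_nat m = 0"
  show False
  proof (cases "n - i = 0")
    case True
    then show False using eq assms(2) by (simp add: rho_def)
  next
    case False
    define q :: rat where "q = - of_nat m / of_nat (n - i)"
    have "q < 0" using False assms(2) by (simp add: q_def)
    moreover have "r = of_rat q"
    proof -
      have "of_nat (n - i) * r = - of_nat m" using eq by (simp add: rho_def eq_neg_iff_add_eq_0)
      then have "r = - of_nat m / of_nat (n - i)" using False by (simp add: field_simps)
      then show ?thesis by (simp add: q_def of_rat_divide of_rat_minus)
    qed
    ultimately show False using r by blast
  qed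
qed

text \<open>Transpositions in \<open>W n\<close> carry the zero at z_n = 0 to every z_i with i in
  \<open>I\<close>, so each monomial of \<open>f\<close> contains all these variables and their
  product can be stripped off. The last conclusion guards against the truncated subtraction in
  \<open>d - card I\<close>.\<close>

lemma poly_fun_divide:
  fixes f :: "(nat \<Rightarrow> 'a::field_char_0) \<Rightarrow> 'a"
  assumes f: "poly_fun n {..d} f" and inv: "\<And>\<pi> z. \<pi> \<in> W n \<Longrightarrow> f (z \<circ> \<pi>) = f z"
    and zero: "\<And>z. z n = 0 \<Longrightarrow> f z = 0" and n: "n \<ge> 1"
    and I: "I = {i \<in> {1..n}. i mod 2 = n mod 2}"
  obtains h where "poly_fun n {..d - card I} h" "\<And>\<pi> z. \<pi> \<in> W n \<Longrightarrow> h (z \<circ> \<pi>) = h z"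
    "\<And>z. f z = (\<Prod>i\<in>I. z i) * h z" "card I \<le> d \<or> (\<forall>z. f z = 0)"
proof -
  have fin: "finite I" by (simp add: I)
  from f obtain p where p: "p \<in> polys n" "\<And>m. m \<in> Poly_Mapping.keys p \<Longrightarrow> mdeg m \<in> {..d}"
    "\<And>z. eval_poly z p = f z" by (rule poly_funE) blast
  define mI :: monom where "mI = (\<Sum>i\<in>I. Poly_Mapping.single i 1)"
  have lookup_mI: "Poly_Mapping.lookup mI i = (if i \<in> I then 1 else 0)" for i
    using fin by (simp add: mI_def lookup_sum lookup_single when_def)
  have keys_mI: "Poly_Mapping.keys mI = I"
    by (auto simp: in_keys_iff lookup_mI split: if_splits)
  have mdeg_mI: "mdeg mI = card I"
    by (simp add: mdeg_def keys_mI lookup_mI)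
  have eval_mI: "eval_monom z mI = (\<Prod>i\<in>I. z i)" for z
    by (simp add: eval_monom_def keys_mI lookup_mI)
  have pos: "Poly_Mapping.lookup m i \<ge> 1" if m: "m \<in> Poly_Mapping.keys p" and i: "i \<in> I" for m i
  proof (rule ccontr)
    assume "\<not> ?thesis"
    then have "Poly_Mapping.keys m \<subseteq> - {i}" by (auto simp: in_keys_iff)
    moreover have "eval_poly z p = eval_poly z 0" if "\<And>j. j \<notin> - {i} \<Longrightarrow> z j = 0" for z
    proof -
      have "transpose i n \<in> W n" using i n by (intro W_transpose) (auto simp: I)
      then have "f z = f (z \<circ> transpose i n)" by (simp add: inv)
      also have "\<dots> = 0" using that by (intro zero) simp
      finally show ?thesis by (simp add: p)
    qed
    ultimately have "Poly_Mapping.lookup p m = Poly_Mapping.lookup 0 m"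
      by (intro lookup_eq_of_eval_eq_on[of "- {i}" p 0 m]) blast+
    with m show False by (simp add: in_keys_iff)
  qed
  have split: "m = mI + (m - mI)" if "m \<in> Poly_Mapping.keys p" for m
    by (rule poly_mapping_eqI) (use pos[OF that] in \<open>auto simp: lookup_add lookup_minus lookup_mI\<close>)
  define h where "h z = (\<Sum>m\<in>Poly_Mapping.keys p. Poly_Mapping.lookup p m * eval_monom z (m - mI))" for z
  have poly_h: "poly_fun n {..d - card I} h"
    unfolding h_def
  proof (rule poly_fun_sum, rule poly_fun_monom)
    fix m assume m: "m \<in> Poly_Mapping.keys p"
    have "Poly_Mapping.keys (m - mI) \<subseteq> Poly_Mapping.keys m"
      by (auto simp: in_keys_iff lookup_minus)
    then show "Poly_Mapping.keys (m - mI) \<subseteq> {1..n}"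
      using p(1) m unfolding polys_def by blast
    show "mdeg (m - mI) \<in> {..d - card I}"
      using p(2)[OF m] mdeg_add[of mI "m - mI"] split[OF m] by (simp add: mdeg_mI)
  qed
  have fh: "f z = (\<Prod>i\<in>I. z i) * h z" for z
  proof -
    have "f z = (\<Sum>m\<in>Poly_Mapping.keys p. Poly_Mapping.lookup p m * eval_monom z (mI + (m - mI)))"
      unfolding p(3)[symmetric] eval_poly_superset[OF finite_keys order.refl, of z p]
      by (intro sum.cong refl) (simp flip: split)
    then show ?thesis
      by (simp add: h_def sum_distrib_left eval_monom_add eval_mI mult.left_commute)
  qed
  have "h (z \<circ> \<pi>) = h z" if \<pi>: "\<pi> \<in> W n" for \<pi> z
  proof -
    have perm: "\<pi> permutes {1..n}" and par: "\<And>i. i \<in> {1..n} \<Longrightarrow> \<pi> i mod 2 = i mod 2"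
      using \<pi> by (auto simp: W_def)
    have "\<pi> ` I \<subseteq> I"
    proof (rule image_subsetI)
      fix i assume "i \<in> I"
      then have "i \<in> {1..n}" "i mod 2 = n mod 2" by (simp_all add: I)
      then show "\<pi> i \<in> I" using par[of i] permutes_in_image[OF perm, of i] by (simp add: I)
    qed
    moreover have "inj_on \<pi> I"
      using permutes_inj[OF perm] by (rule inj_on_subset) simp
    ultimately have bij: "bij_betw \<pi> I I"
      by (simp add: bij_betw_def endo_inj_surj[OF fin])
    \<comment> \<open>The product over \<open>I\<close> is itself invariant and can be cancelled at
      points without zero coordinates.\<close>
    have "h (z \<circ> \<pi>) - h z = 0"
    proof (rule poly_fun_eq_0[where f = "\<lambda>z. h (z \<circ> \<pi>) - h z"])
      show "poly_fun n {..d - card I} (\<lambda>z. h (z \<circ> \<pi>) - h z)"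
        by (intro poly_fun_diff poly_h poly_fun_subst[OF poly_h])
          (use permutes_in_image[OF perm] in \<open>auto intro!: poly_fun_var simp del: atLeastAtMost_iff\<close>)
      fix z :: "nat \<Rightarrow> 'a" assume z: "\<And>i. z i \<noteq> 0"
      have "(\<Prod>i\<in>I. z i) * h (z \<circ> \<pi>) = (\<Prod>i\<in>I. (z \<circ> \<pi>) i) * h (z \<circ> \<pi>)"
        using prod.reindex_bij_betw[OF bij, of z] by simp
      also have "\<dots> = (\<Prod>i\<in>I. z i) * h z"
        using inv[OF \<pi>, of z] by (simp only: fh)
      finally show "h (z \<circ> \<pi>) - h z = 0" using z fin by simp
    qed
    then show ?thesis by simp
  qed
  moreover have "card I \<le> d \<or> (\<forall>z. f z = 0)"
  proof (cases "p = 0")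
    case False
    then obtain m where "Poly_Mapping.lookup p m \<noteq> 0"
      using poly_mapping_eqI[of p 0] by (metis lookup_zero)
    then have m: "m \<in> Poly_Mapping.keys p" by (simp add: in_keys_iff)
    then show ?thesis using p(2)[OF m] mdeg_add[of mI "m - mI"] split[OF m] by (simp add: mdeg_mI)
  qed (use p(3) in auto)
  ultimately show ?thesis using that poly_h fh by blast
qed

text \<open>
  The induction on \<open>n\<close> sets \<open>z_n = 0\<close>, which amounts to passing to \<open>n - 1\<close> variables and shifting
  by \<open>r\<close>; a polynomial that vanishes there is divisible by the product of all \<open>z_i\<close> with
  \<open>i \<equiv> n (mod 2)\<close>, and shifting the quotient by 1 lowers the degree.
\<close>

lemma vanishing:
  fixes r :: "'a::field_char_0"
  assumes r: "\<forall>q::rat. q < 0 \<longrightarrow> r \<noteq> of_rat q"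
  shows "poly_fun n {..d} f \<Longrightarrow> (\<And>\<pi> z. \<pi> \<in> W n \<Longrightarrow> f (z \<circ> \<pi>) = f z) \<Longrightarrow>
    (\<And>\<mu>. \<mu> \<in> Lambda n \<Longrightarrow> odd_size n \<mu> \<le> d \<Longrightarrow> f (\<lambda>i. rho n r i + of_nat (\<mu> i)) = 0) \<Longrightarrow> f z = 0"
proof (induction n arbitrary: d f z)
  case 0
  have "f z = f (\<lambda>i. rho 0 r i + of_nat ((\<lambda>_. 0) i))"
    by (rule poly_fun_cong_on[OF 0(1)]) simp
  also have "\<dots> = 0" by (rule 0(3)) (auto simp: Lambda_def odd_size_def)
  finally show ?case .
next
  case (Suc n)
  note IH_n = Suc.IH
  from Suc.prems show ?case
  proof (induction d arbitrary: f z rule: less_induct)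
    case (less d)
    \<comment> \<open>The last coordinate of \<open>rho (Suc n) r\<close> is 0 and the others are
      those of \<open>rho n r\<close> plus \<open>r\<close>, so \<open>g\<close> has the zeros
      required in \<open>n\<close> variables.\<close>
    define g where "g z = f (\<lambda>i. if i \<le> n then z i + r else 0)" for z
    have poly_g: "poly_fun n {..d} g"
      unfolding g_def
    proof (rule poly_fun_subst[OF less.prems(1)])
      show "poly_fun n {..1} (\<lambda>z. if i \<le> n then z i + r else 0)" if "i \<in> {1..Suc n}" for i
        using that by (cases "i \<le> n") (auto intro!: poly_fun_add poly_fun_var poly_fun_const)
    qed
    have g0: "g z = 0" for z
    proof (rule IH_n[OF poly_g])
      fix \<pi> and z :: "nat \<Rightarrow> 'a" assume \<pi>: "\<pi> \<in> W n"
      then have perm: "\<pi> permutes {1..n}" by (simp add: W_def)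
      then have "\<pi> permutes {1..Suc n}" by (rule permutes_subset) auto
      moreover have fix_n: "\<pi> (Suc n) = Suc n" using perm by (auto simp: permutes_def)
      ultimately have "\<pi> \<in> W (Suc n)" using \<pi> by (auto simp: W_def le_Suc_eq)
      moreover have "\<pi> i \<le> n \<longleftrightarrow> i \<le> n" for i
        using permutes_in_image[OF perm, of i] perm
        by (cases "i \<in> {1..n}") (auto simp: permutes_def)
      then have "(\<lambda>i. if i \<le> n then (z \<circ> \<pi>) i + r else 0) = (\<lambda>i. if i \<le> n then z i + r else 0) \<circ> \<pi>"
        by (auto simp: fun_eq_iff)
      ultimately show "g (z \<circ> \<pi>) = g z"
        using less.prems(2)[of \<pi> "\<lambda>i. if i \<le> n then z i + r else 0"] by (simp only: g_def)
    next
      fix \<mu> assume \<mu>: "\<mu> \<in> Lambda n" "odd_size n \<mu> \<le> d"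
      have 0: "\<mu> i = 0" if "i > n" for i using \<mu>(1) that by (auto simp: Lambda_def)
      have "\<mu> \<in> Lambda (Suc n)"
        unfolding Lambda_def
      proof (intro CollectI conjI allI ballI impI)
        show "\<mu> i = 0" if "i \<notin> {1..Suc n}" for i using \<mu>(1) that by (auto simp: Lambda_def)
        show "\<mu> (i + 1) \<le> \<mu> i" if "i \<in> {1..<Suc n}" for i
          using \<mu>(1) that 0[of "i + 1"] by (cases "i < n") (auto simp: Lambda_def)
      qed
      moreover have "odd_size (Suc n) \<mu> \<le> d" using \<mu>(2) 0 by (simp add: odd_size_Suc)
      moreover have "(\<lambda>i. if i \<le> n then rho n r i + of_nat (\<mu> i) + r else 0) = (\<lambda>i. rho (Suc n) r i + of_nat (\<mu> i))"
        using 0 rho_plus_one[of _ n r] by (auto simp: fun_eq_iff rho_def algebra_simps)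
      ultimately show "g (\<lambda>i. rho n r i + of_nat (\<mu> i)) = 0"
        using less.prems(3)[of \<mu>] by (simp add: g_def)
    qed
    have zero: "f z = 0" if "z (Suc n) = 0" for z
    proof -
      have "f z = f (\<lambda>i. if i \<le> n then (z i - r) + r else 0)"
        by (rule poly_fun_cong_on[OF less.prems(1)]) (use that in \<open>auto simp: le_Suc_eq\<close>)
      then show ?thesis using g0[of "\<lambda>i. z i - r"] by (simp add: g_def)
    qed
    define I where "I = {i \<in> {1..Suc n}. i mod 2 = Suc n mod 2}"
    have card_I: "card I = card {i \<in> {1..Suc n}. odd i}"
      unfolding I_def by (rule card_same_parity)
    obtain h where h: "poly_fun (Suc n) {..d - card I} h" "\<And>\<pi> z. \<pi> \<in> W (Suc n) \<Longrightarrow> h (z \<circ> \<pi>) = h z"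
      "\<And>z. f z = (\<Prod>i\<in>I. z i) * h z" "card I \<le> d \<or> (\<forall>z. f z = 0)"
      by (rule poly_fun_divide[OF less.prems(1,2) zero _ I_def]) auto
    have "card I > 0" by (auto simp: card_gt_0_iff I_def)
    show ?case
    proof (cases "card I \<le> d")
      case True
      define h' where "h' z = h (\<lambda>i. z i + 1)" for z
      have "h' z = 0" for z
      proof (rule less.IH[where f = h' and y = "d - card I"])
        show "d - card I < d" using True \<open>card I > 0\<close> by auto
        show "poly_fun (Suc n) {..d - card I} h'"
          unfolding h'_def
          by (rule poly_fun_subst[OF h(1)]) (auto intro!: poly_fun_add poly_fun_var poly_fun_const)
        show "h' (z \<circ> \<pi>) = h' z" if "\<pi> \<in> W (Suc n)" for \<pi> z
          using h(2)[OF that, of "\<lambda>i. z i + 1"] by (simp add: h'_def comp_def)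
        fix \<mu> assume \<mu>: "\<mu> \<in> Lambda (Suc n)" "odd_size (Suc n) \<mu> \<le> d - card I"
        \<comment> \<open>Adding 1 to every part makes all factors of the product nonzero at
          \<open>rho + \<nu>\<close>, so the zero of \<open>f\<close> there is a zero of
          \<open>h\<close>.\<close>
        define \<nu> where "\<nu> i = (if i \<in> {1..Suc n} then \<mu> i + 1 else 0)" for i
        have "\<nu> \<in> Lambda (Suc n)" using \<mu>(1) by (auto simp: Lambda_def \<nu>_def)
        moreover have "odd_size (Suc n) \<nu> = odd_size (Suc n) \<mu> + card I"
        proof -
          have "odd_size (Suc n) \<nu> = (\<Sum>i\<in>{i \<in> {1..Suc n}. odd i}. \<mu> i + 1)"
            unfolding odd_size_def by (rule sum.cong) (auto simp: \<nu>_def)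
          also have "\<dots> = odd_size (Suc n) \<mu> + card I"
            unfolding sum.distrib card_I odd_size_def by simp
          finally show ?thesis .
        qed
        ultimately have "f (\<lambda>i. rho (Suc n) r i + of_nat (\<nu> i)) = 0"
          using \<mu>(2) True by (intro less.prems(3)) auto
        moreover have "(\<Prod>i\<in>I. rho (Suc n) r i + of_nat (\<nu> i)) \<noteq> 0"
          using not_negative_rat_rho[OF r] by (auto simp: I_def \<nu>_def simp del: of_nat_Suc of_nat_add)
        ultimately have "h (\<lambda>i. rho (Suc n) r i + of_nat (\<nu> i)) = 0" by (simp add: h(3))
        moreover have "h (\<lambda>i. rho (Suc n) r i + of_nat (\<nu> i)) = h' (\<lambda>i. rho (Suc n) r i + of_nat (\<mu> i))"
          unfolding h'_def by (rule poly_fun_cong_on[OF h(1)]) (auto simp: \<nu>_def)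
        ultimately show "h' (\<lambda>i. rho (Suc n) r i + of_nat (\<mu> i)) = 0" by simp
      qed
      from this[of "\<lambda>i. z i - 1"] have "h z = 0" by (simp add: h'_def)
      then show ?thesis by (simp add: h(3))
    qed (use h(4) in auto)
  qed
qed

section \<open>Uniqueness of \<open>R\<close> and a criterion for its top component\<close>

lemma lookup_homogeneous_component:
  "Poly_Mapping.lookup (homogeneous_component d p) m = (if mdeg m = d then Poly_Mapping.lookup p m else 0)"
  by (simp add: homogeneous_component_def lookup_sum lookup_single when_def in_keys_iff)

text \<open>The combination \<open>?F\<close> also vanishes at \<open>rho + l\<close>, hence is zero
  by \<open>vanishing\<close>. Comparing coefficients of the bracket monomial shows that
  \<open>p\<close> and \<open>q\<close> have the same value at \<open>rho + l\<close>. Were that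
  value zero, \<open>vanishing\<close> would give p = 0, against the coefficient 1.\<close>

lemma is_R_unique:
  fixes r :: "'a::field_char_0"
  assumes r: "\<forall>q::rat. q < 0 \<longrightarrow> r \<noteq> of_rat q" and p: "is_R n r l p" and q: "is_R n r l q"
  shows "p = q"
proof -
  have poly: "poly_fun n {..odd_size n l} (\<lambda>z. eval_poly z p)" if "is_R n r l p" for p
  proof (rule poly_funI[of p])
    show "p \<in> polys n" using that by (simp add: is_R_def invariant_polys_def)
    show "mdeg m \<in> {..odd_size n l}" if "m \<in> Poly_Mapping.keys p" for m
    proof -
      have "mdeg m \<le> total_degree p" using that by (simp add: total_degree_def)
      then show ?thesis using \<open>is_R n r l p\<close> by (simp add: is_R_def)
    qed
  qed simp
  let ?v = "\<lambda>p. eval_poly (\<lambda>i. rho n r i + of_nat (l i)) p"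
  let ?F = "const (?v q) * p - const (?v p) * q"
  have evalF: "eval_poly z ?F = ?v q * eval_poly z p - ?v p * eval_poly z q" for z
    using eval_poly_add[of z ?F "const (?v p) * q"] by (simp add: eval_poly_mult)
  have "eval_poly z ?F = 0" for z
  proof (rule vanishing[OF r, where f = "\<lambda>z. eval_poly z ?F"])
    show "poly_fun n {..odd_size n l} (\<lambda>z. eval_poly z ?F)"
      unfolding evalF
      by (intro poly_fun_diff; rule poly_fun_mult[OF poly_fun_const[of "{0}"]])
        (use poly[OF p] poly[OF q] in auto)
    show "eval_poly (z \<circ> \<pi>) ?F = eval_poly z ?F" if "\<pi> \<in> W n" for \<pi> z
      using p q that by (simp add: evalF is_R_def invariant_polys_iff)
    show "eval_poly (\<lambda>i. rho n r i + of_nat (\<mu> i)) ?F = 0" if "\<mu> \<in> Lambda n" "odd_size n \<mu> \<le> odd_size n l" for \<mu>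
      using p q that by (cases "\<mu> = l") (auto simp: evalF is_R_def)
  qed
  then have "?F = 0" by (intro mpoly_eqI) simp
  then have eq: "Poly_Mapping.lookup (const (?v q) * p) m = Poly_Mapping.lookup (const (?v p) * q) m" for m
    by simp
  have scale: "Poly_Mapping.lookup (const c * p) m = c * Poly_Mapping.lookup p m" for c :: 'a and p m
  proof -
    have "const c * p = Poly_Mapping.map ((*) c) p"
      by (simp add: const_def mult_map_scale_conv_mult)
    then show ?thesis by (simp add: map.rep_eq when_def)
  qed
  have v: "?v p = ?v q"
    using eq[of "bracket_monom n l"] p q by (simp add: scale is_R_def)
  show "p = q"
  proof (cases "?v q = 0")
    case True
    have "eval_poly z p = 0" for z
    proof (rule vanishing[OF r, where f = "\<lambda>z. eval_poly z p", OF poly[OF p]])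
      show "eval_poly (z \<circ> \<pi>) p = eval_poly z p" if "\<pi> \<in> W n" for \<pi> z
        using p that by (simp add: is_R_def invariant_polys_iff)
      show "eval_poly (\<lambda>i. rho n r i + of_nat (\<mu> i)) p = 0" if "\<mu> \<in> Lambda n" "odd_size n \<mu> \<le> odd_size n l" for \<mu>
        using p that True v by (cases "\<mu> = l") (auto simp: is_R_def)
    qed
    then have "p = 0" by (intro mpoly_eqI) simp
    with p show ?thesis by (simp add: is_R_def)
  next
    case False
    show ?thesis
      by (rule poly_mapping_eqI) (use eq v False in \<open>simp add: scale\<close>)
  qed
qed

text \<open>\<open>f\<close> has degree at most \<open>d\<close>, and \<open>g\<close> is its
  homogeneous component of degree \<open>d\<close>, possibly zero.\<close>

definition graded :: "nat \<Rightarrow> nat \<Rightarrow> ((nat \<Rightarrow> 'a) \<Rightarrow> 'a) \<Rightarrow> ((nat \<Rightarrow> 'a) \<Rightarrow> 'a::comm_ring_1) \<Rightarrow> bool" where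
  "graded n d f g \<longleftrightarrow> poly_fun n {d} g \<and> poly_fun n {..<d} (\<lambda>z. f z - g z)"

text \<open>By uniqueness, any \<open>f\<close> with the defining properties is \<open>R\<close>.
  The normalization is checked only on points supported in \<open>S\<close>, where the leading part
  agrees with an explicit polynomial \<open>q\<close>.\<close>

lemma eval_R_bar:
  fixes r :: "'a::field_char_0"
  assumes r: "\<forall>q::rat. q < 0 \<longrightarrow> r \<noteq> of_rat q"
    and fg: "graded n (odd_size n l) f g"
    and inv: "\<And>\<pi> z. \<pi> \<in> W n \<Longrightarrow> f (z \<circ> \<pi>) = f z"
    and vanish: "\<And>\<mu>. \<mu> \<in> Lambda n \<Longrightarrow> odd_size n \<mu> \<le> odd_size n l \<Longrightarrow> \<mu> \<noteq> l \<Longrightarrow>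
      f (\<lambda>i. rho n r i + of_nat (\<mu> i)) = 0"
    and m: "mdeg (bracket_monom n l) = odd_size n l" "Poly_Mapping.keys (bracket_monom n l) \<subseteq> S"
    and q: "\<And>z. (\<And>i. i \<notin> S \<Longrightarrow> z i = 0) \<Longrightarrow> g z = eval_poly z q"
      "Poly_Mapping.lookup q (bracket_monom n l) = 1"
  shows "eval_poly z (R_bar n r l) = g z"
proof -
  let ?d = "odd_size n l"
  from fg have "poly_fun n {?d} g" and fg': "poly_fun n {..<?d} (\<lambda>z. f z - g z)"
    by (simp_all add: graded_def)
  from this(1) obtain p1 where p1: "p1 \<in> polys n" "\<And>m. m \<in> Poly_Mapping.keys p1 \<Longrightarrow> mdeg m \<in> {?d}"
    "\<And>z. eval_poly z p1 = g z" by (rule poly_funE) blast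
  from fg' obtain p0 where p0: "p0 \<in> polys n" "\<And>m. m \<in> Poly_Mapping.keys p0 \<Longrightarrow> mdeg m \<in> {..<?d}"
    "\<And>z. eval_poly z p0 = f z - g z" by (rule poly_funE) blast
  define p where "p = p0 + p1"
  have eval_p: "eval_poly z p = f z" for z by (simp add: p_def eval_poly_add p0 p1)
  have keys: "m \<in> Poly_Mapping.keys p0 \<or> m \<in> Poly_Mapping.keys p1" if "m \<in> Poly_Mapping.keys p" for m
    using that Poly_Mapping.keys_add[of p0 p1] unfolding p_def by blast
  have p0_0: "Poly_Mapping.lookup p0 m = 0" if "mdeg m \<ge> ?d" for m
    using p0(2)[of m] that by (auto simp: in_keys_iff)
  have p1_0: "Poly_Mapping.lookup p1 m = 0" if "mdeg m \<noteq> ?d" for m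
    using p1(2)[of m] that by (auto simp: in_keys_iff)
  have coeff: "Poly_Mapping.lookup p (bracket_monom n l) = 1"
  proof -
    have "Poly_Mapping.lookup p1 (bracket_monom n l) = Poly_Mapping.lookup q (bracket_monom n l)"
      by (rule lookup_eq_of_eval_eq_on[OF _ m(2)]) (simp add: p1(3) q(1))
    then show ?thesis using q(2) m(1) p0_0[of "bracket_monom n l"] by (simp add: p_def lookup_add)
  qed
  have "is_R n r l p"
    unfolding is_R_def
  proof (intro conjI ballI impI)
    show "p \<in> invariant_polys n"
      unfolding invariant_polys_iff eval_p
    proof (intro conjI ballI allI inv)
      show "p \<in> polys n" using keys p0(1) p1(1) unfolding polys_def by blast
    qed
    show "total_degree p = ?d"
      unfolding total_degree_def
    proof (rule Max_eqI)
      show "k \<le> ?d" if "k \<in> insert 0 (mdeg ` Poly_Mapping.keys p)" for k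
        using that keys p0(2) p1(2) by force
      have "bracket_monom n l \<in> Poly_Mapping.keys p" using coeff by (simp add: in_keys_iff)
      then show "?d \<in> insert 0 (mdeg ` Poly_Mapping.keys p)" by (metis imageI insertCI m(1))
    qed auto
  qed (use vanish coeff in \<open>auto simp: eval_p\<close>)
  then have "R n r l = p"
    unfolding R_def by (intro the_equality is_R_unique[OF r])
  moreover have "homogeneous_component ?d p = p1"
    by (rule poly_mapping_eqI)
      (auto simp: lookup_homogeneous_component p_def lookup_add p0_0 p1_0)
  ultimately show ?thesis by (simp add: R_bar_def p1(3))
qed

section \<open>Families of power series with polynomial coefficients\<close>

unbundle fps_syntax

lemma graded_le:
  assumes "graded n d f g"
  shows "poly_fun n {..d} f"
proof -
  have "poly_fun n {..d} (\<lambda>z. g z + (f z - g z))"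
    using assms by (intro poly_fun_add) (auto simp: graded_def elim: poly_fun_mono)
  then show ?thesis by simp
qed

lemma graded_zero: "graded n d (\<lambda>_. 0) (\<lambda>_. 0)"
  by (simp add: graded_def poly_fun_zero)

lemma graded_const: "graded n 0 (\<lambda>_. c) (\<lambda>_. c)"
  by (simp add: graded_def poly_fun_zero poly_fun_const)

lemma graded_var: "i \<in> {1..n} \<Longrightarrow> graded n 1 (\<lambda>z. z i) (\<lambda>z. z i)"
  by (simp add: graded_def poly_fun_zero poly_fun_var)

lemma graded_weaken:
  assumes "graded n d f g" "d < e"
  shows "graded n e f (\<lambda>_. 0)"
proof -
  have "poly_fun n {..<e} f"
    by (rule poly_fun_mono[OF graded_le[OF assms(1)]]) (use assms(2) in auto)
  then show ?thesis by (simp add: graded_def poly_fun_zero)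
qed

lemma graded_add:
  assumes "graded n d f g" "graded n d f' g'"
  shows "graded n d (\<lambda>z. f z + f' z) (\<lambda>z. g z + g' z)"
proof -
  have "poly_fun n {..<d} (\<lambda>z. (f z - g z) + (f' z - g' z))"
    using assms by (intro poly_fun_add) (auto simp: graded_def)
  then show ?thesis
    using assms by (auto simp: graded_def algebra_simps intro: poly_fun_add)
qed

lemma graded_sum:
  "(\<And>x. x \<in> A \<Longrightarrow> graded n d (f x) (g x)) \<Longrightarrow> graded n d (\<lambda>z. \<Sum>x\<in>A. f x z) (\<lambda>z. \<Sum>x\<in>A. g x z)"
proof (induction A rule: infinite_finite_induct)
  case (insert x A)
  then have "graded n d (\<lambda>z. f x z + (\<Sum>x\<in>A. f x z)) (\<lambda>z. g x z + (\<Sum>x\<in>A. g x z))"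
    by (intro graded_add) auto
  with insert.hyps show ?case by simp
qed (simp_all add: graded_zero)

lemma graded_mult:
  assumes f: "graded n d f g" and f': "graded n e f' g'"
  shows "graded n (d + e) (\<lambda>z. f z * f' z) (\<lambda>z. g z * g' z)"
proof -
  have "poly_fun n {..<d + e} (\<lambda>z. (f z - g z) * f' z)"
    by (rule poly_fun_mult[where D = "{..<d}" and E = "{..e}"])
      (use f graded_le[OF f'] in \<open>auto simp: graded_def\<close>)
  moreover have "poly_fun n {..<d + e} (\<lambda>z. g z * (f' z - g' z))"
    by (rule poly_fun_mult[where D = "{d}" and E = "{..<e}"])
      (use f f' in \<open>auto simp: graded_def\<close>)
  ultimately have "poly_fun n {..<d + e} (\<lambda>z. (f z - g z) * f' z + g z * (f' z - g' z))"
    by (rule poly_fun_add)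
  moreover have "poly_fun n {d + e} (\<lambda>z. g z * g' z)"
    by (rule poly_fun_mult[where D = "{d}" and E = "{e}"]) (use f f' in \<open>auto simp: graded_def\<close>)
  ultimately show ?thesis by (simp add: graded_def algebra_simps)
qed

lemma graded_cmult:
  "graded n d f g \<Longrightarrow> graded n d (\<lambda>z. c * f z) (\<lambda>z. c * g z)"
  using graded_mult[OF graded_const[of n c], of d f g] by simp

lemma graded_diff:
  "graded n d f g \<Longrightarrow> graded n d f' g' \<Longrightarrow> graded n d (\<lambda>z. f z - f' z) (\<lambda>z. g z - g' z)"
  using graded_add[OF _ graded_cmult[of n d f' g' "-1"], of f g] by simp

text \<open>If the series variable v is given degree -1, then \<open>G\<close> is the leading part
  of \<open>F\<close>; this is compatible with products.\<close>

definition graded_fps :: "nat \<Rightarrow> ((nat \<Rightarrow> 'a) \<Rightarrow> 'a fps) \<Rightarrow> ((nat \<Rightarrow> 'a) \<Rightarrow> 'a::comm_ring_1 fps) \<Rightarrow> bool" where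
  "graded_fps n F G \<longleftrightarrow> (\<forall>d. graded n d (\<lambda>z. F z $ d) (\<lambda>z. G z $ d))"

lemma graded_fps_mult:
  assumes "graded_fps n F G" "graded_fps n F' G'"
  shows "graded_fps n (\<lambda>z. F z * F' z) (\<lambda>z. G z * G' z)"
  unfolding graded_fps_def
proof
  fix d
  show "graded n d (\<lambda>z. (F z * F' z) $ d) (\<lambda>z. (G z * G' z) $ d)"
    unfolding fps_mult_nth
  proof (rule graded_sum)
    fix i assume "i \<in> {0..d}"
    then have "i + (d - i) = d" by simp
    then show "graded n d (\<lambda>z. F z $ i * F' z $ (d - i)) (\<lambda>z. G z $ i * G' z $ (d - i))"
      using graded_mult[of n i "\<lambda>z. F z $ i" "\<lambda>z. G z $ i" "d - i" "\<lambda>z. F' z $ (d - i)" "\<lambda>z. G' z $ (d - i)"] assms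
      by (simp add: graded_fps_def)
  qed
qed

lemma graded_fps_const:
  assumes "c $ 0 = 1"
  shows "graded_fps n (\<lambda>_. c) (\<lambda>_. 1)"
  unfolding graded_fps_def
proof
  fix d show "graded n d (\<lambda>_. c $ d) (\<lambda>_. 1 $ d)"
    using assms graded_weaken[OF graded_const[of n "c $ d"], of d] graded_const[of n 1]
    by (cases "d = 0") auto
qed

text \<open>Factors that do not involve \<open>z\<close> and have constant term 1 do not affect the
  leading part, so they may be inserted freely to create zeros.\<close>

lemma graded_fps_scale:
  assumes "c $ 0 = 1" "graded_fps n F G"
  shows "graded_fps n (\<lambda>z. c * F z) G"
  using graded_fps_mult[OF graded_fps_const[OF assms(1)] assms(2)] by simp

lemma graded_fps_prod:
  "(\<And>x. x \<in> A \<Longrightarrow> graded_fps n (F x) (G x)) \<Longrightarrow> graded_fps n (\<lambda>z. \<Prod>x\<in>A. F x z) (\<lambda>z. \<Prod>x\<in>A. G x z)"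
proof (induction A rule: infinite_finite_induct)
  case (insert x A)
  then have "graded_fps n (\<lambda>z. F x z * (\<Prod>x\<in>A. F x z)) (\<lambda>z. G x z * (\<Prod>x\<in>A. G x z))"
    by (intro graded_fps_mult) auto
  with insert.hyps show ?case by simp
qed (simp_all add: graded_fps_const)

text \<open>With v for \<open>fps_X\<close> and u = 1 / v, this is v (u + x).\<close>

definition lin :: "'a::comm_ring_1 \<Rightarrow> 'a fps" where
  "lin x = 1 + fps_const x * fps_X"

lemma lin_nth: "lin x $ d = (if d = 0 then 1 else if d = 1 then x else 0)"
  by (simp add: lin_def fps_X_def)

lemma lin_0 [simp]: "lin 0 = 1"
  by (simp add: lin_def)

lemma graded_fps_lin:
  assumes "i \<in> {1..n}"
  shows "graded_fps n (\<lambda>z. lin (z i + c)) (\<lambda>z. lin (z i))"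
  unfolding graded_fps_def
proof
  fix d :: nat
  consider "d = 0" | "d = 1" | "d > 1" by linarith
  then show "graded n d (\<lambda>z. lin (z i + c) $ d) (\<lambda>z. lin (z i) $ d)"
  proof cases
    case 2
    have "graded n 1 (\<lambda>z. z i + c) (\<lambda>z. z i + 0)"
      by (rule graded_add[OF graded_var[OF assms] graded_weaken[OF graded_const]]) simp
    with 2 show ?thesis by (simp add: lin_nth)
  qed (simp_all add: lin_nth graded_const graded_zero)
qed

lemma prod_lin_nth_0 [simp]: "(\<Prod>x\<in>A. lin (f x)) $ 0 = 1"
  by (induction A rule: infinite_finite_induct) (simp_all add: lin_nth)

lemma lin_nth_0 [simp]: "lin x $ 0 = 1"
  by (simp add: lin_nth)

section \<open>Degrees in v and residues of products of linear factors\<close>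

definition fps_deg_le :: "nat \<Rightarrow> 'a::zero fps \<Rightarrow> bool" where
  "fps_deg_le d F \<longleftrightarrow> (\<forall>k>d. F $ k = 0)"

lemma fps_deg_le_mult:
  fixes F G :: "'a::comm_ring_1 fps"
  assumes "fps_deg_le d F" "fps_deg_le e G"
  shows "fps_deg_le (d + e) (F * G)"
  unfolding fps_deg_le_def
proof (intro allI impI)
  fix k assume k: "k > d + e"
  have "F $ i * G $ (k - i) = 0" for i
    using assms k by (cases "i > d") (auto simp: fps_deg_le_def)
  then show "(F * G) $ k = 0" by (simp add: fps_mult_nth)
qed

lemma fps_deg_le_lin: "fps_deg_le 1 (lin x)"
  by (simp add: fps_deg_le_def lin_nth)

lemma fps_deg_le_1: "fps_deg_le d 1"
  by (simp add: fps_deg_le_def)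

lemma fps_deg_le_prod_lin: "fps_deg_le (card A) (\<Prod>x\<in>A. lin (f x))"
proof (induction A rule: infinite_finite_induct)
  case (insert x A)
  then show ?case using fps_deg_le_mult[OF fps_deg_le_lin] by fastforce
qed (simp_all add: fps_deg_le_1)

text \<open>In terms of \<open>u = 1 / v\<close> this is the residue at \<open>u = - y\<close>.\<close>

lemma prod_lin_residue:
  fixes y :: "'a::field"
  assumes "finite A"
  shows "((\<Prod>x\<in>A. lin (f x)) * inverse (lin y)) $ card A = (\<Prod>x\<in>A. f x - y)"
  using assms
proof (induction A rule: finite_induct)
  case (insert x A)
  let ?P = "\<Prod>x\<in>A. lin (f x)"
  \<comment> \<open>After division by \<open>lin y\<close>, the new factor leaves the old product,
    whose degree is too small to contribute, and a multiple of v times the old quotient.\<close>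
  have "lin (f x) = lin y + fps_const (f x - y) * fps_X"
    by (simp add: lin_def algebra_simps fps_const_sub[symmetric] del: fps_const_sub)
  then have "lin (f x) * ?P * inverse (lin y) =
      ?P * (lin y * inverse (lin y)) + fps_const (f x - y) * (fps_X * (?P * inverse (lin y)))"
    by (simp only: distrib_left distrib_right ac_simps)
  also have "lin y * inverse (lin y) = 1"
    by (rule inverse_mult_eq_1') simp
  finally have "(lin (f x) * ?P * inverse (lin y)) $ Suc (card A) = (f x - y) * (?P * inverse (lin y)) $ card A"
    using fps_deg_le_prod_lin[of A f] by (simp add: fps_deg_le_def)
  then show ?case using insert by simp
qed simp

section \<open>Elementary symmetric polynomials of one parity and their shifted versions\<close>

lemma W_reindex_prod:
  assumes "\<pi> \<in> W n"
  shows "(\<Prod>i\<in>{i \<in> {1..n}. odd i = s}. f (z (\<pi> i))) = (\<Prod>i\<in>{i \<in> {1..n}. odd i = s}. f (z i))"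
proof -
  have perm: "\<pi> permutes {1..n}" and par: "\<And>i. i \<in> {1..n} \<Longrightarrow> \<pi> i mod 2 = i mod 2"
    using assms by (auto simp: W_def)
  let ?I = "{i \<in> {1..n}. odd i = s}"
  have "\<pi> ` ?I \<subseteq> ?I"
  proof (rule image_subsetI)
    fix i assume "i \<in> ?I"
    then show "\<pi> i \<in> ?I"
      using par[of i] permutes_in_image[OF perm, of i] by (simp add: odd_iff_mod_2_eq_one)
  qed
  moreover have "inj_on \<pi> ?I"
    using permutes_inj[OF perm] by (rule inj_on_subset) simp
  ultimately have "bij_betw \<pi> ?I ?I"
    by (simp add: bij_betw_def endo_inj_surj)
  then show ?thesis by (rule prod.reindex_bij_betw)
qed

text \<open>\<open>gen n True\<close> is E_odd and \<open>gen n False\<close> is E_even; their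
  coefficients are the elementary symmetric polynomials in the variables of one parity.\<close>

definition gen :: "nat \<Rightarrow> bool \<Rightarrow> (nat \<Rightarrow> 'a) \<Rightarrow> 'a::comm_ring_1 fps" where
  "gen n s z = (\<Prod>i\<in>{i \<in> {1..n}. odd i = s}. lin (z i))"

text \<open>
  The shifted elementary symmetric polynomial of degree \<open>p\<close> in the variables of one parity: the
  coefficient of \<open>v^p\<close> picks out the \<open>p\<close>-th term of the Newton expansion at the nodes \<open>- \<rho>_i\<close>.
\<close>

definition shifted_gen :: "nat \<Rightarrow> 'a::field_char_0 \<Rightarrow> nat \<Rightarrow> bool \<Rightarrow> (nat \<Rightarrow> 'a) \<Rightarrow> 'a" where
  "shifted_gen n r p s z =
     (inverse (\<Prod>i\<in>{i \<in> {1..n}. odd i = s \<and> 2 * p \<le> i + 1}. lin (rho n r i)) * gen n s z) $ p"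

lemma graded_shifted_gen: "graded n p (shifted_gen n r p s) (\<lambda>z. gen n s z $ p)"
proof -
  have "graded_fps n (gen n s) (gen n s)"
    unfolding gen_def
  proof (rule graded_fps_prod)
    fix i assume "i \<in> {i \<in> {1..n}. odd i = s}"
    then show "graded_fps n (\<lambda>z. lin (z i)) (\<lambda>z. lin (z i))"
      using graded_fps_lin[of i n 0] by simp
  qed
  then have "graded_fps n (\<lambda>z. inverse (\<Prod>i\<in>{i \<in> {1..n}. odd i = s \<and> 2 * p \<le> i + 1}. lin (rho n r i)) * gen n s z) (gen n s)"
    by (rule graded_fps_scale[rotated]) simp
  then show ?thesis by (simp add: graded_fps_def shifted_gen_def[abs_def])
qed

lemma gen_invariant: "\<pi> \<in> W n \<Longrightarrow> gen n s (z \<circ> \<pi>) = gen n s z"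
  unfolding gen_def comp_def by (rule W_reindex_prod)

lemma shifted_gen_invariant: "\<pi> \<in> W n \<Longrightarrow> shifted_gen n r p s (z \<circ> \<pi>) = shifted_gen n r p s z"
  by (simp add: shifted_gen_def gen_invariant)

lemma gen_split:
  "gen n s z = (\<Prod>i\<in>{i \<in> {1..n}. odd i = s \<and> i + 1 < 2 * p}. lin (z i)) *
    (\<Prod>i\<in>{i \<in> {1..n}. odd i = s \<and> 2 * p \<le> i + 1}. lin (z i))"
proof -
  let ?A = "{i \<in> {1..n}. odd i = s \<and> i + 1 < 2 * p}" and ?B = "{i \<in> {1..n}. odd i = s \<and> 2 * p \<le> i + 1}"
  have "gen n s z = (\<Prod>i\<in>?A \<union> ?B. lin (z i))"
    unfolding gen_def by (rule prod.cong) auto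
  also have "\<dots> = (\<Prod>i\<in>?A. lin (z i)) * (\<Prod>i\<in>?B. lin (z i))"
    by (rule prod.union_disjoint) auto
  finally show ?thesis .
qed

lemma card_parity_less: "card {i \<in> {1..n}. odd i = s \<and> i + 1 < 2 * p} < p" if "p \<ge> 1"
proof -
  have "inj_on (\<lambda>i. i div 2) {i \<in> {1..n}. odd i = s \<and> i + 1 < 2 * p}"
  proof (rule inj_onI)
    fix i j assume "i \<in> {i \<in> {1..n}. odd i = s \<and> i + 1 < 2 * p}" "j \<in> {i \<in> {1..n}. odd i = s \<and> i + 1 < 2 * p}"
    then have "odd i = odd j" by simp
    moreover assume "i div 2 = j div 2"
    ultimately show "i = j" by presburger
  qed
  moreover have "(\<lambda>i. i div 2) ` {i \<in> {1..n}. odd i = s \<and> i + 1 < 2 * p} \<subseteq> (if s then {..<p - 1} else {1..<p})"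
    by (auto split: if_splits elim!: oddE evenE)
  ultimately have "card {i \<in> {1..n}. odd i = s \<and> i + 1 < 2 * p} \<le> card (if s then {..<p - 1} else {1..<p})"
    by (intro card_inj_on_le) auto
  also have "\<dots> < p" using that by auto
  finally show ?thesis .
qed

text \<open>The condition \<open>2 * p \<le> i + 1\<close> means i \<ge> 2p - 1 for odd i and i
  \<ge> 2p for even i. The factors with these indices cancel, and fewer than \<open>p\<close> linear
  factors remain, too few to reach v^p.\<close>

lemma shifted_gen_eq_0:
  assumes "p \<ge> 1" "\<And>i. i \<in> {1..n} \<Longrightarrow> odd i = s \<Longrightarrow> 2 * p \<le> i + 1 \<Longrightarrow> z i = rho n r i"
  shows "shifted_gen n r p s z = 0"
proof -
  let ?A = "{i \<in> {1..n}. odd i = s \<and> i + 1 < 2 * p}" and ?B = "{i \<in> {1..n}. odd i = s \<and> 2 * p \<le> i + 1}"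
  have B: "(\<Prod>i\<in>?B. lin (z i)) = (\<Prod>i\<in>?B. lin (rho n r i))"
    by (rule prod.cong) (use assms(2) in auto)
  have "inverse (\<Prod>i\<in>?B. lin (rho n r i)) * gen n s z =
      (\<Prod>i\<in>?A. lin (z i)) * (inverse (\<Prod>i\<in>?B. lin (rho n r i)) * (\<Prod>i\<in>?B. lin (rho n r i)))"
    unfolding gen_split[of n s z p] B by (rule mult.left_commute)
  also have "inverse (\<Prod>i\<in>?B. lin (rho n r i)) * (\<Prod>i\<in>?B. lin (rho n r i)) = 1"
    by (rule inverse_mult_eq_1) simp
  finally show ?thesis
    using fps_deg_le_prod_lin[of ?A z] card_parity_less[OF assms(1), of n s]
    by (simp add: shifted_gen_def fps_deg_le_def)
qed

section \<open>The polynomials of a column\<close>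

lemma Lambda_antimono:
  assumes "l \<in> Lambda n" "1 \<le> i" "i \<le> j"
  shows "l j \<le> l i"
  using assms(3)
proof (induction j rule: dec_induct)
  case (step j)
  have "l (Suc j) \<le> l j"
    using assms(1,2) step(1) by (cases "Suc j \<le> n") (auto simp: Lambda_def)
  with step show ?case by simp
qed simp

lemma card_odd: "card {i. i \<in> {1..m} \<and> odd i} = (m + 1) div 2"
proof (induction m)
  case (Suc m)
  have "{i. i \<in> {1..Suc m} \<and> odd i} = (if odd (Suc m) then insert (Suc m) else id) {i. i \<in> {1..m} \<and> odd i}"
    by (auto simp: le_Suc_eq)
  with Suc show ?case by auto
qed simp

lemma alternating_sum:
  assumes "i \<le> m"
  shows "(\<Sum>j=i..m. (- 1) ^ (j - i)) = (if i mod 2 = m mod 2 then 1 else (0::int))"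
proof -
  have "(\<Sum>j=i..m. (- 1) ^ (j - i)) = (if even (m - i) then 1 else (0::int))"
    using assms
  proof (induction m rule: dec_induct)
    case (step m)
    then have "(\<Sum>j=i..Suc m. (- 1) ^ (j - i)) = (\<Sum>j=i..m. (- 1) ^ (j - i)) + (- 1 :: int) ^ Suc (m - i)"
      by (simp add: Suc_diff_le)
    with step.IH step.hyps(1) show ?case by (simp add: Suc_diff_le minus_one_power_iff)
  qed simp
  moreover have "even (m - i) \<longleftrightarrow> i mod 2 = m mod 2" using assms by presburger
  ultimately show ?thesis by simp
qed

lemma bracket_column:
  assumes "m \<le> n" "1 \<le> i"
  shows "bracket n (column m) i = (if i \<le> m \<and> i mod 2 = m mod 2 then 1 else 0)"
proof -
  have "bracket n (column m) i = (\<Sum>j\<in>{i..n}. if j \<le> m then (- 1) ^ (j - i) else 0)"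
    unfolding bracket_def by (rule sum.cong) (use assms(2) in \<open>auto simp: column_def\<close>)
  also have "\<dots> = (\<Sum>j=i..m. (- 1) ^ (j - i))"
    by (rule sum.mono_neutral_cong_right) (use assms(1) in auto)
  finally show ?thesis using alternating_sum[of i m] by (cases "i \<le> m") auto
qed

lemma odd_size_column:
  assumes "m \<le> n"
  shows "odd_size n (column m) = (m + 1) div 2"
proof -
  have "odd_size n (column m) = (\<Sum>i\<in>{i. i \<in> {1..m} \<and> odd i}. 1)"
    unfolding odd_size_def
    by (rule sum.mono_neutral_cong_right) (use assms in \<open>auto simp: column_def\<close>)
  then show ?thesis by (simp only: card_odd sum_constant) simp
qed

text \<open>All linear factors outside \<open>I\<close> are 1, so this is the top coefficient of the
  product, the case y = 0 of \<open>prod_lin_residue\<close>.\<close>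

lemma gen_nth_prod:
  fixes z :: "nat \<Rightarrow> 'a::field"
  assumes "I \<subseteq> {i \<in> {1..n}. odd i = s}" "\<And>i. i \<notin> I \<Longrightarrow> z i = 0"
  shows "gen n s z $ card I = (\<Prod>i\<in>I. z i)"
proof -
  have fin: "finite I" using assms(1) by (rule finite_subset) simp
  have "gen n s z = (\<Prod>i\<in>I. lin (z i))"
    unfolding gen_def by (rule prod.mono_neutral_right) (use assms in auto)
  then show ?thesis
    using prod_lin_residue[OF fin, of z 0] by simp
qed

text \<open>The value does not depend on the parity \<open>s\<close>, so the odd and even versions
  cancel at the column of length 2p. After cancellation one denominator is left, and its residue
  involves only differences of entries of \<open>rho\<close>, which are the same for both
  parities.\<close>

lemma shifted_gen_column:
  assumes "1 \<le> p" "2 * p \<le> n"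
  shows "shifted_gen n r p s (\<lambda>i. rho n r i + of_nat (column (2 * p) i)) =
    (\<Prod>t\<in>{1..p}. of_nat (2 * p - 2 * t) * r + 1)"
proof -
  let ?z = "\<lambda>i. rho n r i + of_nat (column (2 * p) i)"
  \<comment> \<open>The largest index of parity \<open>s\<close> up to 2p, and the only one in that
    range with a factor in the denominator.\<close>
  define i0 where "i0 = (if s then 2 * p - 1 else 2 * p)"
  define A where "A = {i \<in> {1..2 * p}. odd i = s}"
  define B where "B = {i \<in> {1..n}. odd i = s \<and> 2 * p < i}"
  have i0: "i0 \<in> A" using assms by (auto simp: A_def i0_def)
  have B': "{i \<in> {1..n}. odd i = s \<and> 2 * p \<le> i + 1} = insert i0 B"
  proof (rule set_eqI)
    fix i show "i \<in> {i \<in> {1..n}. odd i = s \<and> 2 * p \<le> i + 1} \<longleftrightarrow> i \<in> insert i0 B"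
    proof (cases s)
      case True
      then have "odd i = s \<and> 2 * p \<le> i + 1 \<longleftrightarrow> i = i0 \<or> odd i = s \<and> 2 * p < i"
        using assms unfolding i0_def by presburger
      with assms True show ?thesis by (auto simp: B_def i0_def)
    next
      case False
      then have "odd i = s \<and> 2 * p \<le> i + 1 \<longleftrightarrow> i = i0 \<or> odd i = s \<and> 2 * p < i"
        using assms unfolding i0_def by presburger
      with assms False show ?thesis by (auto simp: B_def i0_def)
    qed
  qed
  have i0_B: "i0 \<notin> B" "finite B" by (auto simp: B_def i0_def)
  have gen: "gen n s ?z = (\<Prod>i\<in>A. lin (rho n r i + 1)) * (\<Prod>i\<in>B. lin (rho n r i))"
  proof -
    have "gen n s ?z = (\<Prod>i\<in>A \<union> B. lin (?z i))"
      unfolding gen_def by (rule prod.cong) (use assms in \<open>auto simp: A_def B_def\<close>)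
    also have "\<dots> = (\<Prod>i\<in>A. lin (?z i)) * (\<Prod>i\<in>B. lin (?z i))"
      by (rule prod.union_disjoint) (auto simp: A_def B_def)
    also have "(\<Prod>i\<in>A. lin (?z i)) = (\<Prod>i\<in>A. lin (rho n r i + 1))"
      by (rule prod.cong) (auto simp: A_def column_def)
    also have "(\<Prod>i\<in>B. lin (?z i)) = (\<Prod>i\<in>B. lin (rho n r i))"
      by (rule prod.cong) (auto simp: B_def column_def)
    finally show ?thesis .
  qed
  have "inverse (\<Prod>i\<in>insert i0 B. lin (rho n r i)) * gen n s ?z =
      (\<Prod>i\<in>A. lin (rho n r i + 1)) * inverse (lin (rho n r i0)) *
      (inverse (\<Prod>i\<in>B. lin (rho n r i)) * (\<Prod>i\<in>B. lin (rho n r i)))"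
    using i0_B unfolding gen by (simp add: fps_inverse_mult ac_simps)
  also have "inverse (\<Prod>i\<in>B. lin (rho n r i)) * (\<Prod>i\<in>B. lin (rho n r i)) = 1"
    by (rule inverse_mult_eq_1) simp
  finally have eq: "shifted_gen n r p s ?z = ((\<Prod>i\<in>A. lin (rho n r i + 1)) * inverse (lin (rho n r i0))) $ p"
    by (simp only: shifted_gen_def B' mult_1_right)
  have bij: "bij_betw (\<lambda>t. if s then 2 * t - 1 else 2 * t) {1..p} A"
  proof (rule bij_betw_byWitness[where f' = "\<lambda>i. (i + 1) div 2"])
    show "(\<lambda>t. if s then 2 * t - 1 else 2 * t) ` {1..p} \<subseteq> A"
    proof (rule image_subsetI)
      fix t assume t: "t \<in> {1..p}"
      then have "odd (2 * t - 1)" by presburger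
      with t show "(if s then 2 * t - 1 else 2 * t) \<in> A" by (auto simp: A_def)
    qed
  qed (auto simp: A_def elim!: oddE evenE)
  have "card A = p" using bij_betw_same_card[OF bij] by simp
  then have "shifted_gen n r p s ?z = (\<Prod>i\<in>A. (rho n r i + 1) - rho n r i0)"
    using eq prod_lin_residue[of A "\<lambda>i. rho n r i + 1" "rho n r i0"] by (simp add: A_def)
  also have "\<dots> = (\<Prod>t\<in>{1..p}. (rho n r (if s then 2 * t - 1 else 2 * t) + 1) - rho n r i0)"
    by (rule prod.reindex_bij_betw[OF bij, symmetric])
  also have "\<dots> = (\<Prod>t\<in>{1..p}. of_nat (2 * p - 2 * t) * r + 1)"
  proof (rule prod.cong[OF refl])
    fix t assume "t \<in> {1..p}"
    then have "n - (if s then 2 * t - 1 else 2 * t) = (2 * p - 2 * t) + (n - i0)"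
      using assms by (auto simp: i0_def)
    then show "(rho n r (if s then 2 * t - 1 else 2 * t) + 1) - rho n r i0 = of_nat (2 * p - 2 * t) * r + 1"
      by (simp add: rho_def algebra_simps)
  qed
  finally show ?thesis .
qed

text \<open>The \<open>p\<close> odd-indexed parts up to 2p - 1 are at least 1, so the size bound
  makes them 1 and the later odd-indexed ones 0. Monotonicity then fixes every even-indexed part
  except \<open>l (2 * p)\<close>, which is 0 or 1.\<close>

lemma Lambda_odd_size_column:
  assumes l: "l \<in> Lambda n" and p: "1 \<le> p" "2 * p - 1 \<le> n" and size: "odd_size n l \<le> p" and pos: "l (2 * p - 1) \<noteq> 0"
  shows "l = column (2 * p - 1) \<or> 2 * p \<le> n \<and> l = column (2 * p)"
proof -
  let ?I = "{i \<in> {1..n}. odd i}"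
  have le: "column (2 * p - 1) i \<le> l i" if "i \<in> ?I" for i
    using Lambda_antimono[OF l, of i "2 * p - 1"] that pos by (auto simp: column_def)
  have "(\<Sum>i\<in>?I. column (2 * p - 1) i) = (\<Sum>i\<in>?I. l i)"
  proof (rule antisym)
    show "(\<Sum>i\<in>?I. l i) \<le> (\<Sum>i\<in>?I. column (2 * p - 1) i)"
      using size odd_size_column[OF p(2)] p(1) by (simp add: odd_size_def)
  qed (rule sum_mono, use le in auto)
  then have odd: "l i = column (2 * p - 1) i" if "i \<in> ?I" for i
    using sum_mono_inv[of "column (2 * p - 1)" ?I l i] le that by simp
  have l0: "l i = 0" if "i \<notin> {1..n}" for i using l that by (auto simp: Lambda_def)
  have even: "l i = column (2 * p - 1) i" if i: "i \<in> {1..n}" "even i" "i \<noteq> 2 * p" for i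
  proof -
    have i2: "i - 1 \<in> ?I" using i by (cases i) (auto intro: Suc_leI odd_pos)
    have le1: "l i \<le> l (i - 1)" by (rule Lambda_antimono[OF l]) (use i in \<open>auto elim: evenE\<close>)
    have o1: "l (i - 1) = column (2 * p - 1) (i - 1)" using odd[OF i2] .
    show ?thesis
    proof (cases "i < 2 * p")
      case True
      then have "Suc i \<in> ?I" "i \<le> 2 * p - 2" using i p by (auto elim!: evenE)
      then have "l (Suc i) = 1" using odd[of "Suc i"] p by (auto simp: column_def)
      moreover have "l (Suc i) \<le> l i" by (rule Lambda_antimono[OF l]) (use i in auto)
      moreover have "column (2 * p - 1) (i - 1) = 1" using True i2 by (auto simp: column_def)
      moreover have "column (2 * p - 1) i = 1" using True i by (auto simp: column_def)
      ultimately show ?thesis using le1 o1 by simp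
    next
      case False
      then have "column (2 * p - 1) (i - 1) = 0" "column (2 * p - 1) i = 0"
        using i by (auto simp: column_def)
      then show ?thesis using le1 o1 by simp
    qed
  qed
  have col0: "column (2 * p - 1) i = 0" if "i \<notin> {1..n}" for i
    using that p by (auto simp: column_def)
  show ?thesis
  proof (cases "2 * p \<le> n \<and> l (2 * p) \<noteq> 0")
    case True
    have "l (2 * p) \<le> l (2 * p - 1)" by (rule Lambda_antimono[OF l]) (use p in auto)
    moreover have "l (2 * p - 1) = 1" using odd[of "2 * p - 1"] p by (auto simp: column_def)
    ultimately have "l (2 * p) = 1" using True by simp
    moreover have "column (2 * p) i = column (2 * p - 1) i" if "i \<noteq> 2 * p" for i
      using that by (auto simp: column_def)
    ultimately have "l i = column (2 * p) i" for i
      using odd[of i] even[of i] l0[of i] col0[of i] p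
      by (cases "i = 2 * p"; cases "i \<in> {1..n}"; cases "even i") (auto simp: column_def)
    with True show ?thesis by auto
  next
    case False
    then have "l (2 * p) = column (2 * p - 1) (2 * p)" using l0[of "2 * p"] p by (auto simp: column_def)
    then have "l i = column (2 * p - 1) i" for i
      using odd[of i] even[of i] l0[of i] col0[of i]
      by (cases "i = 2 * p"; cases "i \<in> {1..n}"; cases "even i") auto
    then show ?thesis by auto
  qed
qed

text \<open>\<open>(m + 1) div 2\<close> equals p both for m = 2p - 1 and for m = 2p.\<close>

definition e_value :: "nat \<Rightarrow> (nat \<Rightarrow> 'a) \<Rightarrow> nat \<Rightarrow> 'a::comm_ring_1" where
  "e_value n z m = (if odd m then gen n True z $ ((m + 1) div 2) - gen n False z $ ((m + 1) div 2)
    else gen n False z $ ((m + 1) div 2))"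

text \<open>The explicit formula for the generators. Where \<open>\<mu> (2 * p - 1)\<close> is
  nonzero, the size bound leaves only the columns of lengths 2p - 1 and 2p. One of them is the
  column of length \<open>m\<close>; the other is a zero by \<open>shifted_gen_column\<close> for
  odd \<open>m\<close> and by \<open>shifted_gen_eq_0\<close> for even \<open>m\<close>.\<close>

lemma eval_e_gen:
  fixes r :: "'a::field_char_0"
  assumes r: "\<forall>q::rat. q < 0 \<longrightarrow> r \<noteq> of_rat q" and m: "1 \<le> m" "m \<le> n"
  shows "eval_poly z (e_gen n r m) = e_value n z m"
proof -
  define p where "p = (m + 1) div 2"
  have p: "1 \<le> p" "2 * p - 1 \<le> m" "m = (if odd m then 2 * p - 1 else 2 * p)"
    using m by (auto simp: p_def elim!: oddE evenE)
  have size: "odd_size n (column m) = p" using odd_size_column[OF m(2)] by (simp add: p_def)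
  define S where "S = {i. i \<in> {1..m} \<and> i mod 2 = m mod 2}"
  have card_S: "card S = p" unfolding S_def card_same_parity card_odd p_def ..
  have bracket: "bracket_monom n (column m) = (\<Sum>i\<in>S. Poly_Mapping.single i 1)"
    unfolding bracket_monom_def
    by (rule sum.mono_neutral_cong_right) (use m in \<open>auto simp: S_def bracket_column\<close>)
  have lookup: "Poly_Mapping.lookup (bracket_monom n (column m)) i = (if i \<in> S then 1 else 0)" for i
    by (simp add: bracket lookup_sum lookup_single when_def S_def)
  have keys: "Poly_Mapping.keys (bracket_monom n (column m)) = S"
    by (auto simp: in_keys_iff lookup split: if_splits)
  \<comment> \<open>On points supported in \<open>S\<close> the series of the other parity is 1 and
    has no coefficient in degree p \<ge> 1.\<close>
  have gen_S: "gen n s z $ p = (if s = odd m then \<Prod>i\<in>S. z i else 0)"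
    if "\<And>i. i \<notin> S \<Longrightarrow> z i = 0" for s and z :: "nat \<Rightarrow> 'a"
  proof (cases "s = odd m")
    case True
    have "gen n s z $ card S = (\<Prod>i\<in>S. z i)"
      by (rule gen_nth_prod) (use that m True in \<open>auto simp: S_def odd_iff_mod_2_eq_one\<close>)
    with True show ?thesis by (simp add: card_S)
  next
    case False
    have "gen n s z = (\<Prod>i\<in>{i \<in> {1..n}. odd i = s}. 1)"
      unfolding gen_def
      by (rule prod.cong[OF refl]) (use that False in \<open>auto simp: S_def odd_iff_mod_2_eq_one\<close>)
    with False p(1) show ?thesis by simp
  qed
  define f where "f z = (if odd m then shifted_gen n r p True z - shifted_gen n r p False z else shifted_gen n r p False z)" for z
  have "eval_poly z (R_bar n r (column m)) = e_value n z m"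
  proof (rule eval_R_bar[OF r, where f = f and S = S and q = "Poly_Mapping.single (bracket_monom n (column m)) 1"])
    show "graded n (odd_size n (column m)) f (\<lambda>z. e_value n z m)"
      unfolding size f_def e_value_def p_def[symmetric]
      by (cases "odd m") (auto intro!: graded_diff graded_shifted_gen)
    show "f (z \<circ> \<pi>) = f z" if "\<pi> \<in> W n" for \<pi> z
      using that by (simp add: f_def shifted_gen_invariant)
    fix \<mu> assume \<mu>: "\<mu> \<in> Lambda n" "odd_size n \<mu> \<le> odd_size n (column m)" "\<mu> \<noteq> column m"
    let ?z = "\<lambda>i. rho n r i + of_nat (\<mu> i)"
    have vanish: "shifted_gen n r p s ?z = 0" if "\<mu> (if s then 2 * p - 1 else 2 * p) = 0" for s
    proof (rule shifted_gen_eq_0[OF p(1)])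
      fix i assume i: "i \<in> {1..n}" "odd i = s" "2 * p \<le> i + 1"
      then have "(if s then 2 * p - 1 else 2 * p) \<le> i" by (cases s) (auto elim!: evenE)
      then have "\<mu> i \<le> \<mu> (if s then 2 * p - 1 else 2 * p)"
        using p(1) by (intro Lambda_antimono[OF \<mu>(1)]) auto
      with that show "?z i = rho n r i" by simp
    qed
    have le: "\<mu> (2 * p) \<le> \<mu> (2 * p - 1)" by (rule Lambda_antimono[OF \<mu>(1)]) (use p(1) in auto)
    show "f ?z = 0"
    proof (cases "\<mu> (2 * p - 1) = 0")
      case True
      then show ?thesis using vanish[of True] vanish[of False] le by (simp add: f_def)
    next
      case False
      then consider "\<mu> = column (2 * p - 1)" | "2 * p \<le> n" "\<mu> = column (2 * p)"
        using Lambda_odd_size_column[OF \<mu>(1) p(1) _ _ False] \<mu>(2) p(2) m(2) by (auto simp: size)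
      then show ?thesis
      proof cases
        case 1
        then have "even m" using \<mu>(3) p(3) by auto
        moreover have "\<mu> (2 * p) = 0" using 1 p(1) by (simp add: column_def)
        ultimately show ?thesis using vanish[of False] by (simp add: f_def)
      next
        case 2
        then have "odd m" using \<mu>(3) p(3) by auto
        then show ?thesis using shifted_gen_column[OF p(1) 2(1), of r] 2(2) by (simp add: f_def)
      qed
    qed
  next
    show "mdeg (bracket_monom n (column m)) = odd_size n (column m)"
      by (simp add: mdeg_def keys lookup size card_S)
    show "e_value n z m = eval_poly z (Poly_Mapping.single (bracket_monom n (column m)) 1)"
      if "\<And>i. i \<notin> S \<Longrightarrow> z i = 0" for z :: "nat \<Rightarrow> 'a"
      using gen_S[of z] that
      unfolding e_value_def p_def[symmetric] by (simp add: eval_monom_def keys lookup)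
  qed (simp_all add: keys)
  then show ?thesis by (simp add: e_gen_def)
qed

section \<open>Gamma quotients as power series\<close>

text \<open>With \<open>x = y + 1 / v\<close>, this is the rising factorial \<open>x (x + 1) \<cdots> (x + m - 1)\<close> times \<open>v ^ m\<close>.\<close>

definition rising :: "'a::comm_ring_1 \<Rightarrow> nat \<Rightarrow> 'a fps" where
  "rising y m = (\<Prod>l<m. lin (y + of_nat l))"

lemma rising_0 [simp]: "rising y 0 = 1"
  by (simp add: rising_def)

lemma rising_Suc: "rising y (Suc m) = rising y m * lin (y + of_nat m)"
  by (simp add: rising_def)

lemma rising_nth_0 [simp]: "rising y m $ 0 = 1"
  by (simp add: rising_def)

lemma rising_add: "rising y (m + k) = rising y m * rising (y + of_nat m) k"
  by (induction k) (simp_all add: rising_Suc ac_simps)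

lemma fps_deg_le_rising: "fps_deg_le m (rising y m)"
  using fps_deg_le_prod_lin[of "{..<m}"] by (simp add: rising_def)

text \<open>
  By Gauss's summation formula, with \<open>u = 1 / v\<close>, this is the expansion of
  \<open>\<Gamma>(u + z) \<Gamma>(u + c) / (\<Gamma>(u) \<Gamma>(u + z + c))\<close> at \<open>u = \<infinity>\<close>.
\<close>

definition gamma_coeff :: "'a::field_char_0 \<Rightarrow> 'a \<Rightarrow> nat \<Rightarrow> 'a" where
  "gamma_coeff c z m = pochhammer c m * pochhammer (- z) m / fact m"

definition gamma_fps :: "'a::field_char_0 \<Rightarrow> 'a \<Rightarrow> 'a fps" where
  "gamma_fps c z = Abs_fps (\<lambda>k. \<Sum>m\<le>k. gamma_coeff c z m * inverse (rising c m) $ (k - m))"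

definition gamma_partial :: "'a::field_char_0 \<Rightarrow> 'a \<Rightarrow> nat \<Rightarrow> 'a fps" where
  "gamma_partial c z M = (\<Sum>m\<le>M. fps_const (gamma_coeff c z m) * fps_X ^ m * inverse (rising c m))"

lemma gamma_partial_nth:
  assumes "k \<le> M"
  shows "gamma_partial c z M $ k = gamma_fps c z $ k"
proof -
  have "gamma_partial c z M $ k = (\<Sum>m\<le>M. if m \<le> k then gamma_coeff c z m * inverse (rising c m) $ (k - m) else 0)"
    unfolding gamma_partial_def fps_sum_nth
    by (rule sum.cong) (auto simp: mult.assoc fps_X_power_mult_nth)
  also have "\<dots> = (\<Sum>m\<le>k. gamma_coeff c z m * inverse (rising c m) $ (k - m))"
    by (rule sum.mono_neutral_cong_right) (use assms in auto)
  finally show ?thesis by (simp add: gamma_fps_def)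
qed

text \<open>The relation telescopes: for truncated Gauss sums it holds up to one closed term
  divisible by v^(M+1), which makes it provable by induction on \<open>M\<close> without infinite
  sums.\<close>

lemma gamma_partial_contiguous:
  "lin (z + c) * gamma_partial c (z + 1) M - lin z * gamma_partial c z M =
    fps_const (pochhammer c (Suc M) * pochhammer (- z) M / fact M) * fps_X ^ Suc M * inverse (rising c M)"
proof (induction M)
  case 0
  show ?case by (simp add: gamma_partial_def gamma_coeff_def lin_def algebra_simps flip: fps_const_add)
next
  case (Suc M)
  define q where "q = pochhammer c (Suc M) * pochhammer (- z) M / fact (Suc M)"
  let ?m = "of_nat (Suc M) :: 'a"
  let ?J = "inverse (rising c (Suc M))"
  have m: "?m \<noteq> 0" by (rule of_nat_neq_0)
  have lhs1: "gamma_coeff c (z + 1) (Suc M) = q * (- z - 1)"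
    by (simp add: gamma_coeff_def q_def pochhammer_rec[of "- z - 1"])
  have lhs2: "gamma_coeff c z (Suc M) = q * (- z + of_nat M)"
    by (simp add: gamma_coeff_def q_def pochhammer_Suc[of "- z"])
  have old: "pochhammer c (Suc M) * pochhammer (- z) M / fact M = q * ?m"
    using m by (simp add: q_def field_simps del: of_nat_Suc)
  have new: "pochhammer c (Suc (Suc M)) * pochhammer (- z) (Suc M) / fact (Suc M) = q * ((c + ?m) * (- z + of_nat M))"
    by (simp add: q_def pochhammer_Suc[of c "Suc M"] pochhammer_Suc[of "- z"] del: of_nat_Suc)
  have J: "inverse (rising c M) = lin (c + of_nat M) * ?J"
  proof -
    have "lin (c + of_nat M) * inverse (lin (c + of_nat M)) = 1"
      by (rule inverse_mult_eq_1') simp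
    then show ?thesis by (simp add: rising_Suc fps_inverse_mult mult.left_commute)
  qed
  have key: "lin (z + c) * fps_const (- z - 1) - lin z * fps_const (- z + of_nat M) + fps_const ?m * lin (c + of_nat M)
      = fps_const ((c + ?m) * (- z + of_nat M)) * fps_X"
    by (rule fps_ext) (auto simp: lin_nth algebra_simps)
  have "lin (z + c) * gamma_partial c (z + 1) (Suc M) - lin z * gamma_partial c z (Suc M) =
      (lin (z + c) * gamma_partial c (z + 1) M - lin z * gamma_partial c z M)
      + (lin (z + c) * fps_const (gamma_coeff c (z + 1) (Suc M)) - lin z * fps_const (gamma_coeff c z (Suc M))) * fps_X ^ Suc M * ?J"
    by (simp add: gamma_partial_def algebra_simps)
  also have "\<dots> = fps_const q * (lin (z + c) * fps_const (- z - 1) - lin z * fps_const (- z + of_nat M) + fps_const ?m * lin (c + of_nat M))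
      * fps_X ^ Suc M * ?J"
    unfolding Suc.IH old lhs1 lhs2 J fps_const_mult[symmetric] by (simp only: algebra_simps)
  also have "\<dots> = fps_const (q * ((c + ?m) * (- z + of_nat M))) * fps_X ^ Suc (Suc M) * ?J"
    unfolding key fps_const_mult[symmetric] by (simp only: power_Suc ac_simps)
  finally show ?case unfolding new .
qed

lemma lin_mult_nth: "(lin x * F) $ k = F $ k + (if k = 0 then 0 else x * F $ (k - 1))"
  by (simp add: lin_def distrib_right mult.assoc)

text \<open>The functional equation of the Gamma quotient under z to z + 1. Degree \<open>k\<close>
  is read off from the sums truncated at \<open>k\<close>, whose error starts in degree k +
  1.\<close>

lemma gamma_fps_shift: "lin (z + c) * gamma_fps c (z + 1) = lin z * gamma_fps c z"
proof (rule fps_ext)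
  fix k
  have "(lin (z + c) * gamma_partial c (z + 1) k - lin z * gamma_partial c z k) $ k = 0"
    unfolding gamma_partial_contiguous by (simp add: mult.assoc fps_X_power_mult_nth del: power_Suc)
  then show "(lin (z + c) * gamma_fps c (z + 1)) $ k = (lin z * gamma_fps c z) $ k"
    by (cases "k = 0") (simp_all add: lin_mult_nth gamma_partial_nth)
qed

lemma gamma_fps_nth_0 [simp]: "gamma_fps c z $ 0 = 1"
  by (simp add: gamma_fps_def gamma_coeff_def)

lemma gamma_fps_rising:
  "rising (z + c) m * gamma_fps c (z + of_nat m) = rising z m * gamma_fps c z"
proof (induction m)
  case (Suc m)
  have "rising (z + c) (Suc m) * gamma_fps c (z + of_nat (Suc m)) =
      rising (z + c) m * (lin (z + of_nat m + c) * gamma_fps c (z + of_nat m + 1))"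
    by (simp add: rising_Suc ac_simps)
  also have "\<dots> = lin (z + of_nat m) * (rising (z + c) m * gamma_fps c (z + of_nat m))"
    unfolding gamma_fps_shift by (rule mult.left_commute)
  also have "\<dots> = rising z (Suc m) * gamma_fps c z"
    unfolding Suc.IH by (simp add: rising_Suc ac_simps)
  finally show ?case .
qed simp

text \<open>The series (1 + x v)^c for an arbitrary exponent \<open>c\<close>.\<close>

definition bin_fps :: "'a::field_char_0 \<Rightarrow> 'a \<Rightarrow> 'a fps" where
  "bin_fps c x = Abs_fps (\<lambda>m. (c gchoose m) * x ^ m)"

lemma graded_pochhammer:
  assumes "i \<in> {1..n}"
  shows "graded n m (\<lambda>z. pochhammer (- z i) m) (\<lambda>z. (- 1) ^ m * z i ^ m)"
proof (induction m)
  case 0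
  show ?case by (simp add: graded_const)
next
  case (Suc m)
  have "graded n 1 (\<lambda>z. - 1 * z i + of_nat m) (\<lambda>z. - 1 * z i + 0)"
    by (rule graded_add[OF graded_cmult[OF graded_var[OF assms]] graded_weaken[OF graded_const]]) simp
  from graded_mult[OF Suc this] show ?case by (simp add: pochhammer_Suc mult.assoc power_commutes)
qed

text \<open>In coefficient \<open>k\<close> the m-th Gauss term has degree m in z_i, so only m = k
  reaches the top degree; there (-1)^k times \<open>pochhammer c k / fact k\<close> is the binomial
  coefficient of - c.\<close>

lemma graded_fps_gamma:
  assumes "i \<in> {1..n}"
  shows "graded_fps n (\<lambda>z. gamma_fps c (z i)) (\<lambda>z. bin_fps (- c) (z i))"
  unfolding graded_fps_def
proof
  fix k
  have "graded n k (\<lambda>z. \<Sum>m\<le>k. gamma_coeff c (z i) m * inverse (rising c m) $ (k - m))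
      (\<lambda>z. \<Sum>m\<le>k. if m = k then (- c gchoose k) * z i ^ k else 0)"
  proof (rule graded_sum)
    fix m assume "m \<in> {..k}"
    define s where "s = pochhammer c m / fact m * inverse (rising c m) $ (k - m)"
    have g: "graded n m (\<lambda>z. s * pochhammer (- z i) m) (\<lambda>z. s * ((- 1) ^ m * z i ^ m))"
      by (rule graded_cmult[OF graded_pochhammer[OF assms]])
    have f: "gamma_coeff c (z i) m * inverse (rising c m) $ (k - m) = s * pochhammer (- z i) m" for z
      by (simp add: s_def gamma_coeff_def)
    show "graded n k (\<lambda>z. gamma_coeff c (z i) m * inverse (rising c m) $ (k - m))
      (\<lambda>z. if m = k then (- c gchoose k) * z i ^ k else 0)"
    proof (cases "m = k")
      case True
      have "(\<lambda>z. s * ((- 1) ^ m * z i ^ m)) = (\<lambda>z. (- c gchoose k) * z i ^ k)"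
        using True by (simp add: s_def gbinomial_pochhammer fun_eq_iff)
      with g have "graded n m (\<lambda>z. s * pochhammer (- z i) m) (\<lambda>z. (- c gchoose k) * z i ^ k)"
        by (simp only:)
      with True show ?thesis unfolding f by simp
    next
      case False
      with g \<open>m \<in> {..k}\<close> show ?thesis unfolding f by (auto intro: graded_weaken)
    qed
  qed
  then show "graded n k (\<lambda>z. gamma_fps c (z i) $ k) (\<lambda>z. bin_fps (- c) (z i) $ k)"
    by (simp add: gamma_fps_def bin_fps_def)
qed

lemma graded_fps_rising:
  assumes "i \<in> {1..n}"
  shows "graded_fps n (\<lambda>z. rising (z i + c) j) (\<lambda>z. lin (z i) ^ j)"
proof -
  have "graded_fps n (\<lambda>z. \<Prod>l<j. lin (z i + (c + of_nat l))) (\<lambda>z. \<Prod>l<j. lin (z i))"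
    by (intro graded_fps_prod graded_fps_lin assms)
  then show ?thesis by (simp add: rising_def add.assoc)
qed

text \<open>The product \<Psi>_j up to factors free of \<open>z\<close>: v^j for each odd index and
  \<Gamma>(u + 2r + j) / \<Gamma>(u) for each even one. They turn it into a power series in v with
  constant term 1.\<close>

definition psi :: "nat \<Rightarrow> 'a::field_char_0 \<Rightarrow> nat \<Rightarrow> (nat \<Rightarrow> 'a) \<Rightarrow> 'a fps" where
  "psi n r j z = (\<Prod>i\<in>{i \<in> {1..n}. odd i = True}. rising (z i + r) j) *
     (\<Prod>i\<in>{i \<in> {1..n}. odd i = False}. gamma_fps (2 * r + of_nat j) (z i))"

definition bin_prod :: "nat \<Rightarrow> 'a::field_char_0 \<Rightarrow> (nat \<Rightarrow> 'a) \<Rightarrow> 'a fps" where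
  "bin_prod n c z = (\<Prod>i\<in>{i \<in> {1..n}. odd i = False}. bin_fps c (z i))"

lemma fps_prod_nth_0: "prod f A $ 0 = (\<Prod>x\<in>A. f x $ (0::nat))"
  by (induction A rule: infinite_finite_induct) simp_all

lemma psi_nth_0 [simp]: "psi n r j z $ 0 = 1"
  by (simp add: psi_def fps_prod_nth_0)

lemma graded_fps_psi: "graded_fps n (psi n r j) (\<lambda>z. gen n True z ^ j * bin_prod n (- 2 * r - of_nat j) z)"
proof -
  have "graded_fps n (psi n r j) (\<lambda>z. (\<Prod>i\<in>{i \<in> {1..n}. odd i = True}. lin (z i) ^ j) * bin_prod n (- (2 * r + of_nat j)) z)"
    unfolding psi_def bin_prod_def
    by (intro graded_fps_mult graded_fps_prod graded_fps_rising graded_fps_gamma) auto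
  then show ?thesis by (simp add: gen_def prod_power_distrib)
qed

lemma psi_invariant: "\<pi> \<in> W n \<Longrightarrow> psi n r j (z \<circ> \<pi>) = psi n r j z"
  unfolding psi_def comp_def
  using W_reindex_prod[of \<pi> n "\<lambda>x. rising (x + r) j" z True]
    W_reindex_prod[of \<pi> n "\<lambda>x. gamma_fps (2 * r + of_nat j) x" z False] by simp

section \<open>The polynomials of a two-row partition\<close>

lemma psi_step_odd:
  "rising (x + of_nat m + r) j * rising (x + r) m = rising (x + r + of_nat j) m * rising (x + r) j"
proof -
  have "rising (x + r) (m + j) = rising (x + r) (j + m)" by (simp add: add.commute)
  then show ?thesis unfolding rising_add by (simp add: ac_simps)
qed

text \<open>The i-th factor of \<open>psi\<close> at \<open>rho + \<mu>\<close>, divided by the one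
  at \<open>rho\<close>, is \<open>chain_num\<close> over \<open>chain_den\<close>.\<close>

definition chain_num :: "nat \<Rightarrow> 'a::field_char_0 \<Rightarrow> nat \<Rightarrow> (nat \<Rightarrow> nat) \<Rightarrow> nat \<Rightarrow> 'a fps" where
  "chain_num n r j \<mu> i = rising (if odd i then rho n r i + r + of_nat j else rho n r i) (\<mu> i)"

definition chain_den :: "nat \<Rightarrow> 'a::field_char_0 \<Rightarrow> nat \<Rightarrow> (nat \<Rightarrow> nat) \<Rightarrow> nat \<Rightarrow> 'a fps" where
  "chain_den n r j \<mu> i = rising (if odd i then rho n r i + r else rho n r i + (2 * r + of_nat j)) (\<mu> i)"

definition psi_factor :: "'a::field_char_0 \<Rightarrow> nat \<Rightarrow> nat \<Rightarrow> 'a \<Rightarrow> 'a fps" where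
  "psi_factor r j i x = (if odd i then rising (x + r) j else gamma_fps (2 * r + of_nat j) x)"

lemma psi_eq_prod: "psi n r j z = (\<Prod>i=1..n. psi_factor r j i (z i))"
proof -
  have "(\<Prod>i=1..n. psi_factor r j i (z i)) =
      (\<Prod>i\<in>{i \<in> {1..n}. odd i = True} \<union> {i \<in> {1..n}. odd i = False}. psi_factor r j i (z i))"
    by (rule prod.cong) auto
  also have "\<dots> = (\<Prod>i\<in>{i \<in> {1..n}. odd i = True}. psi_factor r j i (z i)) *
      (\<Prod>i\<in>{i \<in> {1..n}. odd i = False}. psi_factor r j i (z i))"
    by (rule prod.union_disjoint) auto
  also have "\<dots> = psi n r j z"
    unfolding psi_def by (intro arg_cong2[of _ _ _ _ "(*)"] prod.cong) (auto simp: psi_factor_def)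
  finally show ?thesis ..
qed

lemma psi_chain:
  "psi n r j (\<lambda>i. rho n r i + of_nat (\<mu> i)) * (\<Prod>i=1..n. chain_den n r j \<mu> i) =
    psi n r j (rho n r) * (\<Prod>i=1..n. chain_num n r j \<mu> i)"
proof -
  have "psi_factor r j i (rho n r i + of_nat (\<mu> i)) * chain_den n r j \<mu> i =
      psi_factor r j i (rho n r i) * chain_num n r j \<mu> i" for i
  proof (cases "odd i")
    case True
    then show ?thesis
      using psi_step_odd[of "rho n r i" "\<mu> i" r j]
      by (simp add: psi_factor_def chain_den_def chain_num_def mult.commute)
  next
    case False
    then show ?thesis
      using gamma_fps_rising[of "rho n r i" "2 * r + of_nat j" "\<mu> i"]
      by (simp add: psi_factor_def chain_den_def chain_num_def mult.commute)
  qed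
  then show ?thesis
    unfolding psi_eq_prod prod.distrib[symmetric] by simp
qed

text \<open>Since rho_m = rho_(m+1) + r, the numerator at m and the denominator at m + 1 start at
  the same point. As \<mu>_(m+1) \<le> \<mu>_m, their quotient is a polynomial in v of degree
  \<mu>_m - \<mu>_(m+1); \<open>C\<close> collects these quotients. Only the denominator at 1
  survives, namely \<open>rising (of_nat n * r) (\<mu> 1)\<close>.\<close>

lemma chain_prod:
  assumes "\<mu> \<in> Lambda n" "1 \<le> m" "m \<le> n"
  shows "\<exists>C. fps_deg_le (\<mu> 1 - \<mu> m) C \<and>
    (\<Prod>i=1..m. chain_num n r j \<mu> i) * rising (of_nat n * r) (\<mu> 1) =
    C * chain_num n r j \<mu> m * (\<Prod>i=1..m. chain_den n r j \<mu> i)"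
  using assms(2,3)
proof (induction m rule: dec_induct)
  case base
  have "of_nat n * r = rho n r 1 + r"
    using base by (simp add: rho_def of_nat_diff algebra_simps)
  then have "chain_den n r j \<mu> 1 = rising (of_nat n * r) (\<mu> 1)"
    by (simp add: chain_den_def)
  then show ?case by (intro exI[of _ 1]) (simp add: fps_deg_le_1)
next
  case (step m)
  then obtain C where C: "fps_deg_le (\<mu> 1 - \<mu> m) C"
    "(\<Prod>i=1..m. chain_num n r j \<mu> i) * rising (of_nat n * r) (\<mu> 1) =
      C * chain_num n r j \<mu> m * (\<Prod>i=1..m. chain_den n r j \<mu> i)" by auto
  define y where "y = (if odd m then rho n r m + r + of_nat j else rho n r m)"
  have "n - m = Suc (n - Suc m)" using step.prems by simp
  then have rho: "rho n r m = rho n r (Suc m) + r" by (simp add: rho_def algebra_simps)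
  have le: "\<mu> (Suc m) \<le> \<mu> m" "\<mu> m \<le> \<mu> 1"
    using step.hyps by (auto intro: Lambda_antimono[OF assms(1)])
  have num: "chain_num n r j \<mu> m = rising y (\<mu> (Suc m) + (\<mu> m - \<mu> (Suc m)))"
    using le by (simp add: chain_num_def y_def)
  have den: "chain_den n r j \<mu> (Suc m) = rising y (\<mu> (Suc m))"
    by (simp add: chain_den_def y_def rho algebra_simps)
  define C' where "C' = C * rising (y + of_nat (\<mu> (Suc m))) (\<mu> m - \<mu> (Suc m))"
  have "fps_deg_le (\<mu> 1 - \<mu> (Suc m)) C'"
    using fps_deg_le_mult[OF C(1) fps_deg_le_rising, of "\<mu> m - \<mu> (Suc m)" "y + of_nat (\<mu> (Suc m))"] le
    by (simp add: C'_def)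
  moreover have "(\<Prod>i=1..Suc m. chain_num n r j \<mu> i) * rising (of_nat n * r) (\<mu> 1) =
      ((\<Prod>i=1..m. chain_num n r j \<mu> i) * rising (of_nat n * r) (\<mu> 1)) * chain_num n r j \<mu> (Suc m)"
    by (simp add: ac_simps)
  then have "(\<Prod>i=1..Suc m. chain_num n r j \<mu> i) * rising (of_nat n * r) (\<mu> 1) =
      C' * chain_num n r j \<mu> (Suc m) * (\<Prod>i=1..Suc m. chain_den n r j \<mu> i)"
    unfolding C(2) num rising_add by (simp add: C'_def den ac_simps)
  ultimately show ?case by blast
qed

lemma fps_mult_right_cancel:
  fixes c :: "'a::field fps"
  assumes "F * c = G * c" "c $ 0 = 1"
  shows "F = G"
proof -
  have "c $ 0 \<noteq> (0 :: 'a fps) $ 0" unfolding assms(2) by simp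
  then have "c \<noteq> 0" by (rule contrapos_nn) simp
  then show ?thesis by (rule iffD1[OF mult_right_cancel]) (rule assms(1))
qed

text \<open>What remains of the chain is \<open>C\<close> times the last numerator. This degree
  bound is what forces zeros at all points with a short first row.\<close>

lemma psi_ratio:
  fixes r :: "'a::field_char_0"
  assumes "\<mu> \<in> Lambda n" "1 \<le> n"
  shows "\<exists>C. fps_deg_le (\<mu> 1) C \<and> inverse (psi n r j (rho n r)) * psi n r j (\<lambda>i. rho n r i + of_nat (\<mu> i)) *
    rising (of_nat n * r) (\<mu> 1) = C"
proof -
  let ?D = "\<Prod>i=1..n. chain_den n r j \<mu> i" and ?N = "\<Prod>i=1..n. chain_num n r j \<mu> i"
  let ?\<psi> = "psi n r j (\<lambda>i. rho n r i + of_nat (\<mu> i))" and ?I = "inverse (psi n r j (rho n r))"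
  obtain C where C: "fps_deg_le (\<mu> 1 - \<mu> n) C"
    "?N * rising (of_nat n * r) (\<mu> 1) = C * chain_num n r j \<mu> n * ?D"
    using chain_prod[OF assms(1,2) order.refl] by blast
  have inv: "?I * psi n r j (rho n r) = 1" by (rule inverse_mult_eq_1) simp
  have "?I * ?\<psi> * rising (of_nat n * r) (\<mu> 1) * ?D = ?I * (?\<psi> * ?D) * rising (of_nat n * r) (\<mu> 1)"
    by (simp only: ac_simps)
  also have "\<dots> = (?I * psi n r j (rho n r)) * (?N * rising (of_nat n * r) (\<mu> 1))"
    unfolding psi_chain by (simp only: ac_simps)
  also have "\<dots> = (C * chain_num n r j \<mu> n) * ?D"
    unfolding inv C(2) by simp
  finally have "?I * ?\<psi> * rising (of_nat n * r) (\<mu> 1) = C * chain_num n r j \<mu> n"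
    by (rule fps_mult_right_cancel) (simp add: fps_prod_nth_0 chain_den_def)
  moreover have "fps_deg_le ((\<mu> 1 - \<mu> n) + \<mu> n) (C * chain_num n r j \<mu> n)"
    unfolding chain_num_def by (intro fps_deg_le_mult C fps_deg_le_rising)
  moreover have "\<mu> n \<le> \<mu> 1" by (rule Lambda_antimono[OF assms(1)]) (use assms(2) in auto)
  ultimately show ?thesis by simp
qed

text \<open>Only the first two indices matter. The numerator at 1 and the denominator at 2 both
  start at nr + j, so a rising factorial of length a - d remains, and the other factor is free of
  \<open>j\<close>.\<close>

lemma psi_ratio_two_row:
  fixes r :: "'a::field_char_0"
  assumes "n \<ge> 2 \<or> d = 0" "1 \<le> n" "d \<le> a"
  shows "inverse (psi n r j (rho n r)) * psi n r j (\<lambda>i. rho n r i + of_nat (two_row a d i)) * rising (of_nat n * r) a =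
    rising (of_nat n * r + of_nat j + of_nat d) (a - d) * rising (of_nat n * r - 2 * r) d"
proof -
  let ?D = "\<Prod>i=1..n. chain_den n r j (two_row a d) i" and ?N = "\<Prod>i=1..n. chain_num n r j (two_row a d) i"
  let ?\<psi> = "psi n r j (\<lambda>i. rho n r i + of_nat (two_row a d i))" and ?I = "inverse (psi n r j (rho n r))"
  let ?y = "of_nat n * r + of_nat j"
  have rho1: "rho n r 1 + r = of_nat n * r"
    using assms(2) by (simp add: rho_def of_nat_diff algebra_simps)
  have prods: "(\<Prod>i=1..n. g i) = g 1 * g 2" if "\<And>i. i \<ge> 3 \<Longrightarrow> g i = 1" "n = 1 \<Longrightarrow> g 2 = 1" for g :: "nat \<Rightarrow> 'a fps"
  proof (cases "n = 1")
    case False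
    then have "(\<Prod>i=1..n. g i) = (\<Prod>i\<in>{1, 2}. g i)"
      using assms(2) that(1) by (intro prod.mono_neutral_right) auto
    then show ?thesis by simp
  qed (use that in simp)
  have rho2: "rho n r 2 = of_nat n * r - 2 * r" if "n \<noteq> 1"
    using assms(2) that by (simp add: rho_def of_nat_diff algebra_simps)
  have D: "?D = rising (of_nat n * r) a * rising ?y d"
  proof -
    have "?D = chain_den n r j (two_row a d) 1 * chain_den n r j (two_row a d) 2"
      by (rule prods) (use assms(1) in \<open>auto simp: chain_den_def two_row_def\<close>)
    moreover have "chain_den n r j (two_row a d) 2 = rising ?y d"
      using assms(1) rho2 by (cases "d = 0") (auto simp: chain_den_def two_row_def)
    ultimately show ?thesis by (simp add: chain_den_def two_row_def rho1[simplified])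
  qed
  have N: "?N = rising ?y a * rising (of_nat n * r - 2 * r) d"
  proof -
    have "?N = chain_num n r j (two_row a d) 1 * chain_num n r j (two_row a d) 2"
      by (rule prods) (use assms(1) in \<open>auto simp: chain_num_def two_row_def\<close>)
    moreover have "chain_num n r j (two_row a d) 2 = rising (of_nat n * r - 2 * r) d"
      using assms(1) rho2 by (cases "d = 0") (auto simp: chain_num_def two_row_def)
    ultimately show ?thesis by (simp add: chain_num_def two_row_def rho1[simplified])
  qed
  have inv: "?I * psi n r j (rho n r) = 1" by (rule inverse_mult_eq_1) simp
  have "?I * ?\<psi> * rising (of_nat n * r) a * rising ?y d = ?I * (?\<psi> * ?D)"
    by (simp only: D ac_simps)
  also have "\<dots> = (?I * psi n r j (rho n r)) * ?N"
    unfolding psi_chain by (simp only: ac_simps)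
  also have "\<dots> = rising ?y (d + (a - d)) * rising (of_nat n * r - 2 * r) d"
    unfolding inv N using assms(3) by simp
  also have "\<dots> = rising (?y + of_nat d) (a - d) * rising (of_nat n * r - 2 * r) d * rising ?y d"
    unfolding rising_add by (simp only: ac_simps)
  finally show ?thesis by (rule fps_mult_right_cancel) simp
qed

lemma rising_residue:
  fixes x y w :: "'a::field_char_0"
  shows "(rising x m * rising y k * inverse (lin w)) $ (m + k) =
    (\<Prod>l<m. x + of_nat l - w) * (\<Prod>l<k. y + of_nat l - w)"
proof -
  \<comment> \<open>The disjoint sum of index sets lets the residue formula treat both products as
    one.\<close>
  define f where "f = case_sum (\<lambda>l. x + of_nat l) (\<lambda>l. y + of_nat l)"
  have "((\<Prod>t\<in>{..<m} <+> {..<k}. lin (f t)) * inverse (lin w)) $ card ({..<m} <+> {..<k}) =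
      (\<Prod>t\<in>{..<m} <+> {..<k}. f t - w)"
    by (rule prod_lin_residue) simp
  then show ?thesis
    by (simp add: prod.Plus card_Plus f_def rising_def)
qed

section \<open>Finite differences, nonvanishing constants and powers of E_even\<close>

lemma prod_falling: "(\<Prod>l<m. of_nat j + of_nat l + 1 - of_nat m) = (fact m * of_nat (j choose m) :: 'a::field_char_0)"
proof -
  have "(\<Prod>l<m. of_nat j + of_nat l + 1 - of_nat m) = (\<Prod>l<m. (\<lambda>i. of_nat j - of_nat i :: 'a) (m - Suc l))"
    by (rule prod.cong) (auto simp: of_nat_diff)
  also have "\<dots> = (\<Prod>l<m. of_nat j - of_nat l)"
    by (rule prod.nat_diff_reindex)
  also have "\<dots> = fact m * (of_nat j gchoose m)"
    by (simp add: gbinomial_prod_rev atLeast0LessThan)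
  finally show ?thesis by (simp add: binomial_gbinomial)
qed

text \<open>This is the k-th finite difference at 0 of \<open>j choose m\<close>. For m > k all
  terms vanish; for m < k, choosing the subset of size m first leaves an alternating sum over row k
  - m of Pascal's triangle.\<close>

lemma alternating_choose_sum:
  assumes "m \<noteq> k"
  shows "(\<Sum>j\<le>k. (- 1) ^ (k - j) * of_nat (k choose j) * of_nat (j choose m)) = (0 :: 'a::field_char_0)"
proof (cases "m < k")
  case True
  have "(\<Sum>j\<le>k. (- 1) ^ (k - j) * of_nat (k choose j) * of_nat (j choose m)) =
      (\<Sum>j=m..k. (- 1) ^ (k - j) * of_nat (k choose j) * of_nat (j choose m) :: 'a)"
    by (rule sum.mono_neutral_right) auto
  also have "\<dots> = (\<Sum>i\<le>k - m. (- 1) ^ (k - (m + i)) * of_nat (k choose (m + i)) * of_nat ((m + i) choose m))"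
    by (rule sum.reindex_bij_witness[of _ "\<lambda>i. m + i" "\<lambda>j. j - m"]) (use True in auto)
  also have "\<dots> = (\<Sum>i\<le>k - m. ((- 1) ^ (k - m) * of_nat (k choose m)) * ((- 1) ^ i * of_nat ((k - m) choose i)))"
  proof (rule sum.cong[OF refl])
    fix i assume i: "i \<in> {..k - m}"
    then have "(k choose (m + i)) * ((m + i) choose m) = (k choose m) * ((k - m) choose i)"
      using choose_mult[of m "m + i" k] True by simp
    then have "(of_nat (k choose (m + i)) * of_nat ((m + i) choose m) :: 'a) = of_nat (k choose m) * of_nat ((k - m) choose i)"
      by (metis of_nat_mult)
    moreover have "(- 1) ^ (k - (m + i)) = (- 1 :: 'a) ^ (k - m) * (- 1) ^ i"
    proof -
      have "even (k - (m + i)) \<longleftrightarrow> even (k - m + i)" using i True by auto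
      then show ?thesis by (simp add: minus_one_power_iff flip: power_add)
    qed
    ultimately show "(- 1) ^ (k - (m + i)) * of_nat (k choose (m + i)) * of_nat ((m + i) choose m) =
        ((- 1) ^ (k - m) * of_nat (k choose m)) * ((- 1) ^ i * of_nat ((k - m) choose i) :: 'a)"
      by (simp add: mult.assoc)
  qed
  also have "\<dots> = 0"
    unfolding sum_distrib_left[symmetric] using choose_alternating_sum[of "k - m", where 'a = 'a] True by simp
  finally show ?thesis .
qed (use assms in \<open>auto simp: binomial_eq_0\<close>)

text \<open>A vanishing factor forces 2r = - (k + l) with l < b, so r is a negative rational or
  zero; the latter is excluded because b > 0.\<close>

lemma gchoose_nonzero:
  fixes r :: "'a::field_char_0"
  assumes r: "\<forall>q::rat. q < 0 \<longrightarrow> r \<noteq> of_rat q" and "r \<noteq> 0 \<or> b = 0"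
  shows "(- 2 * r - of_nat k) gchoose b \<noteq> 0"
proof
  assume "(- 2 * r - of_nat k) gchoose b = 0"
  then obtain l where l: "l < b" "- 2 * r - of_nat k - of_nat l = 0"
    by (auto simp: gbinomial_prod_rev)
  have "2 * r + of_nat (k + l) = - (- 2 * r - of_nat k - of_nat l)" by simp
  then have "2 * r = - of_nat (k + l)" unfolding l(2) eq_neg_iff_add_eq_0 by simp
  then have "r = - of_nat (k + l) / 2" by (simp add: field_simps)
  also have "\<dots> = of_rat (- of_nat (k + l) / 2)" by (simp add: of_rat_divide of_rat_minus del: of_nat_add)
  finally have "\<not> (- of_nat (k + l) / 2 < (0::rat))" using r by blast
  then have "k + l = 0" by (simp del: of_nat_add)
  with \<open>r = - of_nat (k + l) / 2\<close> l assms(2) show False by simp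
qed

lemma bin_fps_add: "bin_fps (c + 1) x = lin x * bin_fps c x"
proof (rule fps_ext)
  fix m show "bin_fps (c + 1) x $ m = (lin x * bin_fps c x) $ m"
  proof (cases m)
    case (Suc k)
    then show ?thesis
      using gbinomial_Suc_Suc[of c k] by (simp add: lin_mult_nth bin_fps_def algebra_simps)
  qed (simp add: lin_mult_nth bin_fps_def)
qed

text \<open>It brings the powers E_even^(-2r-j) to the common exponent -2r-k, so that the k-th
  difference in \<open>j\<close> becomes a binomial expansion.\<close>

lemma bin_prod_add: "bin_prod n (c + of_nat j) z = gen n False z ^ j * bin_prod n c z"
proof (induction j)
  case (Suc j)
  have "bin_prod n (c + of_nat (Suc j)) z = bin_prod n ((c + of_nat j) + 1) z" by (simp add: ac_simps)
  also have "\<dots> = gen n False z * bin_prod n (c + of_nat j) z"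
    by (simp add: bin_prod_def gen_def bin_fps_add prod.distrib)
  finally show ?case by (simp add: Suc)
qed simp

text \<open>The first part uses up the whole odd size, so the third part is 0 and with it all later
  ones.\<close>

lemma Lambda_two_row:
  assumes \<mu>: "\<mu> \<in> Lambda n" "odd_size n \<mu> \<le> a" "a \<le> \<mu> 1" and n: "1 \<le> n"
  shows "\<mu> = two_row a (\<mu> 2)" "\<mu> 2 \<le> a" "n \<ge> 2 \<or> \<mu> 2 = 0"
proof -
  have split: "odd_size n \<mu> = \<mu> 1 + (\<Sum>i\<in>{i \<in> {1..n}. odd i} - {1}. \<mu> i)"
    unfolding odd_size_def by (rule sum.remove) (use n in auto)
  have 1: "\<mu> 1 = a" "(\<Sum>i\<in>{i \<in> {1..n}. odd i} - {1}. \<mu> i) = 0"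
    using \<mu>(2,3) unfolding split by linarith+
  have out: "\<mu> i = 0" if "i \<notin> {1..n}" for i using \<mu>(1) that by (auto simp: Lambda_def)
  have 3: "\<mu> 3 = 0" using 1(2) out[of 3] by (cases "3 \<le> n") auto
  have "\<mu> i = two_row a (\<mu> 2) i" for i
  proof -
    consider "i = 0" | "i = 1" | "i = 2" | "i \<ge> 3" by linarith
    then show ?thesis
    proof cases
      case 4
      then show ?thesis using Lambda_antimono[OF \<mu>(1), of 3 i] 3 by (simp add: two_row_def)
    qed (use 1 out[of 0] in \<open>auto simp: two_row_def\<close>)
  qed
  then show "\<mu> = two_row a (\<mu> 2)" by blast
  show "\<mu> 2 \<le> a" using Lambda_antimono[OF \<mu>(1), of 1 2] 1 by simp
  show "n \<ge> 2 \<or> \<mu> 2 = 0" using out[of 2] by (cases "n \<ge> 2") simp_all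
qed

lemma odd_size_two_row: "1 \<le> n \<Longrightarrow> odd_size n (two_row a b) = a"
proof -
  assume n: "1 \<le> n"
  have "odd_size n (two_row a b) = (\<Sum>i\<in>{1}. two_row a b i)"
    unfolding odd_size_def
    by (rule sum.mono_neutral_right) (use n in \<open>auto simp: two_row_def\<close>)
  then show ?thesis by (simp add: two_row_def)
qed

lemma bracket_monom_two_row:
  assumes "1 \<le> n" "b \<le> a" "n \<ge> 2 \<or> b = 0"
  shows "bracket_monom n (two_row a b) = Poly_Mapping.single 1 (a - b) + Poly_Mapping.single 2 b"
proof -
  have sum2: "sum g {1..n} = g 1 + g 2"
    if "\<And>i. i \<ge> 3 \<Longrightarrow> g i = 0" "n = 1 \<Longrightarrow> g 2 = 0" for g :: "nat \<Rightarrow> 'b::comm_monoid_add"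
  proof (cases "n = 1")
    case False
    then have "sum g {1..n} = sum g {1, 2}"
      using assms(1) that(1) by (intro sum.mono_neutral_right) auto
    then show ?thesis by simp
  qed (use that in simp)
  have 1: "bracket n (two_row a b) 1 = int a - int b"
    unfolding bracket_def by (subst sum2) (use assms(3) in \<open>auto simp: two_row_def\<close>)
  have 2: "bracket n (two_row a b) 2 = int b"
  proof -
    have "bracket n (two_row a b) 2 = (\<Sum>j=2..n. if j = 2 then int b else 0)"
      unfolding bracket_def by (rule sum.cong) (auto simp: two_row_def)
    then show ?thesis using assms(3) by auto
  qed
  have 3: "bracket n (two_row a b) i = 0" if "i \<ge> 3" for i
    unfolding bracket_def by (rule sum.neutral) (use that in \<open>auto simp: two_row_def\<close>)
  show ?thesis
    unfolding bracket_monom_def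
    by (subst sum2) (use 1 2 3 assms in \<open>auto simp: nat_diff_distrib\<close>)
qed

text \<open>Degree and invariance come from \<open>psi\<close>, the zeros from the telescoped
  quotients and the finite difference, and the normalization from points where only z_1 and z_2 may
  be nonzero.\<close>

lemma eval_R_bar_two_row:
  fixes r :: "'a::field_char_0"
  assumes n: "n \<ge> 1" and r: "\<forall>q::rat. q < 0 \<longrightarrow> r \<noteq> of_rat q" and ba: "b \<le> a" and nb: "n \<ge> 2 \<or> b = 0"
    and ra: "r \<noteq> 0 \<or> a = 0"
  shows "eval_poly z (R_bar n r (two_row a b)) =
    inverse ((- 2 * r - of_nat (a - b)) gchoose b) *
    ((gen n True z - gen n False z) ^ (a - b) * bin_prod n (- 2 * r - of_nat (a - b)) z) $ a"
proof -
  define k where "k = a - b"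
  have a: "a = k + b" using ba by (simp add: k_def)
  \<comment> \<open>The coefficient of the bracket monomial in the leading part before
    normalization.\<close>
  define c where "c = (- 2 * r - of_nat k) gchoose b"
  have c: "c \<noteq> 0" unfolding c_def by (rule gchoose_nonzero[OF r]) (use ra ba in auto)
  let ?y = "of_nat n * r"
  \<comment> \<open>This extracts the a-th coefficient in inverse factorials of u + nr: multiplied
    by \<open>rising ?y (a - 1)\<close>, the shorter ones become polynomials of degree below a, and
    the longer ones start beyond v^a. For a = 0 it is the constant term.\<close>
  define coef where "coef j z = (rising ?y (a - 1) * inverse (psi n r j (rho n r)) * psi n r j z) $ a" for j z
  define f where "f z = inverse c * (\<Sum>j\<le>k. (- 1) ^ (k - j) * of_nat (k choose j) * coef j z)" for z
  define g where "g z = inverse c * ((gen n True z - gen n False z) ^ k * bin_prod n (- 2 * r - of_nat k) z) $ a" for z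
  define m where "m = (Poly_Mapping.single 1 k + Poly_Mapping.single 2 b :: monom)"
  have m: "bracket_monom n (two_row a b) = m"
    using bracket_monom_two_row[OF n ba nb] by (simp add: m_def k_def)
  define q where "q = (\<Sum>i\<le>k. Poly_Mapping.single (Poly_Mapping.single 1 i + Poly_Mapping.single 2 (k - i + b) :: monom)
    (of_nat (k choose i) * (- 1 :: 'a) ^ (k - i)))"
  have "eval_poly z (R_bar n r (two_row a b)) = g z"
  proof (rule eval_R_bar[OF r, where f = f and S = "{1, 2} \<inter> {1..n}" and q = q])
    show "graded n (odd_size n (two_row a b)) f g"
      unfolding odd_size_two_row[OF n]
    proof -
      have "graded n a f (\<lambda>z. inverse c * (\<Sum>j\<le>k. (- 1) ^ (k - j) * of_nat (k choose j) *
          (gen n True z ^ j * bin_prod n (- 2 * r - of_nat j) z) $ a))"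
        unfolding f_def
      proof (intro graded_cmult graded_sum)
        fix j
        have "graded_fps n (\<lambda>z. rising ?y (a - 1) * inverse (psi n r j (rho n r)) * psi n r j z)
            (\<lambda>z. gen n True z ^ j * bin_prod n (- 2 * r - of_nat j) z)"
          by (rule graded_fps_scale[OF _ graded_fps_psi]) simp
        then show "graded n a (coef j) (\<lambda>z. (gen n True z ^ j * bin_prod n (- 2 * r - of_nat j) z) $ a)"
          by (simp add: graded_fps_def coef_def[abs_def])
      qed
      moreover have "(\<Sum>j\<le>k. (- 1) ^ (k - j) * of_nat (k choose j) *
          (gen n True z ^ j * bin_prod n (- 2 * r - of_nat j) z) $ a) =
          ((gen n True z - gen n False z) ^ k * bin_prod n (- 2 * r - of_nat k) z) $ a" for z
      proof -
        have "(gen n True z - gen n False z) ^ k * bin_prod n (- 2 * r - of_nat k) z =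
            (\<Sum>j\<le>k. of_nat (k choose j) * gen n True z ^ j * (- gen n False z) ^ (k - j)) * bin_prod n (- 2 * r - of_nat k) z"
          using binomial_ring[of "gen n True z" "- gen n False z" k] by simp
        also have "\<dots> = (\<Sum>j\<le>k. fps_const ((- 1) ^ (k - j) * of_nat (k choose j)) *
            (gen n True z ^ j * bin_prod n (- 2 * r - of_nat j) z))"
          unfolding sum_distrib_right
        proof (rule sum.cong[OF refl])
          fix j assume "j \<in> {..k}"
          then have j: "- 2 * r - of_nat j = (- 2 * r - of_nat k) + of_nat (k - j)" by (simp add: of_nat_diff)
          have "(- gen n False z) ^ (k - j) = fps_const ((- 1) ^ (k - j)) * gen n False z ^ (k - j)"
            by (subst power_minus) (simp flip: fps_const_power fps_const_neg)
          moreover have "of_nat (k choose j) = (fps_const (of_nat (k choose j)) :: 'a fps)"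
            by (simp add: fps_of_nat)
          ultimately show "of_nat (k choose j) * gen n True z ^ j * (- gen n False z) ^ (k - j) * bin_prod n (- 2 * r - of_nat k) z =
              fps_const ((- 1) ^ (k - j) * of_nat (k choose j)) * (gen n True z ^ j * bin_prod n (- 2 * r - of_nat j) z)"
            unfolding j bin_prod_add fps_const_mult[symmetric] by (simp only: ac_simps)
        qed
        finally show ?thesis by (simp add: fps_sum_nth)
      qed
      ultimately show "graded n a f g" by (simp add: g_def[abs_def])
    qed
    show "f (z \<circ> \<pi>) = f z" if "\<pi> \<in> W n" for \<pi> z
      using that by (simp add: f_def coef_def psi_invariant)
    fix \<mu> assume \<mu>: "\<mu> \<in> Lambda n" "odd_size n \<mu> \<le> odd_size n (two_row a b)" "\<mu> \<noteq> two_row a b"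
    let ?z = "\<lambda>i. rho n r i + of_nat (\<mu> i)"
    show "f ?z = 0"
    proof (cases "\<mu> 1 < a")
      case True
      have "coef j ?z = 0" for j
      proof -
        obtain C where C: "fps_deg_le (\<mu> 1) C"
          "inverse (psi n r j (rho n r)) * psi n r j ?z * rising ?y (\<mu> 1) = C"
          using psi_ratio[OF \<mu>(1) n] by blast
        have "rising ?y (a - 1) = rising ?y (\<mu> 1) * rising (?y + of_nat (\<mu> 1)) (a - 1 - \<mu> 1)"
          using True by (simp flip: rising_add)
        then have "rising ?y (a - 1) * inverse (psi n r j (rho n r)) * psi n r j ?z =
            (inverse (psi n r j (rho n r)) * psi n r j ?z * rising ?y (\<mu> 1)) * rising (?y + of_nat (\<mu> 1)) (a - 1 - \<mu> 1)"
          by (simp only: ac_simps)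
        moreover have "fps_deg_le (\<mu> 1 + (a - 1 - \<mu> 1)) (C * rising (?y + of_nat (\<mu> 1)) (a - 1 - \<mu> 1))"
          by (intro fps_deg_le_mult C fps_deg_le_rising)
        ultimately show ?thesis using True unfolding coef_def C(2) by (simp add: fps_deg_le_def)
      qed
      then show ?thesis by (simp add: f_def)
    next
      case False
      define d where "d = \<mu> 2"
      have \<mu>_eq: "\<mu> = two_row a d" and d: "d \<le> a" "n \<ge> 2 \<or> d = 0"
        using Lambda_two_row[OF \<mu>(1) _ _ n, of a] \<mu>(2) False by (auto simp: odd_size_two_row[OF n] d_def)
      have "d \<noteq> b" using \<mu>(3) \<mu>_eq by auto
      \<comment> \<open>Two different numbers are at most \<open>a\<close>, so \<open>a - 1\<close>
        is a genuine predecessor.\<close>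
      then have a0: "a > 0" and dk: "a - d \<noteq> k" using d(1) ba by (auto simp: k_def)
      \<comment> \<open>The contribution of the second row to the residue; it is free of
        \<open>j\<close>, so the finite difference acts only on the binomial coefficient.\<close>
      define K where "K = (\<Prod>l<d. (?y - 2 * r) + of_nat l - (?y + of_nat (a - 1)))"
      have "coef j ?z = fact (a - d) * K * of_nat (j choose (a - d))" for j
      proof -
        let ?X = "inverse (psi n r j (rho n r)) * psi n r j ?z" and ?w = "?y + of_nat (a - 1)"
        have w: "lin ?w * inverse (lin ?w) = 1" by (rule inverse_mult_eq_1') simp
        have "rising ?y a = rising ?y (a - 1) * lin ?w"
          using rising_Suc[of ?y "a - 1"] a0 by simp
        then have "rising ?y (a - 1) * ?X * lin ?w =
            rising (?y + of_nat j + of_nat d) (a - d) * rising (?y - 2 * r) d"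
          using psi_ratio_two_row[OF d(2) n d(1), of r j] by (simp add: \<mu>_eq ac_simps)
        then have "rising ?y (a - 1) * ?X * (lin ?w * inverse (lin ?w)) =
            rising (?y + of_nat j + of_nat d) (a - d) * rising (?y - 2 * r) d * inverse (lin ?w)"
          by (simp only: mult.assoc[symmetric])
        then have "coef j ?z = (rising (?y + of_nat j + of_nat d) (a - d) * rising (?y - 2 * r) d * inverse (lin ?w)) $ ((a - d) + d)"
          unfolding w using d(1) by (simp add: coef_def mult.assoc)
        also have "\<dots> = (\<Prod>l<a - d. (?y + of_nat j + of_nat d) + of_nat l - ?w) * K"
          unfolding rising_residue K_def ..
        also have "(\<Prod>l<a - d. (?y + of_nat j + of_nat d) + of_nat l - ?w) =
            (\<Prod>l<a - d. of_nat j + of_nat l + 1 - of_nat (a - d))"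
          by (rule prod.cong) (use d(1) a0 in \<open>auto simp: of_nat_diff algebra_simps\<close>)
        finally show ?thesis unfolding prod_falling by (simp only: ac_simps)
      qed
      then have "f ?z = inverse c * (\<Sum>j\<le>k. fact (a - d) * K * ((- 1) ^ (k - j) * of_nat (k choose j) * of_nat (j choose (a - d))))"
        unfolding f_def by (simp add: ac_simps)
      then show ?thesis
        unfolding sum_distrib_left[symmetric] alternating_choose_sum[OF dk] by simp
    qed
  next
    show "mdeg (bracket_monom n (two_row a b)) = odd_size n (two_row a b)"
      unfolding m m_def mdeg_add odd_size_two_row[OF n] by (simp add: a)
    have "Poly_Mapping.keys m \<subseteq> Poly_Mapping.keys (Poly_Mapping.single 1 k :: monom) \<union> Poly_Mapping.keys (Poly_Mapping.single 2 b :: monom)"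
      unfolding m_def by (rule Poly_Mapping.keys_add)
    also have "\<dots> \<subseteq> {1, 2} \<inter> {1..n}" using n nb by auto
    finally show "Poly_Mapping.keys (bracket_monom n (two_row a b)) \<subseteq> {1, 2} \<inter> {1..n}" unfolding m .
    have "Poly_Mapping.lookup q m = (\<Sum>i\<le>k. if i = k then 1 else 0)"
      unfolding q_def lookup_sum
    proof (rule sum.cong[OF refl])
      fix i assume "i \<in> {..k}"
      have "Poly_Mapping.single 1 i + Poly_Mapping.single 2 (k - i + b) = m \<longleftrightarrow> i = k"
      proof
        assume "Poly_Mapping.single 1 i + Poly_Mapping.single 2 (k - i + b) = m"
        from arg_cong[OF this, of "\<lambda>m. Poly_Mapping.lookup m 1"]
        show "i = k" by (simp add: m_def lookup_add lookup_single)
      qed (simp add: m_def)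
      then show "Poly_Mapping.lookup (Poly_Mapping.single (Poly_Mapping.single 1 i + Poly_Mapping.single 2 (k - i + b))
          (of_nat (k choose i) * (- 1) ^ (k - i))) m = (if i = k then 1 else 0 :: 'a)"
        by (simp add: lookup_single when_def)
    qed
    then show "Poly_Mapping.lookup q (bracket_monom n (two_row a b)) = 1" by (simp add: m)
    show "g z = eval_poly z q" if z: "\<And>i. i \<notin> {1, 2} \<inter> {1..n} \<Longrightarrow> z i = 0" for z :: "nat \<Rightarrow> 'a"
    proof -
      \<comment> \<open>At most one factor of each parity is nontrivial. For n = 1 the even product
        is empty, but then z_2 = 0 and \<open>F 0 = 1\<close>.\<close>
      have one: "(\<Prod>i\<in>{i \<in> {1..n}. odd i = s}. F (z i)) = F (z (if s then 1 else 2))"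
        if F: "F 0 = 1" for F :: "'a \<Rightarrow> 'a fps" and s
      proof (cases "(if s then 1 else 2) \<le> n")
        case True
        have "(\<Prod>i\<in>{i \<in> {1..n}. odd i = s}. F (z i)) = (\<Prod>i\<in>{if s then 1 else 2}. F (z i))"
        proof (rule prod.mono_neutral_right)
          show "\<forall>i\<in>{i \<in> {1..n}. odd i = s} - {if s then 1 else 2}. F (z i) = 1"
          proof
            fix i assume "i \<in> {i \<in> {1..n}. odd i = s} - {if s then 1 else 2}"
            then have "i \<notin> {1, 2} \<inter> {1..n}" by auto
            then show "F (z i) = 1" using z[of i] F by simp
          qed
        qed (use True in auto)
        then show ?thesis by simp
      next
        case False
        then have "\<not> s" "n = 1" using n by (auto split: if_splits)
        then have "(\<Prod>i\<in>{i \<in> {1..n}. odd i = s}. F (z i)) = (\<Prod>i\<in>{}. F (z i))"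
          by (intro prod.cong) auto
        then show ?thesis using F z[of 2] \<open>n = 1\<close> \<open>\<not> s\<close> by simp
      qed
      have bin0: "bin_fps c 0 = 1" for c :: 'a
        by (rule fps_ext) (simp add: bin_fps_def power_0_left)
      have "gen n True z - gen n False z = lin (z 1) - lin (z 2)"
        unfolding gen_def by (subst (1 2) one) simp_all
      also have "\<dots> = fps_const (z 1 - z 2) * fps_X"
        by (simp add: lin_def algebra_simps flip: fps_const_sub)
      finally have "g z = inverse c * ((z 1 - z 2) ^ k * bin_fps (- 2 * r - of_nat k) (z 2) $ b)"
        unfolding g_def bin_prod_def one[of "bin_fps (- 2 * r - of_nat k)" False, OF bin0] a
        by (simp add: power_mult_distrib mult.assoc fps_X_power_mult_nth fps_const_power)
      also have "\<dots> = (z 1 - z 2) ^ k * z 2 ^ b"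
      proof -
        have "bin_fps (- 2 * r - of_nat k) (z 2) $ b = c * z 2 ^ b" by (simp add: bin_fps_def c_def)
        then show ?thesis using c by simp
      qed
      also have "\<dots> = eval_poly z q"
      proof -
        have "(z 1 - z 2) ^ k = (\<Sum>i\<le>k. of_nat (k choose i) * z 1 ^ i * (- z 2) ^ (k - i))"
          using binomial_ring[of "z 1" "- z 2" k] by simp
        then show ?thesis
          unfolding q_def eval_poly_sum power_minus[of "z 2"]
          by (simp only: sum_distrib_left sum_distrib_right eval_poly_single eval_monom_add eval_monom_single power_add ac_simps)
      qed
      finally show ?thesis .
    qed
  qed
  then show ?thesis by (simp add: g_def c_def k_def)
qed

section \<open>Expansion in the generators\<close>

text \<open>The quotient of two solutions has derivative zero, hence is constant in characteristic
  zero, and its constant term is 1.\<close>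

lemma fps_linear_ode_unique:
  fixes F G :: "'a::field_char_0 fps"
  assumes F: "E * fps_deriv F = D * F" and G: "E * fps_deriv G = D * G"
    and 0: "F $ 0 = 1" "G $ 0 = 1" "E $ 0 = 1"
  shows "F = G"
proof -
  define Q where "Q = F * inverse G"
  have "G * inverse G = 1" by (rule inverse_mult_eq_1') (use 0 in simp)
  then have FQ: "F = Q * G" by (simp add: Q_def mult.assoc mult.commute[of "inverse G"])
  have "E * fps_deriv Q * G + Q * (E * fps_deriv G) = D * F"
    using F unfolding FQ by (simp add: algebra_simps)
  then have "E * fps_deriv Q * G = 0" unfolding G FQ by (simp add: ac_simps)
  moreover have "E \<noteq> 0" "G \<noteq> 0" using 0 by auto
  ultimately have "fps_deriv Q = 0" by simp
  then have "Q = fps_const (Q $ 0)" by (simp add: fps_deriv_eq_0_iff)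
  moreover have "Q $ 0 = 1" using 0 by (simp add: Q_def)
  ultimately show ?thesis using FQ by simp
qed

lemma fps_binomial_compose_ode:
  fixes g :: "'a::field_char_0 fps"
  assumes "g $ 0 = 0"
  shows "(1 + g) * fps_deriv (fps_binomial c oo g) = fps_const c * fps_deriv g * (fps_binomial c oo g)"
proof -
  have "(1 + fps_X) * fps_deriv (fps_binomial c) = fps_const c * fps_binomial c"
  proof -
    have "fps_deriv (fps_binomial c) * (1 + fps_X) = fps_const c * fps_binomial c"
      unfolding fps_binomial_deriv by (rule dvd_div_mult_self, rule unit_imp_dvd) (simp add: fps_is_unit_iff)
    then show ?thesis by (simp add: mult.commute)
  qed
  then have "((1 + fps_X) * fps_deriv (fps_binomial c)) oo g = (fps_const c * fps_binomial c) oo g"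
    by simp
  then have "(1 + g) * (fps_deriv (fps_binomial c) oo g) = fps_const c * (fps_binomial c oo g)"
    by (simp add: fps_compose_mult_distrib[OF assms] fps_compose_add_distrib assms)
  then have "(1 + g) * (fps_deriv (fps_binomial c) oo g) * fps_deriv g = fps_const c * (fps_binomial c oo g) * fps_deriv g"
    by simp
  then show ?thesis by (simp add: fps_compose_deriv[OF assms] ac_simps)
qed

text \<open>This is (1 + g)^c (1 + h)^c = ((1 + g)(1 + h))^c for arbitrary \<open>c\<close>; both
  sides solve the same linear differential equation.\<close>

lemma fps_binomial_compose_mult:
  fixes g h :: "'a::field_char_0 fps"
  assumes g: "g $ 0 = 0" and h: "h $ 0 = 0"
  shows "(fps_binomial c oo g) * (fps_binomial c oo h) = fps_binomial c oo (g + h + g * h)"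
proof (rule fps_linear_ode_unique)
  let ?G = "fps_binomial c oo g" and ?H = "fps_binomial c oo h"
  let ?s = "g + h + g * h"
  have s: "1 + ?s = (1 + g) * (1 + h)" by (simp add: algebra_simps)
  have s': "fps_deriv ?s = fps_deriv g * (1 + h) + fps_deriv h * (1 + g)" by (simp add: algebra_simps)
  show "(1 + ?s) * fps_deriv (fps_binomial c oo ?s) = fps_const c * fps_deriv ?s * (fps_binomial c oo ?s)"
    by (rule fps_binomial_compose_ode) (simp add: g h)
  have "(1 + ?s) * fps_deriv (?G * ?H) =
      ((1 + g) * fps_deriv ?G) * ((1 + h) * ?H) + ((1 + h) * fps_deriv ?H) * ((1 + g) * ?G)"
    unfolding s by (simp add: algebra_simps)
  also have "\<dots> = fps_const c * fps_deriv ?s * (?G * ?H)"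
    unfolding fps_binomial_compose_ode[OF g] fps_binomial_compose_ode[OF h] s' by (simp only: algebra_simps)
  finally show "(1 + ?s) * fps_deriv (?G * ?H) = fps_const c * fps_deriv ?s * (?G * ?H)" .
qed (simp_all add: g h)

lemma bin_fps_eq_compose: "bin_fps c x = fps_binomial c oo (lin x - 1)"
proof -
  have "lin x - 1 = fps_const x * fps_X" by (simp add: lin_def)
  then show ?thesis
    unfolding bin_fps_def by (simp only: fps_compose_linear fps_binomial_nth mult.commute[of "_ gchoose _"])
qed

text \<open>Merging the factors into one binomial series in E_even - 1 is what allows an expansion
  in the generators of even index.\<close>

lemma bin_prod_eq_compose: "bin_prod n c z = fps_binomial c oo (gen n False z - 1)"
proof -
  have "(\<Prod>i\<in>I. bin_fps c (z i)) = fps_binomial c oo ((\<Prod>i\<in>I. lin (z i)) - 1)" if "finite I" for I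
    using that
  proof (induction I rule: finite_induct)
    case empty
    then show ?case by simp
  next
    case (insert i I)
    have "(\<Prod>i\<in>insert i I. bin_fps c (z i)) = (fps_binomial c oo (lin (z i) - 1)) * (fps_binomial c oo ((\<Prod>i\<in>I. lin (z i)) - 1))"
      using insert by (simp add: bin_fps_eq_compose)
    also have "\<dots> = fps_binomial c oo ((lin (z i) - 1) + ((\<Prod>i\<in>I. lin (z i)) - 1) + (lin (z i) - 1) * ((\<Prod>i\<in>I. lin (z i)) - 1))"
      by (rule fps_binomial_compose_mult) simp_all
    also have "(lin (z i) - 1) + ((\<Prod>i\<in>I. lin (z i)) - 1) + (lin (z i) - 1) * ((\<Prod>i\<in>I. lin (z i)) - 1) =
        (\<Prod>i\<in>insert i I. lin (z i)) - 1"
      using insert by (simp add: algebra_simps)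
    finally show ?case .
  qed
  then show ?thesis unfolding bin_prod_def gen_def by simp
qed

section \<open>The multinomial theorem for divided powers\<close>

definition divided_power :: "nat \<Rightarrow> 'a::field_char_0 fps \<Rightarrow> 'a fps" where
  "divided_power k x = fps_const (1 / fact k) * x ^ k"

lemma divided_power_add:
  "divided_power k (x + y) = (\<Sum>j\<le>k. divided_power j x * divided_power (k - j) y)"
proof -
  have "divided_power k (x + y) = (\<Sum>j\<le>k. fps_const (1 / fact k) * (of_nat (k choose j) * x ^ j * y ^ (k - j)))"
    by (simp add: divided_power_def binomial_ring sum_distrib_left)
  also have "\<dots> = (\<Sum>j\<le>k. divided_power j x * divided_power (k - j) y)"
  proof (rule sum.cong[OF refl])
    fix j assume "j \<in> {..k}"
    then have "(1 / fact k) * of_nat (k choose j) = (1 / fact j) * (1 / fact (k - j) :: 'a)"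
      using binomial_fact[of j k, where 'a = 'a] by simp
    then have "fps_const (1 / fact k) * of_nat (k choose j) = fps_const (1 / fact j) * fps_const (1 / fact (k - j) :: 'a)"
      by (metis fps_const_mult fps_of_nat)
    then show "fps_const (1 / fact k) * (of_nat (k choose j) * x ^ j * y ^ (k - j)) = divided_power j x * divided_power (k - j) y"
      unfolding divided_power_def by (metis (no_types, lifting) mult.assoc mult.left_commute)
  qed
  finally show ?thesis .
qed

definition compositions :: "nat set \<Rightarrow> nat \<Rightarrow> (nat \<Rightarrow> nat) set" where
  "compositions I k = {\<kappa>. (\<forall>i. i \<notin> I \<longrightarrow> \<kappa> i = 0) \<and> sum \<kappa> I = k}"

lemma finite_compositions: "finite I \<Longrightarrow> finite (compositions I k)"
proof -
  assume I: "finite I"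
  have "compositions I k \<subseteq> {\<kappa>. \<forall>i. (i \<in> I \<longrightarrow> \<kappa> i \<in> {..k}) \<and> (i \<notin> I \<longrightarrow> \<kappa> i = 0)}"
    using member_le_sum[OF _ _ I] by (auto simp: compositions_def)
  then show ?thesis
    by (rule finite_subset) (use I in \<open>intro finite_set_of_finite_funs, auto\<close>)
qed

text \<open>Division by factorials removes the multinomial coefficients, so adjoining an index to
  \<open>I\<close> is a plain convolution.\<close>

lemma divided_power_sum:
  assumes "finite I"
  shows "divided_power k (sum f I) = (\<Sum>\<kappa>\<in>compositions I k. \<Prod>i\<in>I. divided_power (\<kappa> i) (f i))"
  using assms
proof (induction I arbitrary: k rule: finite_induct)
  case empty
  have "compositions {} k = (if k = 0 then {\<lambda>_. 0} else {})" by (auto simp: compositions_def)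
  then show ?case by (simp add: divided_power_def)
next
  case (insert i I)
  have "divided_power k (sum f (insert i I)) =
      (\<Sum>j\<le>k. \<Sum>\<kappa>\<in>compositions I (k - j). divided_power j (f i) * (\<Prod>i\<in>I. divided_power (\<kappa> i) (f i)))"
    using insert by (simp add: divided_power_add sum_distrib_left)
  also have "\<dots> = (\<Sum>(j, \<kappa>)\<in>(SIGMA j:{..k}. compositions I (k - j)). divided_power j (f i) * (\<Prod>i\<in>I. divided_power (\<kappa> i) (f i)))"
    by (rule sum.Sigma) (use insert.hyps in \<open>auto intro: finite_compositions\<close>)
  also have "\<dots> = (\<Sum>\<kappa>\<in>compositions (insert i I) k. \<Prod>i\<in>insert i I. divided_power (\<kappa> i) (f i))"
  proof (rule sum.reindex_bij_witness[of _ "\<lambda>\<kappa>. (\<kappa> i, \<kappa>(i := 0))" "\<lambda>(j, \<kappa>). \<kappa>(i := j)"])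
    have upd: "(\<Sum>l\<in>I. if l = i then j else \<kappa> l) = sum \<kappa> I" for \<kappa> :: "nat \<Rightarrow> nat" and j
      by (rule sum.cong) (use insert.hyps in auto)
    show "(\<lambda>(j, \<kappa>). \<kappa>(i := j)) x \<in> compositions (insert i I) k"
      if "x \<in> (SIGMA j:{..k}. compositions I (k - j))" for x
      using that insert.hyps by (auto simp: compositions_def upd)
    show "(\<kappa> i, \<kappa>(i := 0)) \<in> (SIGMA j:{..k}. compositions I (k - j))" if "\<kappa> \<in> compositions (insert i I) k" for \<kappa>
      using that insert.hyps by (auto simp: compositions_def upd)
    show "(\<lambda>\<kappa>. (\<kappa> i, \<kappa>(i := 0))) ((\<lambda>(j, \<kappa>). \<kappa>(i := j)) x) = x"
      if "x \<in> (SIGMA j:{..k}. compositions I (k - j))" for x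
      using that insert.hyps by (auto simp: compositions_def fun_eq_iff)
    show "(\<Prod>l\<in>insert i I. divided_power (((\<lambda>(j, \<kappa>). \<kappa>(i := j)) x) l) (f l)) =
        (case x of (j, \<kappa>) \<Rightarrow> divided_power j (f i) * (\<Prod>i\<in>I. divided_power (\<kappa> i) (f i)))"
      if "x \<in> (SIGMA j:{..k}. compositions I (k - j))" for x
      using insert.hyps by (auto split: prod.splits intro!: prod.cong)
  qed auto
  finally show ?case .
qed

lemma divided_power_sum_mult:
  fixes I J :: "nat set"
  assumes "finite I" "finite J" "I \<inter> J = {}"
  shows "divided_power k (sum f I) * divided_power l (sum f J) =
    (\<Sum>\<kappa>\<in>{\<kappa>. (\<forall>i. i \<notin> I \<union> J \<longrightarrow> \<kappa> i = 0) \<and> sum \<kappa> I = k \<and> sum \<kappa> J = l}. \<Prod>i\<in>I \<union> J. divided_power (\<kappa> i) (f i))"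
proof -
  have "divided_power k (sum f I) * divided_power l (sum f J) =
      (\<Sum>(\<kappa>, \<kappa>')\<in>compositions I k \<times> compositions J l.
        (\<Prod>i\<in>I. divided_power (\<kappa> i) (f i)) * (\<Prod>i\<in>J. divided_power (\<kappa>' i) (f i)))"
    by (simp add: divided_power_sum assms sum_product sum.cartesian_product)
  also have "\<dots> = (\<Sum>\<kappa>\<in>{\<kappa>. (\<forall>i. i \<notin> I \<union> J \<longrightarrow> \<kappa> i = 0) \<and> sum \<kappa> I = k \<and> sum \<kappa> J = l}. \<Prod>i\<in>I \<union> J. divided_power (\<kappa> i) (f i))"
  proof (rule sum.reindex_bij_witness[of _ "\<lambda>\<kappa>. (\<lambda>i. if i \<in> I then \<kappa> i else 0, \<lambda>i. if i \<in> J then \<kappa> i else 0)"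
        "\<lambda>(\<kappa>, \<kappa>') i. if i \<in> I then \<kappa> i else \<kappa>' i"])
    have J: "i \<notin> I" if "i \<in> J" for i using that assms(3) by auto
    have sumJ: "(\<Sum>i\<in>J. if i \<in> I then \<kappa> i else \<kappa>' i) = sum \<kappa>' J" for \<kappa> \<kappa>' :: "nat \<Rightarrow> nat"
      by (rule sum.cong) (use J in auto)
    show "(\<lambda>(\<kappa>, \<kappa>') i. if i \<in> I then \<kappa> i else \<kappa>' i) x \<in> {\<kappa>. (\<forall>i. i \<notin> I \<union> J \<longrightarrow> \<kappa> i = 0) \<and> sum \<kappa> I = k \<and> sum \<kappa> J = l}"
      if "x \<in> compositions I k \<times> compositions J l" for x
      using that by (auto simp: compositions_def sumJ)
    show "(\<lambda>\<kappa>. (\<lambda>i. if i \<in> I then \<kappa> i else 0, \<lambda>i. if i \<in> J then \<kappa> i else 0)) ((\<lambda>(\<kappa>, \<kappa>') i. if i \<in> I then \<kappa> i else \<kappa>' i) x) = x"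
      if "x \<in> compositions I k \<times> compositions J l" for x
      using that J by (auto simp: compositions_def fun_eq_iff)
    show "(\<Prod>i\<in>I \<union> J. divided_power (((\<lambda>(\<kappa>, \<kappa>') i. if i \<in> I then \<kappa> i else \<kappa>' i) x) i) (f i)) =
        (case x of (\<kappa>, \<kappa>') \<Rightarrow> (\<Prod>i\<in>I. divided_power (\<kappa> i) (f i)) * (\<Prod>i\<in>J. divided_power (\<kappa>' i) (f i)))"
      if "x \<in> compositions I k \<times> compositions J l" for x
    proof -
      obtain \<kappa> \<kappa>' where x: "x = (\<kappa>, \<kappa>')" by fastforce
      have "(\<Prod>i\<in>J. divided_power (if i \<in> I then \<kappa> i else \<kappa>' i) (f i)) = (\<Prod>i\<in>J. divided_power (\<kappa>' i) (f i))"
        by (rule prod.cong) (use J in auto)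
      then show ?thesis by (simp add: x prod.union_disjoint assms)
    qed
  qed (auto simp: compositions_def fun_eq_iff)
  finally show ?thesis .
qed

text \<open>A falling factorial of length k + l is cut after k factors; this separates odd from even
  columns below.\<close>

lemma falling_mult: "(x gchoose k) * ((x - of_nat k) gchoose l) * (fact k * fact l) =
    ((x :: 'a::field_char_0) gchoose (k + l)) * fact (k + l)"
proof -
  have fall: "(y gchoose m) * fact m = (\<Prod>i<m. y - of_nat i)" for y :: 'a and m
    by (simp add: gbinomial_prod_rev atLeast0LessThan)
  have "(\<Prod>i<k + l. x - of_nat i) = (\<Prod>i<k. x - of_nat i) * (\<Prod>i<l. (x - of_nat k) - of_nat i)"
    by (induction l) (simp_all add: algebra_simps)
  then show ?thesis unfolding fall[symmetric] by (simp only: ac_simps)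
qed

section \<open>Partitions encoded by their columns\<close>

lemma card_even: "card {i. i \<in> {1..m} \<and> even i} = m div 2"
proof (induction m)
  case (Suc m)
  have "{i. i \<in> {1..Suc m} \<and> even i} = (if even (Suc m) then insert (Suc m) else id) {i. i \<in> {1..m} \<and> even i}"
    by (auto simp: le_Suc_eq)
  with Suc show ?case by auto
qed simp

text \<open>A partition is encoded by the multiplicities \<open>\<kappa> i = \<mu> i - \<mu> (i + 1)\<close> of its columns.\<close>

definition columns_of :: "nat \<Rightarrow> (nat \<Rightarrow> nat) \<Rightarrow> nat \<Rightarrow> nat" where
  "columns_of n \<mu> = (\<lambda>i. if i \<in> {1..n} then \<mu> i - \<mu> (i + 1) else 0)"

definition of_columns :: "nat \<Rightarrow> (nat \<Rightarrow> nat) \<Rightarrow> nat \<Rightarrow> nat" where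
  "of_columns n \<kappa> = (\<lambda>m. if m \<in> {1..n} then \<Sum>i=m..n. \<kappa> i else 0)"

lemma of_columns_Lambda: "of_columns n \<kappa> \<in> Lambda n"
  by (auto simp: Lambda_def of_columns_def intro!: sum_mono2)

lemma columns_of_of_columns:
  assumes "\<And>i. i \<notin> {1..n} \<Longrightarrow> \<kappa> i = 0"
  shows "columns_of n (of_columns n \<kappa>) = \<kappa>"
proof
  fix i show "columns_of n (of_columns n \<kappa>) i = \<kappa> i"
  proof (cases "i \<in> {1..n}")
    case True
    then have "(\<Sum>j=i..n. \<kappa> j) = \<kappa> i + (\<Sum>j=Suc i..n. \<kappa> j)"
      by (intro sum.atLeast_Suc_atMost) simp
    with True show ?thesis by (simp add: columns_of_def of_columns_def)
  qed (use assms in \<open>auto simp: columns_of_def\<close>)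
qed

lemma of_columns_columns_of:
  assumes "\<mu> \<in> Lambda n"
  shows "of_columns n (columns_of n \<mu>) = \<mu>"
proof
  fix m show "of_columns n (columns_of n \<mu>) m = \<mu> m"
  proof (cases "m \<in> {1..n}")
    case True
    have "(\<Sum>i=m..n. columns_of n \<mu> i) = (\<Sum>i=m..n. \<mu> i - \<mu> (Suc i))"
      by (rule sum.cong) (use True in \<open>auto simp: columns_of_def\<close>)
    also have "\<dots> + \<mu> (Suc n) = \<mu> m"
    proof -
      have "m \<le> n" using True by simp
      then show ?thesis
      proof (induction n rule: dec_induct)
        case base
        have "\<mu> (Suc m) \<le> \<mu> m" by (rule Lambda_antimono[OF assms]) (use True in auto)
        then show ?case by simp
      next
        case (step j)
        have "\<mu> (Suc (Suc j)) \<le> \<mu> (Suc j)" by (rule Lambda_antimono[OF assms]) auto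
        with step show ?case by simp
      qed
    qed
    finally show ?thesis using True assms by (simp add: of_columns_def Lambda_def)
  next
    case False
    then show ?thesis using assms by (auto simp: of_columns_def Lambda_def)
  qed
qed

text \<open>A column of length i meets the rows 1 to i, so exchanging the sums counts the selected
  rows in each column.\<close>

lemma sum_of_columns:
  "(\<Sum>m\<in>{m \<in> {1..n}. P m}. of_columns n \<kappa> m) = (\<Sum>i=1..n. \<kappa> i * card {m. m \<in> {1..i} \<and> P m})"
proof -
  have "(\<Sum>m\<in>{m \<in> {1..n}. P m}. of_columns n \<kappa> m) = (\<Sum>m\<in>{m \<in> {1..n}. P m}. \<Sum>i\<in>{i \<in> {1..n}. m \<le> i}. \<kappa> i)"
    by (rule sum.cong[OF refl]) (auto simp: of_columns_def intro!: sum.cong)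
  also have "\<dots> = (\<Sum>i\<in>{1..n}. \<Sum>m\<in>{m \<in> {m \<in> {1..n}. P m}. m \<le> i}. \<kappa> i)"
    by (rule sum.swap_restrict) auto
  also have "\<dots> = (\<Sum>i=1..n. \<kappa> i * card {m. m \<in> {1..i} \<and> P m})"
  proof (rule sum.cong[OF refl])
    fix i assume "i \<in> {1..n}"
    then have "{m \<in> {m \<in> {1..n}. P m}. m \<le> i} = {m. m \<in> {1..i} \<and> P m}" by auto
    then show "(\<Sum>m\<in>{m \<in> {m \<in> {1..n}. P m}. m \<le> i}. \<kappa> i) = \<kappa> i * card {m. m \<in> {1..i} \<and> P m}" by simp
  qed
  finally show ?thesis .
qed

lemma odd_size_of_columns: "odd_size n (of_columns n \<kappa>) = (\<Sum>i=1..n. \<kappa> i * ((i + 1) div 2))"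
  unfolding odd_size_def sum_of_columns card_odd ..

lemma even_size_of_columns: "even_size n (of_columns n \<kappa>) = (\<Sum>i=1..n. \<kappa> i * (i div 2))"
  unfolding even_size_def sum_of_columns card_even ..

text \<open>A column of odd length has one odd row more than even rows, and one of even length has
  equally many.\<close>

lemma odd_even_size_of_columns:
  "odd_size n (of_columns n \<kappa>) = even_size n (of_columns n \<kappa>) + (\<Sum>i\<in>{i \<in> {1..n}. odd i}. \<kappa> i)"
proof -
  have "(\<Sum>i\<in>{i \<in> {1..n}. odd i}. \<kappa> i) = (\<Sum>i=1..n. if odd i then \<kappa> i else 0)"
    by (rule sum.inter_filter) simp
  then show ?thesis
    unfolding odd_size_of_columns even_size_of_columns
    by (simp add: sum.distrib[symmetric]) (rule sum.cong, auto elim!: oddE evenE)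
qed

text \<open>For column multiplicities the two size conditions prescribe the number a - b of odd
  columns and the total weight a. With the number \<open>l\<close> of even columns fixed, the
  multinomial theorem yields a product of powers of the odd and even parts; summing over
  \<open>l\<close> produces the binomial series.\<close>

lemma sum_partitions_eq_coeff:
  fixes x :: "'a::field_char_0"
  assumes "1 \<le> n" "b \<le> a"
  shows "(\<Sum>\<mu>\<in>{\<mu> \<in> Lambda n. odd_size n \<mu> = a \<and> even_size n \<mu> = b}.
      (x gchoose (\<mu> 1)) * diff_multinomial n \<mu> * (\<Prod>m=1..n. y m ^ (\<mu> m - \<mu> (m + 1)))) =
    (x gchoose (a - b)) *
      ((\<Sum>i\<in>{i \<in> {1..n}. odd i}. fps_const (y i) * fps_X ^ ((i + 1) div 2)) ^ (a - b) *
       (fps_binomial (x - of_nat (a - b)) oo (\<Sum>i\<in>{i \<in> {1..n}. even i}. fps_const (y i) * fps_X ^ ((i + 1) div 2)))) $ a"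
proof -
  define k where "k = a - b"
  \<comment> \<open>The number of odd rows in a column of length \<open>i\<close>, and hence the
    power of v that goes with \<open>y i\<close>.\<close>
  define w :: "nat \<Rightarrow> nat" where "w i = (i + 1) div 2" for i
  define f where "f i = fps_const (y i) * fps_X ^ w i" for i
  let ?I = "{i \<in> {1..n}. odd i}" and ?J = "{i \<in> {1..n}. even i}"
  have IJ: "?I \<union> ?J = {1..n}" "?I \<inter> ?J = {}" by auto
  define K where "K = {\<kappa>. (\<forall>i. i \<notin> {1..n} \<longrightarrow> \<kappa> i = 0) \<and> sum \<kappa> ?I = k \<and> (\<Sum>i=1..n. \<kappa> i * w i) = a}"
  define t where "t \<kappa> = (x gchoose (sum \<kappa> {1..n})) * fact (sum \<kappa> {1..n}) * (\<Prod>i=1..n. y i ^ \<kappa> i / fact (\<kappa> i))" for \<kappa> :: "nat \<Rightarrow> nat"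
  have w: "1 \<le> w i" if "i \<in> {1..n}" for i
    using that unfolding w_def by simp presburger
  have le_a: "\<kappa> i \<le> a" if "\<kappa> \<in> K" "i \<in> {1..n}" for \<kappa> i
  proof -
    have "\<kappa> i \<le> \<kappa> i * w i" using w[OF that(2)] by simp
    also have "\<dots> \<le> (\<Sum>i=1..n. \<kappa> i * w i)" using that(2) by (intro member_le_sum) auto
    finally show ?thesis using that(1) by (simp add: K_def)
  qed
  have finK: "finite K"
  proof (rule finite_subset)
    show "K \<subseteq> {\<kappa>. \<forall>i. (i \<in> {1..n} \<longrightarrow> \<kappa> i \<in> {..a}) \<and> (i \<notin> {1..n} \<longrightarrow> \<kappa> i = 0)}"
      using le_a by (auto simp: K_def)
  qed (intro finite_set_of_finite_funs, auto)
  have "(\<Sum>\<mu>\<in>{\<mu> \<in> Lambda n. odd_size n \<mu> = a \<and> even_size n \<mu> = b}.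
      (x gchoose (\<mu> 1)) * diff_multinomial n \<mu> * (\<Prod>m=1..n. y m ^ (\<mu> m - \<mu> (m + 1)))) = sum t K"
  proof (rule sum.reindex_bij_witness[of _ "of_columns n" "columns_of n"])
    fix \<mu> assume \<mu>: "\<mu> \<in> {\<mu> \<in> Lambda n. odd_size n \<mu> = a \<and> even_size n \<mu> = b}"
    define \<kappa> where "\<kappa> = columns_of n \<mu>"
    have \<mu>_eq: "of_columns n \<kappa> = \<mu>" using \<mu> by (simp add: \<kappa>_def of_columns_columns_of)
    show "of_columns n (columns_of n \<mu>) = \<mu>" using \<mu> by (simp add: of_columns_columns_of)
    show "columns_of n \<mu> \<in> K"
      using \<mu> odd_size_of_columns[of n \<kappa>] odd_even_size_of_columns[of n \<kappa>]
      unfolding \<mu>_eq by (auto simp: K_def k_def w_def \<kappa>_def columns_of_def)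
    have "\<mu> 1 = sum \<kappa> {1..n}"
      using assms(1) arg_cong[OF \<mu>_eq, of "\<lambda>f. f 1"] by (simp add: of_columns_def)
    moreover have "(\<Prod>i=1..n. y i ^ \<kappa> i / fact (\<kappa> i)) = (\<Prod>m=1..n. y m ^ (\<mu> m - \<mu> (m + 1))) / (\<Prod>m=1..n. fact (\<mu> m - \<mu> (m + 1)))"
      unfolding prod_dividef[symmetric] by (rule prod.cong) (auto simp: \<kappa>_def columns_of_def)
    ultimately show "t (columns_of n \<mu>) = (x gchoose (\<mu> 1)) * diff_multinomial n \<mu> * (\<Prod>m=1..n. y m ^ (\<mu> m - \<mu> (m + 1)))"
      unfolding t_def diff_multinomial_def \<kappa>_def[symmetric] by simp
  next
    fix \<kappa> assume \<kappa>: "\<kappa> \<in> K"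
    then show "columns_of n (of_columns n \<kappa>) = \<kappa>" by (intro columns_of_of_columns) (simp add: K_def)
    show "of_columns n \<kappa> \<in> {\<mu> \<in> Lambda n. odd_size n \<mu> = a \<and> even_size n \<mu> = b}"
      using \<kappa> odd_even_size_of_columns[of n \<kappa>] assms(2)
      by (auto simp: of_columns_Lambda odd_size_of_columns K_def k_def w_def)
  qed
  \<comment> \<open>\<open>l\<close> counts the even columns; it is at most \<open>a\<close> because
    every column has an odd row.\<close>
  also have "\<dots> = (\<Sum>l\<le>a. sum t {\<kappa> \<in> K. sum \<kappa> ?J = l})"
  proof (rule sum.group[symmetric])
    show "(\<lambda>\<kappa>. sum \<kappa> ?J) ` K \<subseteq> {..a}"
    proof (rule image_subsetI)
      fix \<kappa> assume \<kappa>: "\<kappa> \<in> K"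
      have "sum \<kappa> ?J \<le> sum \<kappa> {1..n}" by (rule sum_mono2) auto
      also have "\<dots> \<le> (\<Sum>i=1..n. \<kappa> i * w i)" by (rule sum_mono) (use w in simp)
      finally show "sum \<kappa> ?J \<in> {..a}" using \<kappa> by (simp add: K_def)
    qed
  qed (use finK in auto)
  also have "\<dots> = (\<Sum>l\<le>a. (x gchoose k) * (((x - of_nat k) gchoose l) * (sum f ?I ^ k * sum f ?J ^ l) $ a))"
  proof (rule sum.cong[OF refl])
    fix l
    define KK where "KK = {\<kappa>. (\<forall>i. i \<notin> {1..n} \<longrightarrow> \<kappa> i = 0) \<and> sum \<kappa> ?I = k \<and> sum \<kappa> ?J = l}"
    have finKK: "finite KK"
    proof (rule finite_subset)
      show "KK \<subseteq> compositions {1..n} (k + l)"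
        using sum.union_disjoint[of ?I ?J] unfolding IJ by (auto simp: KK_def compositions_def)
    qed (simp add: finite_compositions)
    have prod_f: "(\<Prod>i=1..n. divided_power (\<kappa> i) (f i)) = fps_const (\<Prod>i=1..n. y i ^ \<kappa> i / fact (\<kappa> i)) * fps_X ^ (\<Sum>i=1..n. \<kappa> i * w i)" for \<kappa>
    proof -
      have "divided_power (\<kappa> i) (f i) = fps_const (y i ^ \<kappa> i / fact (\<kappa> i)) * fps_X ^ (\<kappa> i * w i)" for i
        by (simp add: divided_power_def f_def power_mult_distrib power_mult[symmetric] mult.commute[of "\<kappa> i"] fps_const_power
            flip: mult.assoc)
      moreover have "(\<Prod>i\<in>A. fps_const (u i) * fps_X ^ v i) = fps_const (prod u A) * fps_X ^ (sum v A)"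
        for A :: "nat set" and u :: "nat \<Rightarrow> 'a" and v
        by (induction A rule: infinite_finite_induct) (simp_all add: power_add ac_simps flip: fps_const_mult)
      ultimately show ?thesis by simp
    qed
    have "sum f ?I ^ k * sum f ?J ^ l = fps_const (fact k * fact l) * (divided_power k (sum f ?I) * divided_power l (sum f ?J))"
    proof -
      have "sum f A ^ m = fps_const (fact m) * divided_power m (sum f A)" for A m
        by (simp add: divided_power_def flip: mult.assoc)
      then show ?thesis by (simp add: ac_simps flip: fps_const_mult)
    qed
    also have "divided_power k (sum f ?I) * divided_power l (sum f ?J) =
        (\<Sum>\<kappa>\<in>KK. fps_const (\<Prod>i=1..n. y i ^ \<kappa> i / fact (\<kappa> i)) * fps_X ^ (\<Sum>i=1..n. \<kappa> i * w i))"
    proof -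
      have "finite ?I" "finite ?J" by simp_all
      then show ?thesis
        unfolding prod_f[symmetric] KK_def by (subst divided_power_sum_mult[OF _ _ IJ(2)]) (simp_all only: IJ(1))
    qed
    finally have prod_eq: "sum f ?I ^ k * sum f ?J ^ l = fps_const (fact k * fact l) *
        (\<Sum>\<kappa>\<in>KK. fps_const (\<Prod>i=1..n. y i ^ \<kappa> i / fact (\<kappa> i)) * fps_X ^ (\<Sum>i=1..n. \<kappa> i * w i))" .
    have "(sum f ?I ^ k * sum f ?J ^ l) $ a = fact k * fact l *
        (\<Sum>\<kappa>\<in>KK. if (\<Sum>i=1..n. \<kappa> i * w i) = a then \<Prod>i=1..n. y i ^ \<kappa> i / fact (\<kappa> i) else 0)"
      unfolding prod_eq fps_mult_left_const_nth fps_sum_nth fps_X_power_nth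
      by (intro arg_cong[of _ _ "(*) (fact k * fact l)"] sum.cong) auto
    also have "\<dots> = fact k * fact l * (\<Sum>\<kappa>\<in>{\<kappa> \<in> K. sum \<kappa> ?J = l}. \<Prod>i=1..n. y i ^ \<kappa> i / fact (\<kappa> i))"
    proof -
      have "{\<kappa> \<in> K. sum \<kappa> ?J = l} = {\<kappa> \<in> KK. (\<Sum>i=1..n. \<kappa> i * w i) = a}" by (auto simp: K_def KK_def)
      then show ?thesis unfolding sum.inter_filter[OF finKK, symmetric] by (simp only:)
    qed
    finally have coeff: "(sum f ?I ^ k * sum f ?J ^ l) $ a =
      fact k * fact l * (\<Sum>\<kappa>\<in>{\<kappa> \<in> K. sum \<kappa> ?J = l}. \<Prod>i=1..n. y i ^ \<kappa> i / fact (\<kappa> i))" .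
    have "sum t {\<kappa> \<in> K. sum \<kappa> ?J = l} = (x gchoose (k + l)) * fact (k + l) *
        (\<Sum>\<kappa>\<in>{\<kappa> \<in> K. sum \<kappa> ?J = l}. \<Prod>i=1..n. y i ^ \<kappa> i / fact (\<kappa> i))"
      unfolding sum_distrib_left
    proof (rule sum.cong[OF refl])
      fix \<kappa> assume "\<kappa> \<in> {\<kappa> \<in> K. sum \<kappa> ?J = l}"
      then have "sum \<kappa> {1..n} = k + l"
        using sum.union_disjoint[of ?I ?J \<kappa>] unfolding IJ by (simp add: K_def)
      then show "t \<kappa> = (x gchoose (k + l)) * fact (k + l) * (\<Prod>i=1..n. y i ^ \<kappa> i / fact (\<kappa> i))"
        by (simp add: t_def)
    qed
    then show "sum t {\<kappa> \<in> K. sum \<kappa> ?J = l} =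
        (x gchoose k) * (((x - of_nat k) gchoose l) * (sum f ?I ^ k * sum f ?J ^ l) $ a)"
      unfolding coeff falling_mult[symmetric] by (simp only: ac_simps)
  qed
  also have "\<dots> = (x gchoose k) * (sum f ?I ^ k * (fps_binomial (x - of_nat k) oo sum f ?J)) $ a"
  proof -
    \<comment> \<open>Without a constant term, powers of the even part beyond the a-th cannot reach
      v^a, so the sum over \<open>l\<close> may stop at \<open>a\<close>.\<close>
    have J0: "sum f ?J $ 0 = 0" by (auto simp: fps_sum_nth f_def w_def intro!: sum.neutral)
    have "(fps_binomial (x - of_nat k) oo sum f ?J) $ m = (\<Sum>l\<le>a. ((x - of_nat k) gchoose l) * (sum f ?J ^ l) $ m)"
      if "m \<le> a" for m
      unfolding fps_compose_nth fps_binomial_nth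
      by (rule sum.mono_neutral_left) (use that startsby_zero_power_prefix[OF J0] in auto)
    then have "(sum f ?I ^ k * (fps_binomial (x - of_nat k) oo sum f ?J)) $ a =
        (\<Sum>i=0..a. \<Sum>l\<le>a. (sum f ?I ^ k) $ i * (((x - of_nat k) gchoose l) * (sum f ?J ^ l) $ (a - i)))"
      unfolding fps_mult_nth by (simp add: sum_distrib_left)
    also have "\<dots> = (\<Sum>l\<le>a. ((x - of_nat k) gchoose l) * (sum f ?I ^ k * sum f ?J ^ l) $ a)"
      unfolding fps_mult_nth sum_distrib_left by (subst sum.swap) (simp add: mult.left_commute)
    finally show ?thesis by (simp add: sum_distrib_left)
  qed
  finally show ?thesis by (simp add: f_def w_def k_def)
qed

section \<open>The generators as coefficients of E_odd - E_even and E_even, and the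
  conclusion\<close>

lemma gen_nth_eq_0: "gen n s z $ m = 0" if "m > (if s then (n + 1) div 2 else n div 2)"
proof -
  have "card {i \<in> {1..n}. odd i = s} = (if s then (n + 1) div 2 else n div 2)"
    using card_odd[of n] card_even[of n] by (cases s) simp_all
  then show ?thesis
    using fps_deg_le_prod_lin[of "{i \<in> {1..n}. odd i = s}" z] that by (simp add: gen_def fps_deg_le_def)
qed

text \<open>Degree m comes from the single index 2m - 1. The constant terms cancel, and for 2m - 1 >
  n both elementary symmetric polynomials are zero.\<close>

lemma gen_diff_eq_sum:
  "gen n True z - gen n False z = (\<Sum>i\<in>{i \<in> {1..n}. odd i}. fps_const (e_value n z i) * fps_X ^ ((i + 1) div 2))"
proof (rule fps_ext)
  fix m :: nat
  let ?m = "2 * m - 1"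
  have "(\<Sum>i\<in>{i \<in> {1..n}. odd i}. fps_const (e_value n z i) * fps_X ^ ((i + 1) div 2)) $ m =
      (\<Sum>i\<in>{i \<in> {1..n}. odd i}. if i = ?m \<and> m \<ge> 1 then e_value n z ?m else 0)"
    unfolding fps_sum_nth
    by (rule sum.cong) (auto simp: fps_X_power_nth elim!: oddE)
  also have "\<dots> = (if m \<ge> 1 \<and> ?m \<le> n then e_value n z ?m else 0)"
  proof (cases "m \<ge> 1")
    case True
    then have "odd ?m" "?m \<ge> 1" by presburger+
    with True show ?thesis by (auto simp: sum.delta)
  qed simp
  also have "\<dots> = (gen n True z - gen n False z) $ m"
  proof (cases "m \<ge> 1 \<and> ?m \<le> n")
    case True
    then have "odd ?m" by presburger
    with True show ?thesis by (simp add: e_value_def)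
  next
    case False
    show ?thesis
    proof (cases "m = 0")
      case True
      then show ?thesis by (simp add: gen_def)
    next
      case m: False
      then have "m > (n + 1) div 2" "m > n div 2" using False by presburger+
      then show ?thesis using False by (simp add: gen_nth_eq_0)
    qed
  qed
  finally show "(gen n True z - gen n False z) $ m =
      (\<Sum>i\<in>{i \<in> {1..n}. odd i}. fps_const (e_value n z i) * fps_X ^ ((i + 1) div 2)) $ m" ..
qed

lemma gen_even_eq_sum:
  "gen n False z - 1 = (\<Sum>i\<in>{i \<in> {1..n}. even i}. fps_const (e_value n z i) * fps_X ^ ((i + 1) div 2))"
proof (rule fps_ext)
  fix m :: nat
  have "(\<Sum>i\<in>{i \<in> {1..n}. even i}. fps_const (e_value n z i) * fps_X ^ ((i + 1) div 2)) $ m =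
      (\<Sum>i\<in>{i \<in> {1..n}. even i}. if i = 2 * m then e_value n z (2 * m) else 0)"
    unfolding fps_sum_nth
    by (rule sum.cong) (auto simp: fps_X_power_nth elim!: evenE)
  also have "\<dots> = (if m \<ge> 1 \<and> 2 * m \<le> n then e_value n z (2 * m) else 0)"
    by (auto simp: sum.delta)
  also have "\<dots> = (gen n False z - 1) $ m"
  proof (cases "m = 0")
    case True
    then show ?thesis by (simp add: gen_def)
  next
    case False
    then show ?thesis using gen_nth_eq_0[of False n m z] by (auto simp: e_value_def)
  qed
  finally show "(gen n False z - 1) $ m =
      (\<Sum>i\<in>{i \<in> {1..n}. even i}. fps_const (e_value n z i) * fps_X ^ ((i + 1) div 2)) $ m" ..
qed

text \<open>Given the others, the last two assumptions say that \<open>two_row a b\<close> lies in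
  \<open>Lambda n\<close> and that the denominator \<open>c_coeff r a b\<close> is nonzero.\<close>

theorem theorem5p4:
  fixes r :: "'a::field_char_0" and n a b :: nat
  assumes "n \<ge> 1"
    and "\<forall>q::rat. q < 0 \<longrightarrow> r \<noteq> of_rat q"
    and "b \<le> a"
    and "n \<ge> 2 \<or> b = 0"
    and "r \<noteq> 0 \<or> a = 0"
  shows "R_bar n r (two_row a b) =
    const (1 / c_coeff r a b) *
      (\<Sum>\<mu>\<in>{\<mu> \<in> Lambda n. odd_size n \<mu> = a \<and> even_size n \<mu> = b}.
         const (((- 2 * r) gchoose (\<mu> 1)) * diff_multinomial n \<mu>) * e_prod n r \<mu>)"
proof (rule mpoly_eqI)
  fix z :: "nat \<Rightarrow> 'a"
  let ?k = "a - b"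
  let ?M = "{\<mu> \<in> Lambda n. odd_size n \<mu> = a \<and> even_size n \<mu> = b}"
  \<comment> \<open>The first factor comes from the expansion in the generators and cancels; the
    second is the constant that normalizes the bracket monomial.\<close>
  have c: "c_coeff r a b = ((- 2 * r) gchoose ?k) * ((- 2 * r - of_nat ?k) gchoose b)"
  proof -
    have "((- 2 * r) gchoose ?k) * ((- 2 * r - of_nat ?k) gchoose b) * (fact ?k * fact b) =
        ((- 2 * r) gchoose a) * fact a"
      using falling_mult[of "- 2 * r" ?k b] assms(3) by simp
    moreover have "of_nat (a choose b) * (fact ?k * fact b) = (fact a :: 'a)"
      using binomial_fact[OF assms(3), where 'a = 'a] by simp
    ultimately have "((- 2 * r) gchoose ?k) * ((- 2 * r - of_nat ?k) gchoose b) * (fact ?k * fact b) =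
        c_coeff r a b * (fact ?k * fact b)"
      unfolding c_coeff_def by (metis mult.assoc mult.commute)
    then show ?thesis by simp
  qed
  have nz: "(- 2 * r) gchoose ?k \<noteq> 0"
    using gchoose_nonzero[OF assms(2), of ?k 0] assms(5) by auto
  have e: "eval_poly z (e_prod n r \<mu>) = (\<Prod>m=1..n. e_value n z m ^ (\<mu> m - \<mu> (m + 1)))" for \<mu>
    unfolding e_prod_def eval_poly_prod eval_poly_power
    by (rule prod.cong) (use eval_e_gen[OF assms(2)] in auto)
  have "eval_poly z (const (1 / c_coeff r a b) *
      (\<Sum>\<mu>\<in>?M. const (((- 2 * r) gchoose (\<mu> 1)) * diff_multinomial n \<mu>) * e_prod n r \<mu>)) =
      1 / c_coeff r a b * (\<Sum>\<mu>\<in>?M. ((- 2 * r) gchoose (\<mu> 1)) * diff_multinomial n \<mu> *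
        (\<Prod>m=1..n. e_value n z m ^ (\<mu> m - \<mu> (m + 1))))"
    by (simp add: eval_poly_mult eval_poly_sum e)
  also have "\<dots> = 1 / c_coeff r a b * (((- 2 * r) gchoose ?k) *
      ((gen n True z - gen n False z) ^ ?k * bin_prod n (- 2 * r - of_nat ?k) z) $ a)"
    unfolding sum_partitions_eq_coeff[OF assms(1,3)] gen_diff_eq_sum bin_prod_eq_compose gen_even_eq_sum ..
  also have "\<dots> = eval_poly z (R_bar n r (two_row a b))"
    unfolding eval_R_bar_two_row[OF assms] c using nz by (simp add: field_simps)
  finally show "eval_poly z (R_bar n r (two_row a b)) = eval_poly z (const (1 / c_coeff r a b) *
      (\<Sum>\<mu>\<in>?M. const (((- 2 * r) gchoose (\<mu> 1)) * diff_multinomial n \<mu>) * e_prod n r \<mu>))" ..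
qed

end
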